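(* Let $1\le p<\infty$ and $F\in L^p(\Theta)^n$. Then the functional $$\langle f,\varphi\rangle=\int_\Theta F(\theta)\cdot\varphi(X(\theta))\,d\theta\qquad(\varphi\in C_0^\infty(\Omega)^n)$$ is extended by continuity to a bounded linear functional on $W^{1,p'}_0(\Omega)^n$; that is, $f\in W^{-1,p}(\Omega)^n$.
   Context: Geometry. $\Omega\subset\mathbb{R}^n$, $n\in\{2,3\}$, is a (bounded) polyhedral domain with boundary $\partial\Omega$. It is divided into two disjoint components $\Omega_0,\Omega_1$ by a simple closed curve ($n=2$) or closed surface ($n=3$) $\Gamma$ (the immersed boundary), parametrized as $\Gamma=\{X(\theta)=(X_1(\theta),\dots,X_n(\theta)) : \theta\in\Theta\}$, where $\Theta\subset\mathbb{R}^{n-1}$ is bounded (and measurable). Define $J_X=\sqrt{|\partial X_1/\partial\theta|^2+|\partial X_2/\partial\theta|^2}$ if $n=2$, and $J_X=\sqrt{\left|\frac{\partial(X_2,X_3)}{\partial(\theta_1,\theta_2)}\right|^2+\left|\frac{\partial(X_3,X_1)}{\partial(\theta_1,\theta_2)}\right|^2+\left|\frac{\partial(X_1,X_2)}{\partial(\theta_1,\theta_2)}\right|^2}$ if $n=3$. Standing assumptions: $\Gamma$ is a $C^1$ boundary and $X$ is a $C^1$ function (up to the closure of $\Theta$); $\operatorname{dist}(\Gamma,\partial\Omega)>0$; $J_X(\theta)\ne0$ for all $\theta$ (in the closure of $\Theta$). Notation. $p'$ is the conjugate exponent, $1/p+1/p'=1$, $1\le p'\le\infty$. $W^{1,s}_0(\Omega)=\{v\in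 W^{1,s}(\Omega): v|_{\partial\Omega}=0\}$. $W^{-1,p}(\Omega)$ is the topological dual of $W^{1,p'}_0(\Omega)$ (and $W^{-1,p}(\Omega)^n$ the dual of $W^{1,p'}_0(\Omega)^n$). "Extended by continuity" means that there is a bounded linear functional on $W_0^{1,p'}(\Omega)^n$ agreeing with the displayed formula on $C_0^\infty(\Omega)^n$. *)

theory Defs
  imports "HOL-Analysis.Analysis" "HOL-Probability.Essential_Supremum"
begin

section \<open>Functions of class \<open>C\<^sup>k\<close> and test functions\<close>

definition partial_deriv ::
    "'a::euclidean_space \<Rightarrow> ('a \<Rightarrow> 'b::real_normed_vector) \<Rightarrow> 'a \<Rightarrow> 'b" where
  "partial_deriv b f x = frechet_derivative f (at x) b"

definition C1_on ::
    "'a::euclidean_space set \<Rightarrow> ('a \<Rightarrow> 'b::real_normed_vector) \<Rightarrow> bool" where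
  "C1_on U f \<longleftrightarrow> open U \<and> (\<forall>x\<in>U. f differentiable (at x)) \<and>
     (\<forall>b\<in>Basis. continuous_on U (partial_deriv b f))"

primrec Ck :: "nat \<Rightarrow> ('a::euclidean_space \<Rightarrow> 'b::real_normed_vector) \<Rightarrow> bool" where
  "Ck 0 f \<longleftrightarrow> continuous_on UNIV f"
| "Ck (Suc k) f \<longleftrightarrow> (\<forall>x. f differentiable (at x)) \<and> (\<forall>b\<in>Basis. Ck k (partial_deriv b f))"

text \<open>An element of \<open>C\<^sub>0\<^sup>\<infinity>(\<Omega>)\<close> is identified with its extension by zero to the whole space.\<close>

definition test_functions :: "'a::euclidean_space set \<Rightarrow> ('a \<Rightarrow> real) set" where
  "test_functions \<Omega> = {\<psi>. (\<forall>k. Ck k \<psi>) \<and>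
     compact (closure {x. \<psi> x \<noteq> 0}) \<and> closure {x. \<psi> x \<noteq> 0} \<subseteq> \<Omega>}"

section \<open>Lebesgue and Sobolev spaces\<close>

text \<open>Elements of these spaces are functions, not equivalence classes. Values off the
  underlying set are irrelevant, and the norms are seminorms vanishing on null functions; a
  linear functional bounded by such a seminorm is constant on equivalence classes.\<close>

definition conj_exponent :: "ennreal \<Rightarrow> ennreal" where
  "conj_exponent p = inverse (1 - inverse p)"

lemma conj_exponent:
  assumes "1 \<le> p"
  shows "1 / p + 1 / conj_exponent p = 1"
proof (cases p)
  case (real r)
  with assms have "1 \<le> r"
    by simp
  then show ?thesis
  proof (cases "r = 1")
    case True
    with real show ?thesis
      by (simp add: conj_exponent_def)
  next
    case False
    with \<open>1 \<le> r\<close> have r: "1 < r" "0 < 1 - inverse r"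
      by (simp_all add: field_simps)
    have "1 - inverse p = ennreal (1 - inverse r)"
      using real r by (simp add: inverse_ennreal ennreal_minus flip: ennreal_1)
    then have "conj_exponent p = ennreal (inverse (1 - inverse r))"
      unfolding conj_exponent_def using r by (simp add: inverse_ennreal)
    moreover have "0 < inverse (1 - inverse r)"
      using r(2) by (rule positive_imp_inverse_positive)
    ultimately have "1 / p + 1 / conj_exponent p = ennreal (1 / r) + ennreal (1 - inverse r)"
      using real r by (simp add: divide_ennreal inverse_eq_divide flip: ennreal_1)
    also have "\<dots> = 1"
      using r by (simp add: inverse_eq_divide flip: ennreal_plus)
    finally show ?thesis .
  qed
next
  case top
  then show ?thesis
    by (simp add: conj_exponent_def)
qed

definition Lp_space :: "'a measure \<Rightarrow> ennreal \<Rightarrow> ('a \<Rightarrow> real) set" where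
  "Lp_space M p = {f \<in> borel_measurable M.
     if p = \<infinity> then esssup M (\<lambda>x. ereal \<bar>f x\<bar>) < \<infinity>
     else integrable M (\<lambda>x. \<bar>f x\<bar> powr enn2real p)}"

definition Lp_norm :: "'a measure \<Rightarrow> ennreal \<Rightarrow> ('a \<Rightarrow> real) \<Rightarrow> real" where
  "Lp_norm M p f =
     (if p = \<infinity> then real_of_ereal (esssup M (\<lambda>x. ereal \<bar>f x\<bar>))
      else (LINT x|M. \<bar>f x\<bar> powr enn2real p) powr (1 / enn2real p))"

definition locally_integrable :: "'a::euclidean_space set \<Rightarrow> ('a \<Rightarrow> real) \<Rightarrow> bool" where
  "locally_integrable \<Omega> v \<longleftrightarrow> (\<forall>K. compact K \<and> K \<subseteq> \<Omega> \<longrightarrow> integrable (lebesgue_on K) v)"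

definition has_weak_partial ::
    "'a::euclidean_space set \<Rightarrow> 'a \<Rightarrow> ('a \<Rightarrow> real) \<Rightarrow> ('a \<Rightarrow> real) \<Rightarrow> bool" where
  "has_weak_partial \<Omega> b v g \<longleftrightarrow> locally_integrable \<Omega> v \<and> locally_integrable \<Omega> g \<and>
     (\<forall>\<psi>\<in>test_functions \<Omega>.
        (LINT x|lebesgue_on \<Omega>. v x * partial_deriv b \<psi> x) = - (LINT x|lebesgue_on \<Omega>. g x * \<psi> x))"

text \<open>The choice is immaterial: weak derivatives are unique up to null sets.\<close>

definition weak_partial ::
    "'a::euclidean_space set \<Rightarrow> 'a \<Rightarrow> ('a \<Rightarrow> real) \<Rightarrow> 'a \<Rightarrow> real" where
  "weak_partial \<Omega> b v = (SOME g. has_weak_partial \<Omega> b v g)"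

definition W1 :: "'a::euclidean_space set \<Rightarrow> ennreal \<Rightarrow> ('a \<Rightarrow> real) set" where
  "W1 \<Omega> s = {v \<in> Lp_space (lebesgue_on \<Omega>) s.
     \<forall>b\<in>Basis. \<exists>g \<in> Lp_space (lebesgue_on \<Omega>) s. has_weak_partial \<Omega> b v g}"

text \<open>The sum form is equivalent to the \<open>\<ell>\<^sup>s\<close> form of the norm and uniform in \<open>1 \<le> s \<le> \<infinity>\<close>.\<close>

definition W1_norm :: "'a::euclidean_space set \<Rightarrow> ennreal \<Rightarrow> ('a \<Rightarrow> real) \<Rightarrow> real" where
  "W1_norm \<Omega> s v = Lp_norm (lebesgue_on \<Omega>) s v +
     (\<Sum>b\<in>Basis. Lp_norm (lebesgue_on \<Omega>) s (weak_partial \<Omega> b v))"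

text \<open>Null sets of the \<open>d\<close>-dimensional Hausdorff measure, for \<open>d \<ge> 1\<close>. (No bound on the
  diameters of the covering sets is needed for nullity.)\<close>

definition hausdorff_null :: "nat \<Rightarrow> 'a::metric_space set \<Rightarrow> bool" where
  "hausdorff_null d N \<longleftrightarrow> (\<forall>\<epsilon>>0. \<exists>A :: nat \<Rightarrow> 'a set. N \<subseteq> (\<Union>i. A i) \<and> (\<forall>i. bounded (A i)) \<and>
     summable (\<lambda>i. diameter (A i) ^ d) \<and> (\<Sum>i. diameter (A i) ^ d) < \<epsilon>)"

text \<open>\<open>g\<close> is the trace of \<open>v\<close> on the boundary: at almost every boundary point, with respect to
  surface measure, \<open>g\<close> is the limit of \<open>v\<close> in the sense of averages over shrinking balls.\<close>

definition has_trace ::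
    "'a::euclidean_space set \<Rightarrow> ('a \<Rightarrow> real) \<Rightarrow> ('a \<Rightarrow> real) \<Rightarrow> bool" where
  "has_trace \<Omega> v g \<longleftrightarrow> hausdorff_null (DIM('a) - 1) {x \<in> frontier \<Omega>.
     \<not> ((\<lambda>r. (LINT y|lebesgue_on (\<Omega> \<inter> ball x r). \<bar>v y - g x\<bar>) / measure lebesgue (\<Omega> \<inter> ball x r))
         \<longlongrightarrow> 0) (at_right 0)}"

definition W1_0 :: "'a::euclidean_space set \<Rightarrow> ennreal \<Rightarrow> ('a \<Rightarrow> real) set" where
  "W1_0 \<Omega> s = {v \<in> W1 \<Omega> s. has_trace \<Omega> v (\<lambda>_. 0)}"

section \<open>Vector-valued spaces and dual spaces\<close>

definition vec_space :: "('a \<Rightarrow> real) set \<Rightarrow> ('a \<Rightarrow> real ^ 'n) set" where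
  "vec_space S = {u. \<forall>i. (\<lambda>x. u x $ i) \<in> S}"

definition vec_norm :: "(('a \<Rightarrow> real) \<Rightarrow> real) \<Rightarrow> ('a \<Rightarrow> real ^ 'n) \<Rightarrow> real" where
  "vec_norm N u = (\<Sum>i\<in>UNIV. N (\<lambda>x. u x $ i))"

definition dual_space ::
    "('a \<Rightarrow> 'b::real_vector) set \<Rightarrow> (('a \<Rightarrow> 'b) \<Rightarrow> real) \<Rightarrow> (('a \<Rightarrow> 'b) \<Rightarrow> real) set" where
  "dual_space V N = {f.
     (\<forall>u\<in>V. \<forall>v\<in>V. f (\<lambda>x. u x + v x) = f u + f v) \<and>
     (\<forall>c. \<forall>u\<in>V. f (\<lambda>x. c *\<^sub>R u x) = c * f u) \<and>
     (\<exists>C. \<forall>u\<in>V. \<bar>f u\<bar> \<le> C * N u)}"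

text \<open>The space \<open>W\<^sup>-\<^sup>1\<^sup>,\<^sup>p(\<Omega>)\<^sup>n\<close>. Members are regarded as functionals on \<open>W\<^sub>0\<^sup>1\<^sup>,\<^sup>p\<^sup>'(\<Omega>)\<^sup>n\<close> only;
  their values elsewhere are irrelevant.\<close>

definition W_minus1_vec ::
    "(real ^ 'n) set \<Rightarrow> ennreal \<Rightarrow> ((real ^ 'n \<Rightarrow> real ^ 'n) \<Rightarrow> real) set" where
  "W_minus1_vec \<Omega> p = dual_space (vec_space (W1_0 \<Omega> (conj_exponent p)))
     (vec_norm (W1_norm \<Omega> (conj_exponent p)))"

section \<open>Geometry of the immersed boundary\<close>

definition polyhedral_domain :: "'a::euclidean_space set \<Rightarrow> bool" where
  "polyhedral_domain \<Omega> \<longleftrightarrow> open \<Omega> \<and> connected \<Omega> \<and> \<Omega> \<noteq> {} \<and> bounded \<Omega> \<and>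
     (\<exists>\<F>. finite \<F> \<and> (\<forall>P\<in>\<F>. polytope P) \<and> frontier \<Omega> = \<Union>\<F>)"

definition simple_closed_curve :: "'a::topological_space set \<Rightarrow> bool" where
  "simple_closed_curve \<Gamma> \<longleftrightarrow>
     (\<exists>c. simple_path c \<and> pathfinish c = pathstart c \<and> path_image c = \<Gamma>)"

definition closed_surface :: "'a::topological_space set \<Rightarrow> bool" where
  "closed_surface \<Gamma> \<longleftrightarrow> \<Gamma> \<noteq> {} \<and> compact \<Gamma> \<and> connected \<Gamma> \<and>
     (\<forall>x\<in>\<Gamma>. \<exists>U. openin (top_of_set \<Gamma>) U \<and> x \<in> U \<and> U homeomorphic ball (0 :: real ^ 2) 1)"

text \<open>Near each of its points, \<open>\<Gamma>\<close> is the graph of a \<open>C\<^sup>1\<close> function over the hyperplane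
  orthogonal to some direction \<open>e\<close>, with \<open>\<Omega>\<^sub>0\<close> and \<open>\<Omega>\<^sub>1\<close> on the two sides of the graph.\<close>

definition C1_boundary ::
    "'a::euclidean_space set \<Rightarrow> 'a set \<Rightarrow> 'a set \<Rightarrow> bool" where
  "C1_boundary \<Omega>\<^sub>0 \<Omega>\<^sub>1 \<Gamma> \<longleftrightarrow>
     (\<forall>x\<in>\<Gamma>. \<exists>e (h :: 'a \<Rightarrow> real) r. norm e = 1 \<and> C1_on UNIV h \<and> r > 0 \<and>
        (\<forall>y\<in>ball x r.
           (y \<in> \<Gamma> \<longleftrightarrow> y \<bullet> e = h (y - (y \<bullet> e) *\<^sub>R e)) \<and>
           (y \<in> \<Omega>\<^sub>0 \<longleftrightarrow> y \<bullet> e < h (y - (y \<bullet> e) *\<^sub>R e)) \<and>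
           (y \<in> \<Omega>\<^sub>1 \<longleftrightarrow> y \<bullet> e > h (y - (y \<bullet> e) *\<^sub>R e))))"

text \<open>The part of the geometric hypotheses common to both dimensions. Being \<open>C\<^sup>1\<close> up to the
  closure of the (merely measurable) parameter set means being \<open>C\<^sup>1\<close> on an open set containing
  that closure.\<close>

definition immersed_boundary ::
    "'a::euclidean_space set \<Rightarrow> 'a set \<Rightarrow> 'a set \<Rightarrow> 'a set \<Rightarrow>
     'm::euclidean_space set \<Rightarrow> ('m \<Rightarrow> 'a) \<Rightarrow> bool" where
  "immersed_boundary \<Omega> \<Omega>\<^sub>0 \<Omega>\<^sub>1 \<Gamma> \<Theta> X \<longleftrightarrow>
     polyhedral_domain \<Omega> \<and> \<Gamma> \<subseteq> \<Omega> \<and>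
     \<Omega>\<^sub>0 \<noteq> \<Omega>\<^sub>1 \<and> components (\<Omega> - \<Gamma>) = {\<Omega>\<^sub>0, \<Omega>\<^sub>1} \<and>
     bounded \<Theta> \<and> \<Theta> \<in> sets lebesgue \<and> \<Gamma> = X ` \<Theta> \<and>
     C1_boundary \<Omega>\<^sub>0 \<Omega>\<^sub>1 \<Gamma> \<and> (\<exists>U. closure \<Theta> \<subseteq> U \<and> C1_on U X) \<and>
     setdist \<Gamma> (frontier \<Omega>) > 0"

definition J2 :: "(real \<Rightarrow> real ^ 2) \<Rightarrow> real \<Rightarrow> real" where
  "J2 X \<theta> = sqrt (\<bar>partial_deriv 1 (\<lambda>t. X t $ 1) \<theta>\<bar>\<^sup>2 + \<bar>partial_deriv 1 (\<lambda>t. X t $ 2) \<theta>\<bar>\<^sup>2)"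

definition jacobian_minor :: "(real ^ 2 \<Rightarrow> real ^ 3) \<Rightarrow> 3 \<Rightarrow> 3 \<Rightarrow> real ^ 2 \<Rightarrow> real" where
  "jacobian_minor X i j \<theta> =
     partial_deriv (axis 1 1) (\<lambda>t. X t $ i) \<theta> * partial_deriv (axis 2 1) (\<lambda>t. X t $ j) \<theta> -
     partial_deriv (axis 2 1) (\<lambda>t. X t $ i) \<theta> * partial_deriv (axis 1 1) (\<lambda>t. X t $ j) \<theta>"

definition J3 :: "(real ^ 2 \<Rightarrow> real ^ 3) \<Rightarrow> real ^ 2 \<Rightarrow> real" where
  "J3 X \<theta> = sqrt (\<bar>jacobian_minor X 2 3 \<theta>\<bar>\<^sup>2 + \<bar>jacobian_minor X 3 1 \<theta>\<bar>\<^sup>2 +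
     \<bar>jacobian_minor X 1 2 \<theta>\<bar>\<^sup>2)"

definition immersed_boundary_2 ::
    "(real ^ 2) set \<Rightarrow> (real ^ 2) set \<Rightarrow> (real ^ 2) set \<Rightarrow> (real ^ 2) set \<Rightarrow>
     real set \<Rightarrow> (real \<Rightarrow> real ^ 2) \<Rightarrow> bool" where
  "immersed_boundary_2 \<Omega> \<Omega>\<^sub>0 \<Omega>\<^sub>1 \<Gamma> \<Theta> X \<longleftrightarrow> immersed_boundary \<Omega> \<Omega>\<^sub>0 \<Omega>\<^sub>1 \<Gamma> \<Theta> X \<and>
     simple_closed_curve \<Gamma> \<and> (\<forall>\<theta>\<in>closure \<Theta>. J2 X \<theta> \<noteq> 0)"

definition immersed_boundary_3 ::
    "(real ^ 3) set \<Rightarrow> (real ^ 3) set \<Rightarrow> (real ^ 3) set \<Rightarrow> (real ^ 3) set \<Rightarrow>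
     (real ^ 2) set \<Rightarrow> (real ^ 2 \<Rightarrow> real ^ 3) \<Rightarrow> bool" where
  "immersed_boundary_3 \<Omega> \<Omega>\<^sub>0 \<Omega>\<^sub>1 \<Gamma> \<Theta> X \<longleftrightarrow> immersed_boundary \<Omega> \<Omega>\<^sub>0 \<Omega>\<^sub>1 \<Gamma> \<Theta> X \<and>
     closed_surface \<Gamma> \<and> (\<forall>\<theta>\<in>closure \<Theta>. J3 X \<theta> \<noteq> 0)"

end

theory Submission
  imports Defs "HOL-Library.Function_Algebras"
begin

text \<open>
  By the Hahn--Banach theorem (\<open>Hahn_Banach_seminorm\<close>, applied in \<open>boundary_functional_extends\<close>) a linear
  functional on test functions that is dominated there by the \<open>W\<^sup>1\<^sup>,\<^sup>p\<^sup>'\<close> norm extends to the whole Sobolev space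
  with the same bound, and \<open>F \<bullet> \<phi>(X)\<close> splits into components. So the theorem amounts to two facts: the norm is a
  seminorm on \<open>W\<^sup>1\<^sup>,\<^sup>p\<^sup>'\<close>, and \<open>\<bar>\<integral>\<^sub>\<Theta> F \<psi>(X)\<bar> \<le> K \<parallel>\<psi>\<parallel>\<close> for scalar test functions \<open>\<psi>\<close> (\<open>boundary_functional_bounded\<close>).

  For \<open>p = 1\<close> the second fact holds because a continuous function is bounded by its essential supremum. For
  \<open>p > 1\<close>, with \<open>r = p'\<close>, Young's inequality and a scaling argument reduce it to the trace inequality
  \<open>\<integral>\<^sub>\<Theta> \<bar>\<psi>(X)\<bar>\<^sup>r \<le> C \<integral> (\<bar>\<psi>\<bar>\<^sup>r + \<Sum>\<^sub>b \<bar>\<partial>\<^sub>b \<psi>\<bar>\<^sup>r)\<close> (\<open>trace_inequality\<close>), which is local because the closure of \<open>\<Theta>\<close> is compact.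
  Near a parameter \<open>\<theta>\<^sub>0\<close> the map \<open>X\<close> is an immersion, since its Jacobian does not vanish; choose a direction
  \<open>\<nu>\<close> outside the tangent space at \<open>X \<theta>\<^sub>0\<close>. Then \<open>\<Phi>(\<theta>, t) = X \<theta> + t \<nu>\<close> does not shrink distances by more than a
  constant factor, for \<open>\<theta>\<close> close to \<open>\<theta>\<^sub>0\<close> and all real \<open>t\<close> (\<open>transversal_expanding\<close>). A map between spaces of equal
  dimension with this property has preimages of measure at most a constant times that of the set
  (\<open>expanding_vimage_emeasure_le\<close>), so integrals of \<open>G \<circ> \<Phi>\<close> are bounded by integrals of \<open>G\<close>. On the other hand, the
  fundamental theorem of calculus along the line \<open>t \<mapsto> X \<theta> + t \<nu>\<close>, which leaves the support of \<open>\<psi>\<close>, bounds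
  \<open>\<bar>\<psi>(X \<theta>)\<bar>\<^sup>r\<close> by a constant times the line integral of \<open>\<bar>\<psi>\<bar>\<^sup>r + \<Sum>\<^sub>b \<bar>\<partial>\<^sub>b \<psi>\<bar>\<^sup>r\<close> (\<open>powr_le_line_integral\<close>). Integrating over \<open>\<theta>\<close>, Tonelli's theorem
  gives the local trace inequality.

  The first fact needs care because \<open>weak_partial\<close> is an arbitrary choice: that the chosen derivative lies in
  the Lebesgue space and depends linearly on the function up to null sets follows from the a.e. uniqueness of weak
  derivatives (\<open>weak_partial_unique\<close>). It rests on the fundamental lemma of the calculus of variations, for which products
  of one-dimensional functions \<open>exp (- 1 / t)\<close> supply smooth approximations of the indicators of boxes.
  Integration by parts (\<open>test_function_has_weak_partial\<close>) identifies the weak derivatives of a test function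
  with its classical ones.
\<close>

section \<open>Partial derivatives and smooth bump functions\<close>

lemma partial_deriv_eqI:
  assumes "(f has_derivative f') (at x)"
  shows "partial_deriv b f x = f' b"
  using frechet_derivative_at[OF assms] by (simp add: partial_deriv_def)

lemma partial_deriv_cong_open:
  assumes "open S" "x \<in> S" "\<And>y. y \<in> S \<Longrightarrow> f y = g y"
  shows "partial_deriv b f x = partial_deriv b g x"
proof -
  have "(f has_derivative D) (at x) \<longleftrightarrow> (g has_derivative D) (at x)" for D
    using assms by (auto intro: has_derivative_transform_within_open[where s = S])
  then show ?thesis
    by (simp add: partial_deriv_def frechet_derivative_def)
qed

lemma Ck_imp_continuous:
  "Ck k f \<Longrightarrow> continuous_on UNIV f"
  by (cases k) (auto simp: continuous_on_eq_continuous_within intro: differentiable_imp_continuous_within)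

lemma Ck_Suc_imp_Ck: "Ck (Suc k) f \<Longrightarrow> Ck k f"
proof (induction k arbitrary: f)
  case 0
  then show ?case using Ck_imp_continuous Ck.simps(1) by blast
next
  case (Suc k)
  then show ?case by (metis Ck.simps(2))
qed

lemma Ck_const: "Ck k (\<lambda>_::'a::euclidean_space. c::'b::real_normed_vector)"
proof (induction k arbitrary: c)
  case (Suc k)
  have "partial_deriv b (\<lambda>_. c) = (\<lambda>_::'a. 0)" for b
    by (rule ext) (auto intro: partial_deriv_eqI[OF has_derivative_const, THEN trans])
  with Suc[of 0] show ?case by simp
qed simp

lemma partial_deriv_add:
  assumes "f differentiable (at x)" "g differentiable (at x)"
  shows "partial_deriv b (\<lambda>x. f x + g x) x = partial_deriv b f x + partial_deriv b g x"
  using partial_deriv_eqI[OF has_derivative_add[OF assms[unfolded frechet_derivative_works]]]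
  by (simp add: partial_deriv_def)

lemma partial_deriv_mult:
  fixes f g :: "'a::euclidean_space \<Rightarrow> real"
  assumes "f differentiable (at x)" "g differentiable (at x)"
  shows "partial_deriv b (\<lambda>x. f x * g x) x = f x * partial_deriv b g x + partial_deriv b f x * g x"
  using partial_deriv_eqI[OF has_derivative_mult[OF assms[unfolded frechet_derivative_works]]]
  by (simp add: partial_deriv_def)

lemma Ck_add:
  assumes "Ck k f" "Ck k g"
  shows "Ck k (\<lambda>x. f x + g x)"
  using assms
proof (induction k arbitrary: f g)
  case (Suc k)
  then have "partial_deriv b (\<lambda>x. f x + g x) = (\<lambda>x. partial_deriv b f x + partial_deriv b g x)" for b
    by (auto intro!: partial_deriv_add)
  with Suc show ?case by auto
qed (auto intro: continuous_on_add)

lemma Ck_mult: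
  fixes f g :: "'a::euclidean_space \<Rightarrow> real"
  assumes "Ck k f" "Ck k g"
  shows "Ck k (\<lambda>x. f x * g x)"
  using assms
proof (induction k arbitrary: f g)
  case (Suc k)
  then have "partial_deriv b (\<lambda>x. f x * g x) = (\<lambda>x. f x * partial_deriv b g x + partial_deriv b f x * g x)" for b
    by (auto intro!: partial_deriv_mult)
  moreover have "Ck k f" "Ck k g"
    using Suc.prems Ck_Suc_imp_Ck by blast+
  ultimately show ?case using Suc by (auto intro!: Ck_add)
qed (auto intro: continuous_on_mult)

lemma Ck_prod:
  fixes f :: "'i \<Rightarrow> 'a::euclidean_space \<Rightarrow> real"
  assumes "\<And>i. i \<in> A \<Longrightarrow> Ck k (f i)"
  shows "Ck k (\<lambda>x. \<Prod>i\<in>A. f i x)"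
  using assms
  by (induction A rule: infinite_finite_induct) (auto intro: Ck_mult Ck_const)

text \<open>Derivatives of \<open>exp (- 1 / t)\<close>, extended by zero to \<open>t \<le> 0\<close>, are combinations of this function times powers of
\<open>1 / t\<close>. Carrying the power as a parameter makes the family closed under differentiation.\<close>

definition flat_exp :: "nat \<Rightarrow> real \<Rightarrow> real" where
  "flat_exp n t = (if t > 0 then (1 / t) ^ n * exp (- (1 / t)) else 0)"

lemma flat_exp_tendsto_0: "(flat_exp n \<longlongrightarrow> 0) (at 0)"
proof (rule filterlim_split_at)
  show "(flat_exp n \<longlongrightarrow> 0) (at_left 0)"
    by (rule tendsto_eventually) (auto simp: flat_exp_def eventually_at_filter)
  have "((\<lambda>t::real. inverse t ^ n / exp (inverse t)) \<longlongrightarrow> 0) (at_right 0)"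
    by (rule filterlim_compose[OF tendsto_power_div_exp_0 filterlim_inverse_at_top_right])
  moreover have "\<forall>\<^sub>F t in at_right 0. inverse t ^ n / exp (inverse t) = flat_exp n t"
    by (auto simp: flat_exp_def eventually_at_filter exp_minus divide_inverse)
  ultimately show "(flat_exp n \<longlongrightarrow> 0) (at_right 0)"
    using Lim_transform_eventually by blast
qed

lemma flat_exp_deriv:
  "(flat_exp n has_real_derivative flat_exp (n + 2) t - real n * flat_exp (n + 1) t) (at t)"
proof -
  consider "t < 0" | "t = 0" | "t > 0" by linarith
  then show ?thesis
  proof cases
    case 1
    show ?thesis
      by (rule has_field_derivative_transform_within_open[where f = "\<lambda>_. 0" and S = "{..<0}"])
         (use 1 in \<open>auto simp: flat_exp_def\<close>)
  next
    case 2
    have "\<forall>\<^sub>F h in at 0. flat_exp (n + 1) h = (flat_exp n (0 + h) - flat_exp n 0) / h"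
      by (auto simp: flat_exp_def eventually_at_filter)
    then show ?thesis
      unfolding 2 has_field_derivative_def DERIV_def[unfolded has_field_derivative_def]
      using flat_exp_tendsto_0[of "n + 1"] Lim_transform_eventually
      unfolding DERIV_def[symmetric] has_field_derivative_def[symmetric]
      by (auto simp: DERIV_def flat_exp_def[of _ 0])
  next
    case 3
    show ?thesis
    proof (rule has_field_derivative_transform_within_open
        [where f = "\<lambda>t. (1 / t) ^ n * exp (- (1 / t))" and S = "{0<..}"])
      have i: "((\<lambda>t. 1 / t) has_real_derivative - ((1/t)^2)) (at t)"
        using 3 by (auto intro!: derivative_eq_intros simp: power2_eq_square)
      have "((\<lambda>t. exp (- (1 / t))) has_real_derivative exp (- (1 / t)) * (1/t)^2) (at t)"
        using DERIV_fun_exp[OF DERIV_minus[OF i]] by simp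
      from DERIV_mult[OF DERIV_power[OF i, of n] this]
      have "((\<lambda>t. (1 / t) ^ n * exp (- (1 / t))) has_real_derivative
          real n * (1/t)^(n - 1) * (- ((1/t)^2)) * exp (- (1 / t)) + (1/t)^n * (exp (- (1 / t)) * (1/t)^2)) (at t)"
        by (simp add: mult_ac)
      moreover have "real n * (1/t)^(n - 1) * (- ((1/t)^2)) = - (real n * (1/t)^(n+1))"
        by (cases n) (auto simp: power2_eq_square)
      ultimately have "((\<lambda>t. (1 / t) ^ n * exp (- (1 / t))) has_real_derivative
          - (real n * (1/t)^(n+1)) * exp (- (1 / t)) + (1/t)^n * (exp (- (1 / t)) * (1/t)^2)) (at t)"
        by (simp only:)
      also have "- (real n * (1/t)^(n+1)) * exp (- (1 / t)) + (1/t)^n * (exp (- (1 / t)) * (1/t)^2) =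
          flat_exp (n + 2) t - real n * flat_exp (n + 1) t"
        using 3 by (simp add: flat_exp_def power_add power2_eq_square)
      finally show "((\<lambda>t. (1 / t) ^ n * exp (- (1 / t))) has_real_derivative
          flat_exp (n + 2) t - real n * flat_exp (n + 1) t) (at t)" .
    qed (use 3 in \<open>auto simp: flat_exp_def\<close>)
  qed
qed

text \<open>The derivative formula \<open>flat_exp_deriv\<close> stays inside the family, so induction on the order of differentiability works
once the power is kept arbitrary.\<close>

lemma Ck_flat_exp_affine:
  "Ck k (\<lambda>x::'a::euclidean_space. flat_exp n (x \<bullet> v + d))"
proof (induction k arbitrary: n)
  case 0
  have "isCont (flat_exp n) t" for t
    using flat_exp_deriv DERIV_isCont by blast
  then have "continuous_on UNIV (flat_exp n)"
    by (simp add: continuous_on_eq_continuous_within)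
  then show ?case
    by (auto intro!: continuous_on_compose2[of UNIV "flat_exp n"] continuous_intros)
next
  case (Suc k)
  have D: "((\<lambda>x. flat_exp n (x \<bullet> v + d)) has_derivative
      (\<lambda>h. (h \<bullet> v) * (flat_exp (n + 2) (x \<bullet> v + d) - real n * flat_exp (n + 1) (x \<bullet> v + d)))) (at x)" for x
  proof -
    have "((\<lambda>x. x \<bullet> v + d) has_derivative (\<lambda>h. h \<bullet> v)) (at x)"
      by (auto intro!: derivative_eq_intros)
    from has_derivative_compose[OF this flat_exp_deriv[of n, unfolded has_field_derivative_def]]
    show ?thesis by (simp add: mult.commute)
  qed
  then have "partial_deriv b (\<lambda>x. flat_exp n (x \<bullet> v + d)) =
      (\<lambda>x. (b \<bullet> v) * (flat_exp (n + 2) (x \<bullet> v + d) + (- real n) * flat_exp (n + 1) (x \<bullet> v + d)))" for b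
    using partial_deriv_eqI[OF D] by (auto simp: fun_eq_iff)
  moreover have "Ck k (\<lambda>x. (b \<bullet> v) * (flat_exp (n + 2) (x \<bullet> v + d) + (- real n) * flat_exp (n + 1) (x \<bullet> v + d)))" for b
    by (intro Ck_mult Ck_add Ck_const Suc)
  ultimately show ?case
    using D by (auto simp: differentiable_def)
qed

text \<open>Each factor \<open>exp (- 1 / ((n + 1) s))\<close> tends to 1 for \<open>s > 0\<close> and vanishes for \<open>s \<le> 0\<close>, so these functions increase
to the indicator of the open box and vanish outside it for every \<open>n\<close>.\<close>

definition box_bump :: "'a::euclidean_space \<Rightarrow> 'a \<Rightarrow> nat \<Rightarrow> 'a \<Rightarrow> real" where
  "box_bump a b n x = (\<Prod>i\<in>Basis. flat_exp 0 (real (Suc n) * (x \<bullet> i - a \<bullet> i)) *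
                                   flat_exp 0 (real (Suc n) * (b \<bullet> i - x \<bullet> i)))"

lemma flat_exp_0_bounds: "0 \<le> flat_exp 0 t" "flat_exp 0 t \<le> 1"
  by (auto simp: flat_exp_def)

lemma Ck_box_bump: "Ck k (box_bump a b n)"
proof -
  have "Ck k (\<lambda>x. flat_exp 0 (x \<bullet> (real (Suc n) *\<^sub>R i) + - real (Suc n) * (a \<bullet> i)) *
                                   flat_exp 0 (x \<bullet> (- real (Suc n) *\<^sub>R i) + real (Suc n) * (b \<bullet> i)))" for i
    by (intro Ck_mult Ck_flat_exp_affine)
  then have "Ck k (\<lambda>x. \<Prod>i\<in>Basis. flat_exp 0 (x \<bullet> (real (Suc n) *\<^sub>R i) + - real (Suc n) * (a \<bullet> i)) *
                                   flat_exp 0 (x \<bullet> (- real (Suc n) *\<^sub>R i) + real (Suc n) * (b \<bullet> i)))"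
    by (rule Ck_prod)
  then show ?thesis
    by (simp add: box_bump_def[abs_def] algebra_simps)
qed

lemma box_bump_bounds: "0 \<le> box_bump a b n x" "box_bump a b n x \<le> 1"
  unfolding box_bump_def using flat_exp_0_bounds
  by (auto intro!: prod_nonneg prod_le_1 mult_nonneg_nonneg mult_le_one)

lemma box_bump_eq_0: 
  assumes "x \<notin> box a b"
  shows "box_bump a b n x = 0"
proof -
  obtain i where "i \<in> Basis" "x \<bullet> i \<le> a \<bullet> i \<or> b \<bullet> i \<le> x \<bullet> i"
    using assms by (auto simp: mem_box not_less)
  then show ?thesis
    unfolding box_bump_def
    by (intro prod_zero bexI[of _ i]) (auto simp: flat_exp_def zero_less_mult_iff)
qed

lemma box_bump_tendsto_indicator: "(\<lambda>n. box_bump a b n x) \<longlonglongrightarrow> indicator (box a b) x"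
proof (cases "x \<in> box a b")
  case True
  have 1: "(\<lambda>n. flat_exp 0 (real (Suc n) * s)) \<longlonglongrightarrow> 1" if "s > 0" for s
  proof -
    have "(\<lambda>n. exp (- (inverse (real (Suc n)) * (1 / s)))) \<longlonglongrightarrow> exp (- (0 * (1 / s)))"
      by (intro tendsto_intros LIMSEQ_inverse_real_of_nat)
    moreover have "exp (- (inverse (real (Suc n)) * (1 / s))) = flat_exp 0 (real (Suc n) * s)" for n
      using that by (simp add: flat_exp_def field_simps zero_less_mult_iff del: of_nat_Suc)
    ultimately show ?thesis by simp
  qed
  have "(\<lambda>n. box_bump a b n x) \<longlonglongrightarrow> (\<Prod>i\<in>(Basis::'a set). 1 * 1)"
    unfolding box_bump_def using True
    by (intro tendsto_prod tendsto_mult 1) (auto simp: mem_box)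
  then show ?thesis using True by simp
qed (simp add: box_bump_eq_0)

lemma box_bump_test_function:
  assumes "cbox a b \<subseteq> \<Omega>"
  shows "box_bump a b n \<in> test_functions \<Omega>"
proof -
  have "{x. box_bump a b n x \<noteq> 0} \<subseteq> cbox a b"
    using box_bump_eq_0 box_subset_cbox by blast
  then have *: "closure {x. box_bump a b n x \<noteq> 0} \<subseteq> cbox a b"
    by (intro closure_minimal closed_cbox)
  then have "compact (closure {x. box_bump a b n x \<noteq> 0})"
    by (metis bounded_subset bounded_cbox closed_closure compact_eq_bounded_closed)
  then show ?thesis
    using * assms Ck_box_bump by (auto simp: test_functions_def)
qed

section \<open>The fundamental lemma and uniqueness of weak derivatives\<close>

definition test_supp :: "('a::topological_space \<Rightarrow> real) \<Rightarrow> 'a set" where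
  "test_supp \<psi> = closure {x. \<psi> x \<noteq> 0}"

lemma test_function_props:
  assumes "\<psi> \<in> test_functions \<Omega>"
  shows "compact (test_supp \<psi>)" "test_supp \<psi> \<subseteq> \<Omega>" 
    "\<And>x. \<psi> differentiable (at x)" "continuous_on UNIV \<psi>"
    "\<And>b. b \<in> Basis \<Longrightarrow> continuous_on UNIV (partial_deriv b \<psi>)"
    "\<And>x. x \<notin> test_supp \<psi> \<Longrightarrow> \<psi> x = 0" 
    "\<And>x b. x \<notin> test_supp \<psi> \<Longrightarrow> partial_deriv b \<psi> x = 0"
proof -
  have Ck: "Ck k \<psi>" for k
    using assms by (simp add: test_functions_def)
  show "compact (test_supp \<psi>)" "test_supp \<psi> \<subseteq> \<Omega>"
    using assms by (auto simp: test_functions_def test_supp_def)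
  show "\<psi> differentiable (at x)" for x
    using Ck[of "Suc 0"] by simp
  show "continuous_on UNIV \<psi>"
    using Ck[of 0] by simp
  show "continuous_on UNIV (partial_deriv b \<psi>)" if "b \<in> Basis" for b
    using Ck[of "Suc 0"] that by simp
  show 0: "\<psi> x = 0" if "x \<notin> test_supp \<psi>" for x
    using that subsetD[OF closure_subset, of x "{x. \<psi> x \<noteq> 0}"] by (auto simp: test_supp_def)
  show "partial_deriv b \<psi> x = 0" if "x \<notin> test_supp \<psi>" for x b
  proof -
    have "partial_deriv b \<psi> x = partial_deriv b (\<lambda>_. 0) x"
    proof (rule partial_deriv_cong_open)
      show "open (- test_supp \<psi>)"
        by (simp add: test_supp_def open_Compl)
      show "x \<in> - test_supp \<psi>"
        using that by simp
      show "\<psi> y = 0" if "y \<in> - test_supp \<psi>" for y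
        using that 0 by blast
    qed
    also have "\<dots> = 0"
      by (rule partial_deriv_eqI[OF has_derivative_const])
    finally show ?thesis .
  qed
qed

text \<open>On the compact set \<open>K\<close> the factor \<open>\<psi>\<close> is bounded, and off \<open>K\<close> the product vanishes.\<close>

lemma locally_integrable_mult:
  fixes v \<psi> :: "'a::euclidean_space \<Rightarrow> real"
  assumes v: "locally_integrable \<Omega> v" and \<Omega>: "open \<Omega>" and \<psi>: "continuous_on UNIV \<psi>"
    and K: "compact K" "K \<subseteq> \<Omega>" "\<And>x. x \<notin> K \<Longrightarrow> \<psi> x = 0"
  shows "integrable (lebesgue_on \<Omega>) (\<lambda>x. v x * \<psi> x)"
proof -
  have v': "integrable (lebesgue_on K) v"
    using v K by (simp add: locally_integrable_def)
  have K': "K \<in> sets lebesgue"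
    using K(1) by (simp add: borel_compact)
  have \<psi>K: "continuous_on K \<psi>"
    using \<psi> continuous_on_subset by blast
  then obtain B where B: "\<And>x. x \<in> K \<Longrightarrow> \<bar>\<psi> x\<bar> \<le> B"
    using compact_imp_bounded[OF compact_continuous_image[OF \<psi>K K(1)]]
    by (auto simp: bounded_iff)
  have "integrable (lebesgue_on K) (\<lambda>x. v x * \<psi> x)"
  proof (rule Bochner_Integration.integrable_bound)
    show "integrable (lebesgue_on K) (\<lambda>x. B * v x)"
      using v' by simp
    show "(\<lambda>x. v x * \<psi> x) \<in> borel_measurable (lebesgue_on K)"
      using v' continuous_imp_measurable_on_sets_lebesgue[OF \<psi>K K'] by (intro borel_measurable_times) auto
    show "AE x in lebesgue_on K. norm (v x * \<psi> x) \<le> norm (B * v x)"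
    proof (rule AE_I2)
      fix x assume "x \<in> space (lebesgue_on K)"
      then have "\<bar>\<psi> x\<bar> \<le> \<bar>B\<bar>" using B by force
      then show "norm (v x * \<psi> x) \<le> norm (B * v x)"
        by (simp add: abs_mult mult.commute mult_right_mono)
    qed
  qed
  then have "integrable lebesgue (\<lambda>x. indicator K x *\<^sub>R (v x * \<psi> x))"
    using K' by (subst (asm) integrable_restrict_space) auto
  also have "(\<lambda>x. indicator K x *\<^sub>R (v x * \<psi> x)) = (\<lambda>x. indicator \<Omega> x *\<^sub>R (v x * \<psi> x))"
    using K by (auto simp: fun_eq_iff split: split_indicator)
  finally show ?thesis
    using \<Omega> by (subst integrable_restrict_space) auto
qed

lemma integrable_lebesgue_on_subset:
  fixes f :: "'a::euclidean_space \<Rightarrow> real"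
  assumes "integrable (lebesgue_on T) f" "S \<subseteq> T" "S \<in> sets lebesgue" "T \<in> sets lebesgue"
  shows "integrable (lebesgue_on S) f"
proof -
  have "set_integrable lebesgue T f"
    using assms by (simp add: set_integrable_def integrable_restrict_space)
  then have "set_integrable lebesgue S f"
    by (rule set_integrable_subset) (use assms in auto)
  then show ?thesis
    using assms by (simp add: set_integrable_def integrable_restrict_space)
qed

text \<open>The box bumps are test functions dominated by the indicator of the closed box, so the hypothesis passes to the limit.\<close>

lemma integral_cbox_eq_0:
  fixes d :: "'a::euclidean_space \<Rightarrow> real"
  assumes d: "locally_integrable \<Omega> d" and \<Omega>: "open \<Omega>"
    and 0: "\<And>\<psi>. \<psi> \<in> test_functions \<Omega> \<Longrightarrow> (LINT x|lebesgue_on \<Omega>. d x * \<psi> x) = 0"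
    and ab: "cbox a b \<subseteq> \<Omega>"
  shows "integral (cbox a b) d = 0"
proof -
  have int: "integrable (lebesgue_on (cbox a b)) d"
    using d ab by (simp add: locally_integrable_def)
  then have "integrable lebesgue (\<lambda>x. indicator (cbox a b) x *\<^sub>R d x)"
    by (subst (asm) integrable_restrict_space) auto
  moreover have "indicator (cbox a b) x *\<^sub>R d x = indicator \<Omega> x *\<^sub>R (indicator (cbox a b) x * d x)"
    for x
    using ab by (auto split: split_indicator)
  ultimately have int2: "integrable (lebesgue_on \<Omega>) (\<lambda>x. indicator (cbox a b) x * d x)"
    using \<Omega> by (subst integrable_restrict_space) (simp_all only:, auto)
  have bump: "integrable (lebesgue_on \<Omega>) (\<lambda>x. d x * box_bump a b n x)" for n
    using d \<Omega> _ compact_cbox ab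
  proof (rule locally_integrable_mult)
    show "continuous_on UNIV (box_bump a b n)"
      using Ck_box_bump Ck.simps(1) by blast
    show "box_bump a b n x = 0" if "x \<notin> cbox a b" for x
      using that box_bump_eq_0 box_subset_cbox by blast
  qed
  have lim: "(\<lambda>n. d x * box_bump a b n x) \<longlonglongrightarrow> d x * indicator (box a b) x" for x
    by (intro tendsto_intros box_bump_tendsto_indicator)
  have "(\<lambda>n. LINT x|lebesgue_on \<Omega>. d x * box_bump a b n x) \<longlonglongrightarrow>
      (LINT x|lebesgue_on \<Omega>. d x * indicator (box a b) x)"
  proof (rule integral_dominated_convergence[where w = "\<lambda>x. \<bar>indicator (cbox a b) x * d x\<bar>"])
    show "(\<lambda>x. d x * indicator (box a b) x) \<in> borel_measurable (lebesgue_on \<Omega>)"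
      by (rule borel_measurable_LIMSEQ_real[OF lim]) (use bump in auto)
    show "AE x in lebesgue_on \<Omega>. norm (d x * box_bump a b n x) \<le> \<bar>indicator (cbox a b) x * d x\<bar>" for n
    proof (rule AE_I2)
      fix x
      show "norm (d x * box_bump a b n x) \<le> \<bar>indicator (cbox a b) x * d x\<bar>"
        using box_bump_bounds[of a b n x] box_bump_eq_0[of x a b n] box_subset_cbox[of a b]
        by (cases "x \<in> box a b") (auto simp: abs_mult mult_left_le)
    qed
  qed (use bump int2 lim in \<open>auto intro: borel_measurable_integrable\<close>)
  moreover have "(LINT x|lebesgue_on \<Omega>. d x * box_bump a b n x) = 0" for n
    using 0 box_bump_test_function ab by blast
  ultimately have "0 = (LINT x|lebesgue_on \<Omega>. d x * indicator (box a b) x)"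
    by (simp add: LIMSEQ_const_iff)
  also have "\<dots> = (LINT x|lebesgue. indicator \<Omega> x *\<^sub>R (d x * indicator (box a b) x))"
    using \<Omega> by (subst integral_restrict_space) auto
  also have "\<dots> = (LINT x|lebesgue. indicator (box a b) x *\<^sub>R d x)"
    using ab box_subset_cbox[of a b]
    by (intro Bochner_Integration.integral_cong) (auto split: split_indicator)
  also have "\<dots> = (LINT x|lebesgue_on (box a b). d x)"
    by (subst integral_restrict_space) auto
  also have "\<dots> = integral (box a b) d"
  proof (rule lebesgue_integral_eq_integral)
    show "integrable (lebesgue_on (box a b)) d"
      using int box_subset_cbox by (rule integrable_lebesgue_on_subset) auto
  qed auto
  finally show ?thesis
    by (simp add: integral_open_interval)
qed

text \<open>Almost everywhere an integrable function is the limit of its averages over shrinking cubes; here all these averages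
vanish.\<close>

lemma fundamental_lemma_calculus_of_variations:
  fixes d :: "'a::euclidean_space \<Rightarrow> real"
  assumes d: "locally_integrable \<Omega> d" and \<Omega>: "open \<Omega>"
    and 0: "\<And>\<psi>. \<psi> \<in> test_functions \<Omega> \<Longrightarrow> (LINT x|lebesgue_on \<Omega>. d x * \<psi> x) = 0"
  shows "AE x in lebesgue_on \<Omega>. d x = 0"
proof -
  obtain \<D> where \<D>: "countable \<D>" "\<D> \<subseteq> Pow \<Omega>" "\<And>X. X \<in> \<D> \<Longrightarrow> \<exists>a b. X = cbox a b" "\<Union>\<D> = \<Omega>"
    using open_countable_Union_open_cbox[OF \<Omega>] by metis
  have "AE x in lebesgue. x \<in> Q \<longrightarrow> d x = 0" if Q: "Q \<in> \<D>" for Q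
  proof -
    obtain a b where ab: "Q = cbox a b" "cbox a b \<subseteq> \<Omega>"
      using \<D>(3)[OF Q] \<D>(2) Q by auto
    define f where "f x = (if x \<in> cbox a b then d x else 0)" for x
    have sub: "integral (cbox c e) f = 0 \<and> f integrable_on cbox c e" for c e
    proof -
      obtain c' e' where ce: "cbox c e \<inter> cbox a b = cbox c' e'"
        using Int_interval by blast
      then have sub: "cbox c' e' \<subseteq> cbox a b" "cbox c' e' \<subseteq> \<Omega>"
        using ab(2) by auto
      have "integrable (lebesgue_on (cbox c' e')) d"
        using d sub(2) by (simp add: locally_integrable_def)
      then have "d integrable_on cbox c' e'"
        by (simp add: integrable_on_lebesgue_on)
      then have "(d has_integral 0) (cbox c' e')"
        using integral_cbox_eq_0[OF d \<Omega> 0 sub(2)] integrable_integral by force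
      then have "(f has_integral 0) (cbox c e)"
        unfolding f_def ce[symmetric] by (subst has_integral_restrict_Int) (simp add: Int_commute)
      then show ?thesis by blast
    qed
    have "f integrable_on cbox c e" for c e
      using sub by simp
    then obtain N where N: "negligible N"
      "\<And>x e. \<lbrakk>x \<notin> N; 0 < e\<rbrakk> \<Longrightarrow> \<exists>\<delta>>0. \<forall>h. 0 < h \<and> h < \<delta> \<longrightarrow>
          norm (integral (cbox x (x + h *\<^sub>R One)) f /\<^sub>R h ^ DIM('a) - f x) < e"
      using integrable_ccontinuous_explicit[of f] by blast
    have "f x = 0" if "x \<notin> N" for x
    proof (rule ccontr)
      assume "f x \<noteq> 0"
      then obtain \<delta> where "\<delta> > 0" "\<forall>h. 0 < h \<and> h < \<delta> \<longrightarrow>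
          norm (integral (cbox x (x + h *\<^sub>R One)) f /\<^sub>R h ^ DIM('a) - f x) < norm (f x)"
        using N(2)[OF \<open>x \<notin> N\<close>, of "norm (f x)"] by auto
      moreover obtain h where "0 < h" "h < \<delta>"
        using dense[OF \<open>\<delta> > 0\<close>] by blast
      ultimately show False
        using sub by auto
    qed
    then have "{x \<in> space lebesgue. \<not> (x \<in> Q \<longrightarrow> d x = 0)} \<subseteq> N"
      unfolding f_def ab(1) by (smt (verit) mem_Collect_eq subsetI)
    moreover have "N \<in> null_sets lebesgue"
      using N(1) by (simp add: negligible_iff_null_sets)
    ultimately show ?thesis by (intro AE_I'[of N])
  qed
  then have "AE x in lebesgue. \<forall>Q\<in>\<D>. x \<in> Q \<longrightarrow> d x = 0"
    unfolding AE_ball_countable[OF \<D>(1)] by (intro ballI)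
  then have "AE x in lebesgue. x \<in> \<Omega> \<longrightarrow> d x = 0"
    unfolding \<D>(4)[symmetric] Union_iff by (rule AE_mp) (intro AE_I2 impI, blast)
  then show ?thesis
    using \<Omega> by (simp add: AE_restrict_space_iff)
qed

lemma weak_partial_unique:
  assumes \<Omega>: "open \<Omega>" and g: "has_weak_partial \<Omega> b v g" and h: "has_weak_partial \<Omega> b v h"
  shows "AE x in lebesgue_on \<Omega>. g x = h x"
proof -
  have "locally_integrable \<Omega> (\<lambda>x. g x - h x)"
    using g h by (auto simp: has_weak_partial_def locally_integrable_def)
  moreover have "(LINT x|lebesgue_on \<Omega>. (g x - h x) * \<psi> x) = 0" if \<psi>: "\<psi> \<in> test_functions \<Omega>" for \<psi>
  proof -
    note p = test_function_props[OF \<psi>]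
    have "integrable (lebesgue_on \<Omega>) (\<lambda>x. g x * \<psi> x)" "integrable (lebesgue_on \<Omega>) (\<lambda>x. h x * \<psi> x)"
      using g h locally_integrable_mult[OF _ \<Omega> p(4) p(1) p(2) p(6)]
      by (auto simp: has_weak_partial_def)
    moreover have "(LINT x|lebesgue_on \<Omega>. g x * \<psi> x) = (LINT x|lebesgue_on \<Omega>. h x * \<psi> x)"
      using g h \<psi> unfolding has_weak_partial_def by force
    ultimately show ?thesis by (simp add: left_diff_distrib)
  qed
  ultimately have "AE x in lebesgue_on \<Omega>. g x - h x = 0"
    using \<Omega> by (intro fundamental_lemma_calculus_of_variations) auto
  then show ?thesis by simp
qed

section \<open>The Lebesgue norms are seminorms\<close>

text \<open>At the origin, which convexity on the positive half-line does not reach, \<open>\<alpha>\<^sup>r \<le> \<alpha>\<close> for \<open>0 \<le> \<alpha> \<le> 1\<close> gives the inequality.\<close>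

lemma powr_convex_combination:
  fixes x y \<alpha> \<beta> r :: real
  assumes "r \<ge> 1" "x \<ge> 0" "y \<ge> 0" "\<alpha> \<ge> 0" "\<beta> \<ge> 0" "\<alpha> + \<beta> = 1"
  shows "(\<alpha> * x + \<beta> * y) powr r \<le> \<alpha> * x powr r + \<beta> * y powr r"
proof -
  have le: "t powr r \<le> t" if "0 \<le> t" "t \<le> 1" for t :: real
    using that powr_mono'[of 1 r t] assms(1) by simp
  consider "x = 0" | "y = 0" | "x > 0" "y > 0"
    using assms by linarith
  then show ?thesis
  proof cases
    case 1
    then show ?thesis
      using le[of \<beta>] assms by (simp add: powr_mult mult_right_mono)
  next
    case 2
    then show ?thesis
      using le[of \<alpha>] assms by (simp add: powr_mult mult_right_mono)
  next
    case 3
    then show ?thesis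
      using powr_convex[OF assms(1)] assms by (auto simp: convex_on_def)
  qed
qed

lemma Lp_space_finite_iff:
  "Lp_space M (ennreal r) = {f \<in> borel_measurable M. integrable M (\<lambda>x. \<bar>f x\<bar> powr r)}" if "r \<ge> 0"
  using that by (simp add: Lp_space_def)

lemma Lp_norm_finite:
  "Lp_norm M (ennreal r) f = (LINT x|M. \<bar>f x\<bar> powr r) powr (1 / r)" if "r \<ge> 0"
  using that by (simp add: Lp_norm_def)

lemma Lp_norm_finite_powr:
  assumes "r > 0"
  shows "Lp_norm M (ennreal r) f powr r = (LINT x|M. \<bar>f x\<bar> powr r)"
  using assms by (simp add: Lp_norm_finite powr_powr integral_nonneg_AE)

lemma abs_add_powr_le:
  fixes f g a b r :: real
  assumes r: "r \<ge> 1" and "a > 0" "b > 0"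
  shows "\<bar>f + g\<bar> powr r \<le> (a + b) powr r * (a / (a + b) * (\<bar>f\<bar> powr r / a powr r) + b / (a + b) * (\<bar>g\<bar> powr r / b powr r))"
proof -
  have ab: "a / (a + b) + b / (a + b) = 1"
    using assms by (simp add: add_divide_distrib[symmetric])
  have "(a + b) * (a / (a + b) * (\<bar>f\<bar> / a) + b / (a + b) * (\<bar>g\<bar> / b)) = \<bar>f\<bar> + \<bar>g\<bar>"
    using assms by (simp add: distrib_left)
  then have "\<bar>f + g\<bar> powr r \<le> ((a + b) * (a / (a + b) * (\<bar>f\<bar> / a) + b / (a + b) * (\<bar>g\<bar> / b))) powr r"
    using assms by (intro powr_mono2) auto
  also have "\<dots> = (a + b) powr r * (a / (a + b) * (\<bar>f\<bar> / a) + b / (a + b) * (\<bar>g\<bar> / b)) powr r"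
    by (rule powr_mult)
  also have "\<dots> \<le> (a + b) powr r * (a / (a + b) * (\<bar>f\<bar> / a) powr r + b / (a + b) * (\<bar>g\<bar> / b) powr r)"
    using assms ab by (intro mult_left_mono powr_convex_combination) auto
  finally show ?thesis
    using assms by (simp add: powr_divide)
qed

text \<open>Minkowski's inequality by convexity: for \<open>a\<close> and \<open>b\<close> larger than the norms of \<open>f\<close> and \<open>g\<close>, integrating
\<open>abs_add_powr_le\<close> shows that the norm of \<open>f + g\<close> is at most \<open>a + b\<close>. Taking \<open>a\<close> and \<open>b\<close> strictly larger than the norms
avoids dividing by zero.\<close>

lemma Lp_add_finite:
  assumes r: "r \<ge> 1" and f: "f \<in> Lp_space M (ennreal r)" and g: "g \<in> Lp_space M (ennreal r)"
  shows "(\<lambda>x. f x + g x) \<in> Lp_space M (ennreal r)"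
    and "Lp_norm M (ennreal r) (\<lambda>x. f x + g x) \<le> Lp_norm M (ennreal r) f + Lp_norm M (ennreal r) g"
proof -
  have [measurable]: "f \<in> borel_measurable M" "g \<in> borel_measurable M"
    and int: "integrable M (\<lambda>x. \<bar>f x\<bar> powr r)" "integrable M (\<lambda>x. \<bar>g x\<bar> powr r)"
    using f g r by (auto simp: Lp_space_finite_iff)
  define bd where "bd a b x = (a + b) powr r * (a / (a + b) * (\<bar>f x\<bar> powr r / a powr r) + b / (a + b) * (\<bar>g x\<bar> powr r / b powr r))"
    for a b x
  have int_bd: "integrable M (bd a b)" for a b
    unfolding bd_def using int by (intro integrable_mult_right Bochner_Integration.integrable_add integrable_divide)
  have le_bd: "\<bar>f x + g x\<bar> powr r \<le> bd a b x" if "a > 0" "b > 0" for a b x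
    unfolding bd_def by (rule abs_add_powr_le) (use r that in auto)
  have int_sum: "integrable M (\<lambda>x. \<bar>f x + g x\<bar> powr r)"
  proof (rule Bochner_Integration.integrable_bound[OF int_bd[of 1 1]])
    show "AE x in M. norm (\<bar>f x + g x\<bar> powr r) \<le> norm (bd 1 1 x)"
      using le_bd[of 1 1] by (intro AE_I2) (simp add: order_trans[OF _ abs_ge_self])
  qed simp
  then show "(\<lambda>x. f x + g x) \<in> Lp_space M (ennreal r)"
    using r by (simp add: Lp_space_finite_iff)
  let ?A = "Lp_norm M (ennreal r) f" and ?B = "Lp_norm M (ennreal r) g"
  have nonneg: "?A \<ge> 0" "?B \<ge> 0"
    using r by (auto simp: Lp_norm_finite)
  have "Lp_norm M (ennreal r) (\<lambda>x. f x + g x) \<le> ?A + ?B + e" if "e > 0" for e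
  proof -
    define a b where "a = ?A + e / 2" and "b = ?B + e / 2"
    have ab: "a > 0" "b > 0" "?A \<le> a" "?B \<le> b" "a + b = ?A + ?B + e"
      using nonneg that by (auto simp: a_def b_def)
    have "(LINT x|M. \<bar>f x\<bar> powr r) / a powr r \<le> 1" "(LINT x|M. \<bar>g x\<bar> powr r) / b powr r \<le> 1"
      using r ab nonneg
      by (auto simp: Lp_norm_finite_powr[symmetric] intro!: powr_mono2)
    then have "a / (a + b) * ((LINT x|M. \<bar>f x\<bar> powr r) / a powr r) + b / (a + b) * ((LINT x|M. \<bar>g x\<bar> powr r) / b powr r)
        \<le> a / (a + b) * 1 + b / (a + b) * 1"
      using ab by (intro add_mono mult_left_mono) auto
    also have "\<dots> = 1"
      using ab by (simp add: add_divide_distrib[symmetric])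
    finally have le1: "a / (a + b) * ((LINT x|M. \<bar>f x\<bar> powr r) / a powr r) + b / (a + b) * ((LINT x|M. \<bar>g x\<bar> powr r) / b powr r) \<le> 1" .
    have "(LINT x|M. \<bar>f x + g x\<bar> powr r) \<le> (LINT x|M. bd a b x)"
      using int_sum int_bd le_bd ab by (intro integral_mono) auto
    also have "\<dots> = (a + b) powr r * (a / (a + b) * ((LINT x|M. \<bar>f x\<bar> powr r) / a powr r) + b / (a + b) * ((LINT x|M. \<bar>g x\<bar> powr r) / b powr r))"
      unfolding bd_def using int by simp
    also have "\<dots> \<le> (a + b) powr r"
      using le1 by (intro mult_left_le) auto
    finally have "(LINT x|M. \<bar>f x + g x\<bar> powr r) powr (1 / r) \<le> ((a + b) powr r) powr (1 / r)"
      using r by (intro powr_mono2) (auto intro: integral_nonneg_AE)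
    then show ?thesis
      using r ab by (simp add: Lp_norm_finite powr_powr)
  qed
  then show "Lp_norm M (ennreal r) (\<lambda>x. f x + g x) \<le> ?A + ?B"
    by (rule field_le_epsilon)
qed

lemma Lp_scale_finite:
  assumes r: "r \<ge> 1" and f: "f \<in> Lp_space M (ennreal r)"
  shows "(\<lambda>x. c * f x) \<in> Lp_space M (ennreal r)"
    and "Lp_norm M (ennreal r) (\<lambda>x. c * f x) = \<bar>c\<bar> * Lp_norm M (ennreal r) f"
  using f r by (auto simp: Lp_space_finite_iff Lp_norm_finite abs_mult powr_mult powr_powr integral_nonneg_AE)

lemma Lp_cong_AE:
  assumes f: "f \<in> Lp_space M q" and g: "g \<in> borel_measurable M" and "AE x in M. f x = g x"
  shows "g \<in> Lp_space M q" and "Lp_norm M q g = Lp_norm M q f"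
proof -
  have [measurable]: "f \<in> borel_measurable M" "g \<in> borel_measurable M"
    using f g by (auto simp: Lp_space_def)
  have ess: "esssup M (\<lambda>x. ereal \<bar>f x\<bar>) = esssup M (\<lambda>x. ereal \<bar>g x\<bar>)"
    by (rule esssup_AE_cong) (use assms(3) in auto)
  have ae: "AE x in M. \<bar>f x\<bar> powr s = \<bar>g x\<bar> powr s" for s
    using assms(3) by eventually_elim simp
  have "integrable M (\<lambda>x. \<bar>f x\<bar> powr s) = integrable M (\<lambda>x. \<bar>g x\<bar> powr s)" for s
    by (rule integrable_cong_AE[OF _ _ ae]) auto
  with ess show "g \<in> Lp_space M q"
    using f by (cases "q = top") (simp_all add: Lp_space_def)
  have "(LINT x|M. \<bar>f x\<bar> powr s) = (LINT x|M. \<bar>g x\<bar> powr s)" for s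
    by (rule integral_cong_AE[OF _ _ ae]) auto
  with ess show "Lp_norm M q g = Lp_norm M q f"
    by (simp add: Lp_norm_def)
qed

text \<open>On a null space the essential supremum is \<open>-\<infinity>\<close>, whence the assumption on \<open>M\<close>.\<close>

lemma Lp_norm_infinity_eq_esssup:
  assumes f: "f \<in> Lp_space M \<infinity>" and M: "emeasure M (space M) \<noteq> 0"
  shows "ereal (Lp_norm M \<infinity> f) = esssup M (\<lambda>x. ereal \<bar>f x\<bar>)" "0 \<le> Lp_norm M \<infinity> f"
proof -
  have "esssup M (\<lambda>x. 0) \<le> esssup M (\<lambda>x. ereal \<bar>f x\<bar>)"
    using f by (intro esssup_mono) (auto simp: Lp_space_def)
  then have 0: "0 \<le> esssup M (\<lambda>x. ereal \<bar>f x\<bar>)"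
    using M by (simp add: esssup_const)
  moreover have "esssup M (\<lambda>x. ereal \<bar>f x\<bar>) < \<infinity>"
    using f by (simp add: Lp_space_def)
  ultimately show 1: "ereal (Lp_norm M \<infinity> f) = esssup M (\<lambda>x. ereal \<bar>f x\<bar>)"
    by (simp add: Lp_norm_def ereal_real less_top[symmetric] top_ereal_def[symmetric])
  show "0 \<le> Lp_norm M \<infinity> f"
    using 0 unfolding 1[symmetric] by simp
qed

lemma Lp_norm_infinity_AE:
  assumes f: "f \<in> Lp_space M \<infinity>" and M: "emeasure M (space M) \<noteq> 0"
  shows "AE x in M. \<bar>f x\<bar> \<le> Lp_norm M \<infinity> f"
  using esssup_AE[of "\<lambda>x. ereal \<bar>f x\<bar>" M]
  unfolding Lp_norm_infinity_eq_esssup(1)[OF assms, symmetric] by simp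

lemma Lp_infinityI:
  assumes "f \<in> borel_measurable M" "AE x in M. \<bar>f x\<bar> \<le> C" and M: "emeasure M (space M) \<noteq> 0"
  shows "f \<in> Lp_space M \<infinity>" "Lp_norm M \<infinity> f \<le> C"
proof -
  have le: "esssup M (\<lambda>x. ereal \<bar>f x\<bar>) \<le> ereal C"
    using assms by (intro esssup_I) auto
  then show *: "f \<in> Lp_space M \<infinity>"
    using assms(1) by (auto simp: Lp_space_def)
  show "Lp_norm M \<infinity> f \<le> C"
    using le unfolding Lp_norm_infinity_eq_esssup(1)[OF * M, symmetric] by simp
qed

lemma Lp_add_infinity:
  assumes M: "emeasure M (space M) \<noteq> 0" and f: "f \<in> Lp_space M \<infinity>" and g: "g \<in> Lp_space M \<infinity>"
  shows "(\<lambda>x. f x + g x) \<in> Lp_space M \<infinity>"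
    and "Lp_norm M \<infinity> (\<lambda>x. f x + g x) \<le> Lp_norm M \<infinity> f + Lp_norm M \<infinity> g"
proof -
  have "AE x in M. \<bar>f x + g x\<bar> \<le> Lp_norm M \<infinity> f + Lp_norm M \<infinity> g"
    using Lp_norm_infinity_AE[OF f M] Lp_norm_infinity_AE[OF g M] by eventually_elim linarith
  moreover have "(\<lambda>x. f x + g x) \<in> borel_measurable M"
    using f g by (auto simp: Lp_space_def)
  ultimately show "(\<lambda>x. f x + g x) \<in> Lp_space M \<infinity>"
    "Lp_norm M \<infinity> (\<lambda>x. f x + g x) \<le> Lp_norm M \<infinity> f + Lp_norm M \<infinity> g"
    using Lp_infinityI M by blast+
qed

lemma Lp_scale_infinity:
  assumes M: "emeasure M (space M) \<noteq> 0" and f: "f \<in> Lp_space M \<infinity>"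
  shows "(\<lambda>x. c * f x) \<in> Lp_space M \<infinity>"
    and "Lp_norm M \<infinity> (\<lambda>x. c * f x) = \<bar>c\<bar> * Lp_norm M \<infinity> f"
proof -
  have *: "(\<lambda>x. c * f x) \<in> Lp_space M \<infinity> \<and> Lp_norm M \<infinity> (\<lambda>x. c * f x) \<le> \<bar>c\<bar> * Lp_norm M \<infinity> f"
    if f: "f \<in> Lp_space M \<infinity>" for c f
  proof -
    have "AE x in M. \<bar>c * f x\<bar> \<le> \<bar>c\<bar> * Lp_norm M \<infinity> f"
      using Lp_norm_infinity_AE[OF f M] by eventually_elim (simp add: abs_mult mult_left_mono)
    moreover have "(\<lambda>x. c * f x) \<in> borel_measurable M"
      using f by (auto simp: Lp_space_def)
    ultimately show ?thesis
      using Lp_infinityI M by blast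
  qed
  show cf: "(\<lambda>x. c * f x) \<in> Lp_space M \<infinity>"
    using * f by blast
  show "Lp_norm M \<infinity> (\<lambda>x. c * f x) = \<bar>c\<bar> * Lp_norm M \<infinity> f"
  proof (cases "c = 0")
    case True
    then show ?thesis
      using *[OF f, of 0] Lp_norm_infinity_eq_esssup(2)[OF cf M] by simp
  next
    case False
    then have "Lp_norm M \<infinity> f \<le> \<bar>inverse c\<bar> * Lp_norm M \<infinity> (\<lambda>x. c * f x)"
      using *[OF cf, of "inverse c"] by (simp add: mult.assoc[symmetric])
    then show ?thesis
      using *[OF f, of c] False by (simp add: field_simps)
  qed
qed

lemma exponent_cases:
  assumes "1 \<le> (q::ennreal)"
  obtains "q = \<infinity>" | r where "r \<ge> 1" "q = ennreal r"
  using assms by (cases q) auto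

lemma Lp_add:
  assumes "1 \<le> q" "emeasure M (space M) \<noteq> 0" "f \<in> Lp_space M q" "g \<in> Lp_space M q"
  shows "(\<lambda>x. f x + g x) \<in> Lp_space M q" "Lp_norm M q (\<lambda>x. f x + g x) \<le> Lp_norm M q f + Lp_norm M q g"
  using assms Lp_add_finite[of _ f M g] Lp_add_infinity[of M f g]
  by (cases rule: exponent_cases[OF assms(1)]; simp)+

lemma Lp_scale:
  assumes "1 \<le> q" "emeasure M (space M) \<noteq> 0" "f \<in> Lp_space M q"
  shows "(\<lambda>x. c * f x) \<in> Lp_space M q" "Lp_norm M q (\<lambda>x. c * f x) = \<bar>c\<bar> * Lp_norm M q f"
  using assms Lp_scale_finite[of _ f M c] Lp_scale_infinity[of M f c]
  by (cases rule: exponent_cases[OF assms(1)]; simp)+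

lemma Lp_norm_nonneg:
  assumes "emeasure M (space M) \<noteq> 0" "f \<in> Lp_space M q"
  shows "0 \<le> Lp_norm M q f"
  using assms Lp_norm_infinity_eq_esssup(2)[of f M] by (cases "q = \<infinity>") (auto simp: Lp_norm_def)

section \<open>The first-order Sobolev norm is a seminorm\<close>

text \<open>An open set is a countable union of compact boxes.\<close>

lemma locally_integrable_imp_measurable:
  assumes "open \<Omega>" "locally_integrable \<Omega> v"
  shows "v \<in> borel_measurable (lebesgue_on \<Omega>)"
proof -
  obtain \<D> where \<D>: "countable \<D>" "\<D> \<subseteq> Pow \<Omega>" "\<And>X. X \<in> \<D> \<Longrightarrow> \<exists>a b. X = cbox a b" "\<Union>\<D> = \<Omega>"
    using open_countable_Union_open_cbox[OF assms(1)] by metis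
  show ?thesis
  proof (rule measurable_piecewise_restrict[where C = \<D>])
    show "countable \<D>" "space (lebesgue_on \<Omega>) \<subseteq> \<Union>\<D>" using \<D> by auto
  next
    fix Q assume Q: "Q \<in> \<D>"
    then obtain a b where ab: "Q = cbox a b" "Q \<subseteq> \<Omega>"
      using \<D>(2) \<D>(3)[OF Q] by auto
    then show "Q \<inter> space (lebesgue_on \<Omega>) \<in> sets (lebesgue_on \<Omega>)"
      using assms(1) by (auto simp: sets_restrict_space_iff Int_absorb2)
    have "v \<in> borel_measurable (lebesgue_on Q)"
      using assms(2) ab compact_cbox unfolding locally_integrable_def
      by (intro borel_measurable_integrable) blast
    moreover have "restrict_space (lebesgue_on \<Omega>) Q = lebesgue_on Q"
      using ab assms(1) by (subst restrict_restrict_space) (auto simp: Int_absorb1)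
    ultimately show "v \<in> borel_measurable (restrict_space (lebesgue_on \<Omega>) Q)"
      by simp
  qed
qed

lemma has_weak_partial_add:
  assumes \<Omega>: "open \<Omega>" and g: "has_weak_partial \<Omega> b v g" and h: "has_weak_partial \<Omega> b w h" and b: "b \<in> Basis"
  shows "has_weak_partial \<Omega> b (\<lambda>x. v x + w x) (\<lambda>x. g x + h x)"
proof -
  have l: "locally_integrable \<Omega> v" "locally_integrable \<Omega> w" "locally_integrable \<Omega> g" "locally_integrable \<Omega> h"
    using g h by (auto simp: has_weak_partial_def)
  have "(LINT x|lebesgue_on \<Omega>. (v x + w x) * partial_deriv b \<psi> x) = - (LINT x|lebesgue_on \<Omega>. (g x + h x) * \<psi> x)"
    if \<psi>: "\<psi> \<in> test_functions \<Omega>" for \<psi>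
  proof -
    note p = test_function_props[OF \<psi>]
    have "integrable (lebesgue_on \<Omega>) (\<lambda>x. u x * partial_deriv b \<psi> x)" "integrable (lebesgue_on \<Omega>) (\<lambda>x. u x * \<psi> x)"
      if "locally_integrable \<Omega> u" for u
      using locally_integrable_mult[OF that \<Omega> p(4) p(1) p(2) p(6)]
        locally_integrable_mult[OF that \<Omega> p(5)[OF b] p(1) p(2) p(7)] by auto
    then show ?thesis
      using g h \<psi> l by (simp add: has_weak_partial_def distrib_right)
  qed
  moreover have "locally_integrable \<Omega> (\<lambda>x. v x + w x)" "locally_integrable \<Omega> (\<lambda>x. g x + h x)"
    using l by (auto simp: locally_integrable_def)
  ultimately show ?thesis by (simp add: has_weak_partial_def)
qed

lemma has_weak_partial_scale:
  assumes g: "has_weak_partial \<Omega> b v g"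
  shows "has_weak_partial \<Omega> b (\<lambda>x. c * v x) (\<lambda>x. c * g x)"
  using g by (auto simp: has_weak_partial_def locally_integrable_def mult.assoc)

lemma lebesgue_on_open_nonnull:
  assumes "open \<Omega>" "\<Omega> \<noteq> {}"
  shows "emeasure (lebesgue_on \<Omega>) (space (lebesgue_on \<Omega>)) \<noteq> 0"
  using assms open_not_negligible[OF assms]
  by (auto simp: emeasure_restrict_space negligible_iff_null_sets null_sets_def)

text \<open>Any weak derivative in the Lebesgue space may stand in for the chosen one, because the two agree almost everywhere.\<close>

lemma weak_partial_chosen:
  assumes \<Omega>: "open \<Omega>" and g: "has_weak_partial \<Omega> b v g" "g \<in> Lp_space (lebesgue_on \<Omega>) q"
  shows "has_weak_partial \<Omega> b v (weak_partial \<Omega> b v)"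
    "weak_partial \<Omega> b v \<in> Lp_space (lebesgue_on \<Omega>) q"
    "Lp_norm (lebesgue_on \<Omega>) q (weak_partial \<Omega> b v) = Lp_norm (lebesgue_on \<Omega>) q g"
proof -
  show w: "has_weak_partial \<Omega> b v (weak_partial \<Omega> b v)"
    unfolding weak_partial_def by (rule someI[of "has_weak_partial \<Omega> b v", OF g(1)])
  have "weak_partial \<Omega> b v \<in> borel_measurable (lebesgue_on \<Omega>)"
    using w \<Omega> locally_integrable_imp_measurable by (auto simp: has_weak_partial_def)
  then show "weak_partial \<Omega> b v \<in> Lp_space (lebesgue_on \<Omega>) q"
    "Lp_norm (lebesgue_on \<Omega>) q (weak_partial \<Omega> b v) = Lp_norm (lebesgue_on \<Omega>) q g"
    using Lp_cong_AE[OF g(2) _ weak_partial_unique[OF \<Omega> g(1) w]] by auto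
qed

lemma W1_weak_partial:
  assumes "open \<Omega>" "v \<in> W1 \<Omega> q" "b \<in> Basis"
  shows "has_weak_partial \<Omega> b v (weak_partial \<Omega> b v)"
    "weak_partial \<Omega> b v \<in> Lp_space (lebesgue_on \<Omega>) q"
  using assms weak_partial_chosen[OF assms(1)] unfolding W1_def by blast+

lemma W1_add:
  assumes q: "1 \<le> q" and \<Omega>: "open \<Omega>" "\<Omega> \<noteq> {}" and v: "v \<in> W1 \<Omega> q" and w: "w \<in> W1 \<Omega> q"
  shows "(\<lambda>x. v x + w x) \<in> W1 \<Omega> q" "W1_norm \<Omega> q (\<lambda>x. v x + w x) \<le> W1_norm \<Omega> q v + W1_norm \<Omega> q w"
proof -
  note M = lebesgue_on_open_nonnull[OF \<Omega>]
  have Lp: "v \<in> Lp_space (lebesgue_on \<Omega>) q" "w \<in> Lp_space (lebesgue_on \<Omega>) q"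
    using v w by (auto simp: W1_def)
  let ?s = "\<lambda>b x. weak_partial \<Omega> b v x + weak_partial \<Omega> b w x"
  have s: "has_weak_partial \<Omega> b (\<lambda>x. v x + w x) (?s b)" "?s b \<in> Lp_space (lebesgue_on \<Omega>) q"
    "Lp_norm (lebesgue_on \<Omega>) q (?s b) \<le>
       Lp_norm (lebesgue_on \<Omega>) q (weak_partial \<Omega> b v) + Lp_norm (lebesgue_on \<Omega>) q (weak_partial \<Omega> b w)"
    if b: "b \<in> Basis" for b
    using W1_weak_partial[OF \<Omega>(1) v b] W1_weak_partial[OF \<Omega>(1) w b] b \<Omega>(1)
    by (auto intro: has_weak_partial_add Lp_add[OF q M])
  show "(\<lambda>x. v x + w x) \<in> W1 \<Omega> q"
    using s(1,2) Lp_add(1)[OF q M Lp] unfolding W1_def by blast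
  have "Lp_norm (lebesgue_on \<Omega>) q (weak_partial \<Omega> b (\<lambda>x. v x + w x)) \<le>
       Lp_norm (lebesgue_on \<Omega>) q (weak_partial \<Omega> b v) + Lp_norm (lebesgue_on \<Omega>) q (weak_partial \<Omega> b w)"
    if b: "b \<in> Basis" for b
    using weak_partial_chosen(3)[OF \<Omega>(1) s(1,2)[OF b]] s(3)[OF b] by simp
  then have "(\<Sum>b\<in>Basis. Lp_norm (lebesgue_on \<Omega>) q (weak_partial \<Omega> b (\<lambda>x. v x + w x))) \<le>
      (\<Sum>b\<in>Basis. Lp_norm (lebesgue_on \<Omega>) q (weak_partial \<Omega> b v) +
        Lp_norm (lebesgue_on \<Omega>) q (weak_partial \<Omega> b w))"
    by (rule sum_mono)
  then show "W1_norm \<Omega> q (\<lambda>x. v x + w x) \<le> W1_norm \<Omega> q v + W1_norm \<Omega> q w"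
    using Lp_add(2)[OF q M Lp] unfolding W1_norm_def sum.distrib by linarith
qed

lemma W1_scale:
  assumes q: "1 \<le> q" and \<Omega>: "open \<Omega>" "\<Omega> \<noteq> {}" and v: "v \<in> W1 \<Omega> q"
  shows "(\<lambda>x. c * v x) \<in> W1 \<Omega> q" "W1_norm \<Omega> q (\<lambda>x. c * v x) = \<bar>c\<bar> * W1_norm \<Omega> q v"
proof -
  note M = lebesgue_on_open_nonnull[OF \<Omega>]
  have Lp: "v \<in> Lp_space (lebesgue_on \<Omega>) q"
    using v by (auto simp: W1_def)
  have s: "has_weak_partial \<Omega> b (\<lambda>x. c * v x) (\<lambda>x. c * weak_partial \<Omega> b v x)"
    "(\<lambda>x. c * weak_partial \<Omega> b v x) \<in> Lp_space (lebesgue_on \<Omega>) q"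
    "Lp_norm (lebesgue_on \<Omega>) q (\<lambda>x. c * weak_partial \<Omega> b v x) =
       \<bar>c\<bar> * Lp_norm (lebesgue_on \<Omega>) q (weak_partial \<Omega> b v)"
    if b: "b \<in> Basis" for b
    using W1_weak_partial[OF \<Omega>(1) v b]
    by (auto intro: has_weak_partial_scale Lp_scale[OF q M])
  show "(\<lambda>x. c * v x) \<in> W1 \<Omega> q"
    using s(1,2) Lp_scale(1)[OF q M Lp] unfolding W1_def by blast
  have "Lp_norm (lebesgue_on \<Omega>) q (weak_partial \<Omega> b (\<lambda>x. c * v x)) =
       \<bar>c\<bar> * Lp_norm (lebesgue_on \<Omega>) q (weak_partial \<Omega> b v)" if b: "b \<in> Basis" for b
    using weak_partial_chosen(3)[OF \<Omega>(1) s(1,2)[OF b]] s(3)[OF b] by simp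
  then show "W1_norm \<Omega> q (\<lambda>x. c * v x) = \<bar>c\<bar> * W1_norm \<Omega> q v"
    using Lp_scale(2)[OF q M Lp] unfolding W1_norm_def by (simp add: distrib_left sum_distrib_left)
qed

lemma W1_norm_nonneg:
  assumes "open \<Omega>" "\<Omega> \<noteq> {}" "v \<in> W1 \<Omega> q"
  shows "0 \<le> W1_norm \<Omega> q v"
proof -
  note M = lebesgue_on_open_nonnull[OF assms(1,2)]
  have "0 \<le> Lp_norm (lebesgue_on \<Omega>) q v"
    using assms(3) by (intro Lp_norm_nonneg[OF M]) (simp add: W1_def)
  moreover have "0 \<le> Lp_norm (lebesgue_on \<Omega>) q (weak_partial \<Omega> b v)" if "b \<in> Basis" for b
    using W1_weak_partial(2)[OF assms(1,3) that] by (rule Lp_norm_nonneg[OF M])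
  ultimately show ?thesis
    unfolding W1_norm_def by (intro add_nonneg_nonneg sum_nonneg) auto
qed

section \<open>Test functions as Sobolev functions\<close>

lemma has_derivative_along_line:
  fixes h :: "'a::euclidean_space \<Rightarrow> real"
  assumes "h differentiable (at (x + s *\<^sub>R v))"
  shows "((\<lambda>s. h (x + s *\<^sub>R v)) has_real_derivative partial_deriv v h (x + s *\<^sub>R v)) (at s)"
proof -
  have 1: "((\<lambda>s. x + s *\<^sub>R v) has_derivative (\<lambda>t. t *\<^sub>R v)) (at s)"
    by (auto intro!: derivative_eq_intros)
  have 2: "(h has_derivative frechet_derivative h (at (x + s *\<^sub>R v))) (at (x + s *\<^sub>R v))"
    using assms by (simp add: frechet_derivative_works)
  interpret bounded_linear "frechet_derivative h (at (x + s *\<^sub>R v))"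
    using 2 by (rule has_derivative_bounded_linear)
  show ?thesis
    using has_derivative_compose[OF 1 2]
    by (simp add: has_field_derivative_def partial_deriv_def scaleR mult_commute_abs)
qed

lemma partial_deriv_direction:
  fixes h :: "'a::euclidean_space \<Rightarrow> 'b::real_normed_vector"
  assumes "h differentiable (at x)"
  shows "partial_deriv v h x = (\<Sum>b\<in>Basis. (v \<bullet> b) *\<^sub>R partial_deriv b h x)"
proof -
  interpret bounded_linear "frechet_derivative h (at x)"
    using assms unfolding frechet_derivative_works by (rule has_derivative_bounded_linear)
  show ?thesis
    unfolding partial_deriv_def
    by (subst euclidean_representation[of v, symmetric]) (simp add: sum scaleR)
qed

lemma integrable_lborel_compact_support:
  fixes f :: "'a::euclidean_space \<Rightarrow> real"
  assumes "continuous_on UNIV f" "compact K" "\<And>x. x \<notin> K \<Longrightarrow> f x = 0"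
  shows "integrable lborel f"
proof -
  have "integrable lborel (\<lambda>x. indicator K x *\<^sub>R f x)"
    using assms by (intro borel_integrable_compact) (auto intro: continuous_on_subset)
  also have "(\<lambda>x. indicator K x *\<^sub>R f x) = f"
    using assms(3) by (auto simp: fun_eq_iff split: split_indicator)
  finally show ?thesis .
qed

lemma integral_lebesgue_on_eq_lborel:
  fixes f :: "'a::euclidean_space \<Rightarrow> real"
  assumes f: "continuous_on UNIV f" and \<Omega>: "\<Omega> \<in> sets lebesgue" and 0: "\<And>x. x \<notin> \<Omega> \<Longrightarrow> f x = 0"
  shows "integral\<^sup>L (lebesgue_on \<Omega>) f = integral\<^sup>L lborel f"
    "integrable (lebesgue_on \<Omega>) f \<longleftrightarrow> integrable lborel f"
proof -
  have eq: "(\<lambda>x. indicator \<Omega> x * f x) = f"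
    using 0 by (auto simp: fun_eq_iff split: split_indicator)
  have f': "f \<in> borel_measurable lborel"
    using f by (simp add: borel_measurable_continuous_onI)
  show "integral\<^sup>L (lebesgue_on \<Omega>) f = integral\<^sup>L lborel f"
    using \<Omega> f' by (simp add: integral_restrict_space integral_completion eq)
  show "integrable (lebesgue_on \<Omega>) f \<longleftrightarrow> integrable lborel f"
    using \<Omega> f' by (simp add: integrable_restrict_space integrable_completion eq)
qed

text \<open>By translation invariance the difference quotients of \<open>h\<close> in direction \<open>v\<close> have integral zero, and by the mean value
theorem they are dominated by a multiple of the indicator of a ball.\<close>

lemma integral_partial_deriv_eq_0:
  fixes h :: "'a::euclidean_space \<Rightarrow> real"
  assumes diff: "\<And>x. h differentiable (at x)" and cont: "continuous_on UNIV (partial_deriv v h)"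
    and K: "compact K" "\<And>x. x \<notin> K \<Longrightarrow> h x = 0" "\<And>x. x \<notin> K \<Longrightarrow> partial_deriv v h x = 0"
  shows "integral\<^sup>L lborel (partial_deriv v h) = 0"
proof -
  have h_cont: "continuous_on UNIV h"
    using diff by (simp add: continuous_on_eq_continuous_within differentiable_imp_continuous_within)
  have h_int: "integrable lborel h"
    using h_cont K(1,2) by (rule integrable_lborel_compact_support)
  obtain B where B: "\<And>x. x \<in> K \<Longrightarrow> \<bar>partial_deriv v h x\<bar> \<le> B"
    using compact_imp_bounded[OF compact_continuous_image[OF continuous_on_subset[OF cont] K(1)]]
    by (auto simp: bounded_iff)
  have B': "\<bar>partial_deriv v h x\<bar> \<le> \<bar>B\<bar>" for x
    using B[of x] K(3)[of x] by (cases "x \<in> K") force+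
  obtain R where R: "\<And>x. x \<in> K \<Longrightarrow> norm x \<le> R"
    using compact_imp_bounded[OF K(1)] by (auto simp: bounded_iff)
  define D where "D = cball (0::'a) (R + norm v)"
  define t where "t n = inverse (real (Suc n))" for n
  have t: "0 < t n" "t n \<le> 1" for n
    by (auto simp: t_def field_simps)
  define F where "F n x = (h (x + t n *\<^sub>R v) - h x) / t n" for n x
  have shift_int: "integrable lborel (\<lambda>x. h (x + c))" for c
    using h_int lborel_distr_plus[of c] integrable_distr_eq[of "(+) c" lborel borel h]
      borel_measurable_continuous_onI[OF h_cont] by (simp add: add.commute)
  have shift: "(LINT x|lborel. h (x + c)) = integral\<^sup>L lborel h" for c
    using lborel_distr_plus[of c] integral_distr[of "(+) c" lborel borel h]
      borel_measurable_continuous_onI[OF h_cont] by (simp add: add.commute)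
  have "integral\<^sup>L lborel (F n) = 0" for n
    unfolding F_def using shift_int h_int shift by simp
  moreover have "(\<lambda>n. integral\<^sup>L lborel (F n)) \<longlonglongrightarrow> integral\<^sup>L lborel (partial_deriv v h)"
  proof (rule integral_dominated_convergence[where w = "\<lambda>x. \<bar>B\<bar> * indicator D x"])
    show "partial_deriv v h \<in> borel_measurable lborel"
      using cont by (simp add: borel_measurable_continuous_onI)
    show "F n \<in> borel_measurable lborel" for n
      unfolding F_def using shift_int h_int by (intro borel_measurable_integrable) auto
    show "integrable lborel (\<lambda>x. \<bar>B\<bar> * indicator D x)"
      by (intro integrable_mult_right integrable_real_indicator) (use emeasure_bounded_finite[OF bounded_cball] in \<open>auto simp: D_def\<close>)
    show "AE x in lborel. (\<lambda>n. F n x) \<longlonglongrightarrow> partial_deriv v h x"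
    proof (rule AE_I2)
      fix x
      have "((\<lambda>s. h (x + s *\<^sub>R v)) has_real_derivative partial_deriv v h x) (at 0)"
        using has_derivative_along_line[of h x 0 v] diff by simp
      then have lim: "((\<lambda>s. (h (x + s *\<^sub>R v) - h x) / s) \<longlongrightarrow> partial_deriv v h x) (at 0)"
        by (simp add: DERIV_def)
      have "filterlim t (at 0) sequentially"
        unfolding filterlim_at using t LIMSEQ_inverse_real_of_nat
        by (auto simp: t_def[abs_def] intro!: always_eventually)
      from filterlim_compose[OF lim this] show "(\<lambda>n. F n x) \<longlonglongrightarrow> partial_deriv v h x"
        by (simp add: F_def)
    qed
    show "AE x in lborel. norm (F n x) \<le> \<bar>B\<bar> * indicator D x" for n
    proof (rule AE_I2)
      fix x
      show "norm (F n x) \<le> \<bar>B\<bar> * indicator D x"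
      proof (cases "x \<in> D")
        case True
        have "\<exists>z>0. z < t n \<and> h (x + t n *\<^sub>R v) - h (x + 0 *\<^sub>R v) = (t n - 0) * partial_deriv v h (x + z *\<^sub>R v)"
          using MVT2[OF t(1)[of n], of "\<lambda>s. h (x + s *\<^sub>R v)" "\<lambda>s. partial_deriv v h (x + s *\<^sub>R v)"]
            has_derivative_along_line[OF diff] by auto
        then obtain z where "h (x + t n *\<^sub>R v) - h x = t n * partial_deriv v h (x + z *\<^sub>R v)"
          by auto
        then have "F n x = partial_deriv v h (x + z *\<^sub>R v)"
          using t(1)[of n] by (simp add: F_def)
        then show ?thesis
          using B' True by simp
      next
        case False
        have "norm (t n *\<^sub>R v) \<le> norm v"
          using t[of n] by (simp add: mult_left_le_one_le)
        moreover have "norm x > R + norm v"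
          using False by (simp add: D_def)
        moreover have "norm x \<le> norm (x + t n *\<^sub>R v) + norm (t n *\<^sub>R v)"
          using norm_triangle_ineq4[of "x + t n *\<^sub>R v" "t n *\<^sub>R v"] by simp
        ultimately have "norm x > R" "norm (x + t n *\<^sub>R v) > R"
          using norm_ge_zero[of v] by linarith+
        then have "x \<notin> K" "x + t n *\<^sub>R v \<notin> K"
          using R by (meson not_less)+
        then show ?thesis
          using K(2) False by (simp add: F_def)
      qed
    qed
  qed
  ultimately show ?thesis
    by (simp add: LIMSEQ_const_iff)
qed

lemma continuous_imp_locally_integrable:
  fixes f :: "'a::euclidean_space \<Rightarrow> real"
  assumes "continuous_on UNIV f"
  shows "locally_integrable \<Omega> f"
  unfolding locally_integrable_def
proof (intro allI impI)
  fix K assume K: "compact K \<and> K \<subseteq> \<Omega>"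
  then have "integrable lborel (\<lambda>x. indicator K x *\<^sub>R f x)"
    using assms by (intro borel_integrable_compact) (auto intro: continuous_on_subset)
  then have "integrable lebesgue (\<lambda>x. indicator K x *\<^sub>R f x)"
    by (subst integrable_completion) auto
  then show "integrable (lebesgue_on K) f"
    using K by (subst integrable_restrict_space) (auto simp: borel_compact)
qed

text \<open>Integration by parts: the product with another test function has compact support, so its derivative integrates to
zero.\<close>

lemma test_function_has_weak_partial:
  assumes \<Omega>: "open \<Omega>" and \<psi>: "\<psi> \<in> test_functions \<Omega>" and b: "b \<in> Basis"
  shows "has_weak_partial \<Omega> b \<psi> (partial_deriv b \<psi>)"
proof -
  note p = test_function_props[OF \<psi>]
  have "(LINT x|lebesgue_on \<Omega>. \<psi> x * partial_deriv b \<eta> x) = - (LINT x|lebesgue_on \<Omega>. partial_deriv b \<psi> x * \<eta> x)"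
    if \<eta>: "\<eta> \<in> test_functions \<Omega>" for \<eta>
  proof -
    note c = test_function_props[OF \<eta>]
    have cont: "continuous_on UNIV (\<lambda>x. \<psi> x * partial_deriv b \<eta> x)" "continuous_on UNIV (\<lambda>x. partial_deriv b \<psi> x * \<eta> x)"
      using p(4) p(5)[OF b] c(4) c(5)[OF b] by (auto intro: continuous_on_mult)
    have \<Omega>': "\<Omega> \<in> sets lebesgue" using \<Omega> by simp
    have 0: "\<psi> x = 0" "\<eta> x = 0" if "x \<notin> \<Omega>" for x
      using that p(2,6) c(2,6) by blast+
    have int: "integrable lborel (\<lambda>x. \<psi> x * partial_deriv b \<eta> x)" "integrable lborel (\<lambda>x. partial_deriv b \<psi> x * \<eta> x)"
      using cont c(6,7) by (auto intro!: integrable_lborel_compact_support[OF _ c(1)])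
    have D: "partial_deriv b (\<lambda>x. \<psi> x * \<eta> x) = (\<lambda>x. \<psi> x * partial_deriv b \<eta> x + partial_deriv b \<psi> x * \<eta> x)"
      using p(3) c(3) by (intro ext partial_deriv_mult)
    have "integral\<^sup>L lborel (partial_deriv b (\<lambda>x. \<psi> x * \<eta> x)) = 0"
    proof (rule integral_partial_deriv_eq_0[OF _ _ c(1)])
      show "(\<lambda>x. \<psi> x * \<eta> x) differentiable at x" for x
        using p(3) c(3) by (intro differentiable_mult)
      show "continuous_on UNIV (partial_deriv b (\<lambda>x. \<psi> x * \<eta> x))"
        unfolding D using cont by (intro continuous_on_add)
    qed (simp_all add: D c(6,7))
    then have "(LINT x|lborel. \<psi> x * partial_deriv b \<eta> x) + (LINT x|lborel. partial_deriv b \<psi> x * \<eta> x) = 0"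
      using int by (simp add: D)
    then show ?thesis
      using integral_lebesgue_on_eq_lborel(1)[OF cont(1) \<Omega>'] integral_lebesgue_on_eq_lborel(1)[OF cont(2) \<Omega>'] 0
      by simp
  qed
  then show ?thesis
    unfolding has_weak_partial_def
    using continuous_imp_locally_integrable p(4) p(5)[OF b] by blast
qed

lemma continuous_compact_support_Lp:
  fixes f :: "'a::euclidean_space \<Rightarrow> real"
  assumes \<Omega>: "open \<Omega>" "\<Omega> \<noteq> {}" and q: "1 \<le> q" and f: "continuous_on UNIV f" 
    and K: "compact K" "K \<subseteq> \<Omega>" "\<And>x. x \<notin> K \<Longrightarrow> f x = 0"
  shows "f \<in> Lp_space (lebesgue_on \<Omega>) q"
proof (cases rule: exponent_cases[OF q])
  have meas: "f \<in> borel_measurable (lebesgue_on \<Omega>)"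
    using f \<Omega> continuous_on_subset by (intro continuous_imp_measurable_on_sets_lebesgue) auto
  {
    case 1
    obtain B where B: "\<And>x. x \<in> K \<Longrightarrow> \<bar>f x\<bar> \<le> B"
      using compact_imp_bounded[OF compact_continuous_image[OF continuous_on_subset[OF f] K(1)]]
      by (auto simp: bounded_iff)
    have "\<bar>f x\<bar> \<le> \<bar>B\<bar>" for x
      using B[of x] K(3)[of x] by (cases "x \<in> K") force+
    then show ?thesis
      unfolding 1 using meas lebesgue_on_open_nonnull[OF \<Omega>] by (intro Lp_infinityI(1)[of _ _ "\<bar>B\<bar>"]) auto
  next
    case (2 r)
    have cont: "continuous_on UNIV (\<lambda>x. \<bar>f x\<bar> powr r)"
      by (rule continuous_on_powr'[OF continuous_on_rabs[OF f] continuous_on_const]) (use 2 in auto)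
    have "integrable lborel (\<lambda>x. \<bar>f x\<bar> powr r)"
      using cont K by (intro integrable_lborel_compact_support[of _ K]) auto
    moreover have "\<bar>f x\<bar> powr r = 0" if "x \<notin> \<Omega>" for x
      using K(2) K(3)[of x] that by auto
    ultimately have "integrable (lebesgue_on \<Omega>) (\<lambda>x. \<bar>f x\<bar> powr r)"
      using integral_lebesgue_on_eq_lborel(2)[OF cont, of \<Omega>] \<Omega> by simp
    then show ?thesis
      using 2 meas by (simp add: Lp_space_finite_iff)
  }
qed

lemma test_function_W1:
  assumes \<Omega>: "open \<Omega>" "\<Omega> \<noteq> {}" and q: "1 \<le> q" and \<psi>: "\<psi> \<in> test_functions \<Omega>"
  shows "\<psi> \<in> W1 \<Omega> q" 
    "W1_norm \<Omega> q \<psi> = Lp_norm (lebesgue_on \<Omega>) q \<psi> + (\<Sum>b\<in>Basis. Lp_norm (lebesgue_on \<Omega>) q (partial_deriv b \<psi>))"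
proof -
  note p = test_function_props[OF \<psi>]
  have Lp: "\<psi> \<in> Lp_space (lebesgue_on \<Omega>) q" 
    "b \<in> Basis \<Longrightarrow> partial_deriv b \<psi> \<in> Lp_space (lebesgue_on \<Omega>) q" for b
    using continuous_compact_support_Lp[OF \<Omega> q _ p(1,2)] p(4-7) by auto
  note w = test_function_has_weak_partial[OF \<Omega>(1) \<psi>]
  show "\<psi> \<in> W1 \<Omega> q"
    unfolding W1_def using Lp w by blast
  have "(\<Sum>b\<in>Basis. Lp_norm (lebesgue_on \<Omega>) q (weak_partial \<Omega> b \<psi>)) = (\<Sum>b\<in>Basis. Lp_norm (lebesgue_on \<Omega>) q (partial_deriv b \<psi>))"
    by (intro sum.cong refl weak_partial_chosen(3)[OF \<Omega>(1) w] Lp(2))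
  then show "W1_norm \<Omega> q \<psi> = Lp_norm (lebesgue_on \<Omega>) q \<psi> + (\<Sum>b\<in>Basis. Lp_norm (lebesgue_on \<Omega>) q (partial_deriv b \<psi>))"
    by (simp add: W1_norm_def)
qed

section \<open>Measure of preimages under expanding maps\<close>

lemma mem_cube_if_norm_le:
  fixes x z :: "'a::euclidean_space"
  assumes "norm (x - z) \<le> \<rho>"
  shows "x \<in> cbox (z - \<rho> *\<^sub>R One) (z + \<rho> *\<^sub>R One)"
  using order_trans[OF Basis_le_norm assms]
  by (auto simp: mem_box inner_diff_left inner_add_left abs_le_iff algebra_simps)

lemma emeasure_cube:
  fixes u v :: "'a::euclidean_space"
  assumes "\<And>i. i \<in> Basis \<Longrightarrow> v \<bullet> i - u \<bullet> i = s" "s \<ge> 0"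
  shows "emeasure lborel (box u v) = ennreal (s ^ DIM('a))"
proof -
  have "u \<bullet> i \<le> v \<bullet> i" if "i \<in> Basis" for i
    using assms(1)[OF that] assms(2) by simp
  then show ?thesis
    using assms by (simp add: inner_diff_left)
qed

lemma norm_diff_le_cube:
  fixes u v x y :: "'a::euclidean_space"
  assumes "\<And>i. i \<in> Basis \<Longrightarrow> v \<bullet> i - u \<bullet> i = s" "x \<in> cbox u v" "y \<in> cbox u v"
  shows "norm (x - y) \<le> real DIM('a) * s"
proof -
  have "norm (x - y) \<le> (\<Sum>i\<in>Basis. \<bar>(x - y) \<bullet> i\<bar>)"
    by (rule norm_le_l1)
  also have "\<dots> \<le> (\<Sum>i\<in>(Basis::'a set). s)"
  proof (rule sum_mono)
    fix i :: 'a assume i: "i \<in> Basis"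
    then have "u \<bullet> i \<le> x \<bullet> i" "x \<bullet> i \<le> v \<bullet> i" "u \<bullet> i \<le> y \<bullet> i" "y \<bullet> i \<le> v \<bullet> i"
      using assms(2,3) by (auto simp: mem_box)
    then show "\<bar>(x - y) \<bullet> i\<bar> \<le> s"
      using assms(1)[OF i] by (simp add: inner_diff_left abs_le_iff)
  qed
  finally show ?thesis by simp
qed

text \<open>The constant \<open>c\<close> may be smaller than 1: the map is allowed to contract distances, but by a bounded factor only.\<close>

definition expanding_on :: "real \<Rightarrow> 'c::metric_space set \<Rightarrow> ('c \<Rightarrow> 'a::metric_space) \<Rightarrow> bool" where
  "expanding_on c S \<Phi> \<longleftrightarrow> c > 0 \<and> (\<forall>x\<in>S. \<forall>y\<in>S. c * dist x y \<le> dist (\<Phi> x) (\<Phi> y))"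

text \<open>The preimage of a cube of side \<open>s\<close> has diameter at most \<open>d s / c\<close>, where \<open>d\<close> is the dimension, hence lies in a cube of
side \<open>2 d s / c\<close>. Because the dimensions agree, the volumes of the two cubes are proportional.\<close>

lemma expanding_vimage_cube:
  fixes \<Phi> :: "'c::euclidean_space \<Rightarrow> 'a::euclidean_space"
  assumes dim: "DIM('c) = DIM('a)" and exp: "expanding_on c S \<Phi>"
    and s: "\<And>i. i \<in> Basis \<Longrightarrow> v \<bullet> i - u \<bullet> i = s" "s \<ge> 0"
  obtains C where "C \<in> sets lborel" "S \<inter> \<Phi> -` cbox u v \<subseteq> C"
    "emeasure lborel C \<le> ennreal ((2 * real DIM('a) / c) ^ DIM('a)) * emeasure lborel (box u v)"
proof (cases "S \<inter> \<Phi> -` cbox u v = {}")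
  case True
  then show ?thesis using that[of "{}"] by simp
next
  case False
  then obtain z where z: "z \<in> S" "\<Phi> z \<in> cbox u v" by auto
  have c: "c > 0" using exp by (simp add: expanding_on_def)
  define \<rho> where "\<rho> = real DIM('a) * s / c"
  have \<rho>: "\<rho> \<ge> 0" using s c by (simp add: \<rho>_def)
  let ?C = "cbox (z - \<rho> *\<^sub>R One) (z + \<rho> *\<^sub>R One)"
  have "x \<in> ?C" if x: "x \<in> S" "\<Phi> x \<in> cbox u v" for x
  proof (rule mem_cube_if_norm_le)
    have "c * norm (x - z) \<le> norm (\<Phi> x - \<Phi> z)"
      using exp x z by (simp add: expanding_on_def dist_norm)
    also have "\<dots> \<le> real DIM('a) * s"
      using norm_diff_le_cube[OF s(1)] x z by blast
    finally show "norm (x - z) \<le> \<rho>"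
      using c by (simp add: \<rho>_def field_simps)
  qed
  then have sub: "S \<inter> \<Phi> -` cbox u v \<subseteq> ?C" by auto
  have "emeasure lborel ?C = ennreal ((2 * \<rho>) ^ DIM('a))"
    using \<rho> by (simp add: emeasure_lborel_cbox_eq inner_diff_left inner_add_left dim)
  also have "(2 * \<rho>) ^ DIM('a) = (2 * real DIM('a) / c) ^ DIM('a) * s ^ DIM('a)"
    by (simp add: \<rho>_def power_mult_distrib[symmetric] mult_ac)
  also have "ennreal \<dots> = ennreal ((2 * real DIM('a) / c) ^ DIM('a)) * emeasure lborel (box u v)"
    using c s(2) emeasure_cube[OF s] by (simp add: ennreal_mult)
  finally show ?thesis
    using that[of ?C] sub by simp
qed

text \<open>Cover \<open>A\<close> by countably many non-overlapping cubes of total volume close to the measure of \<open>A\<close> and apply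
\<open>expanding_vimage_cube\<close> to each of them.\<close>

lemma expanding_vimage_emeasure_le_bounded:
  fixes \<Phi> :: "'c::euclidean_space \<Rightarrow> 'a::euclidean_space"
  assumes dim: "DIM('c) = DIM('a)" and exp: "expanding_on c S \<Phi>"
    and A: "A \<in> sets borel" "bounded A"
  shows "emeasure lborel (S \<inter> \<Phi> -` A) \<le> ennreal ((2 * real DIM('a) / c) ^ DIM('a)) * emeasure lborel A"
proof -
  define K where "K = (2 * real DIM('a) / c) ^ DIM('a)"
  have c: "c > 0" using exp by (simp add: expanding_on_def)
  have K: "K > 0" using c by (simp add: K_def)
  obtain k where k: "k > 0" "A \<subseteq> cbox (- (k *\<^sub>R One)) (k *\<^sub>R One)"
  proof -
    obtain B where B: "B > 0" "\<And>x. x \<in> A \<Longrightarrow> norm x \<le> B"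
      using A(2) by (meson bounded_pos)
    then have "A \<subseteq> cbox (- (B *\<^sub>R One)) (B *\<^sub>R One)"
      using mem_cube_if_norm_le[of _ 0 B] by auto
    with B(1) that show ?thesis by blast
  qed
  have A_meas: "A \<in> lmeasurable"
    using A by (intro bounded_set_imp_lmeasurable) auto
  then have A_fin: "emeasure lborel A = ennreal (measure lebesgue A)"
    using A(1) emeasure_eq_measure2[OF A_meas] by simp
  have "emeasure lborel (S \<inter> \<Phi> -` A) \<le> ennreal K * emeasure lborel A + ennreal e" if "e > 0" for e
  proof -
    have eK: "e / K > 0" using that K by simp
    obtain \<D> where \<D>: "countable \<D>"
      "\<And>Q. Q \<in> \<D> \<Longrightarrow> Q \<subseteq> cbox (- (k *\<^sub>R One)) (k *\<^sub>R One) \<and> Q \<noteq> {} \<and> (\<exists>c d. Q = cbox c d)"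
      "pairwise (\<lambda>A B. interior A \<inter> interior B = {}) \<D>"
      "\<And>u v. cbox u v \<in> \<D> \<Longrightarrow> \<exists>n. \<forall>i \<in> Basis. v \<bullet> i - u \<bullet> i = ((k *\<^sub>R One) \<bullet> i - (- (k *\<^sub>R One)) \<bullet> i)/2^n"
      "A \<subseteq> \<Union>\<D>" "\<Union>\<D> \<in> lmeasurable" "measure lebesgue (\<Union>\<D>) \<le> measure lebesgue A + e / K"
    proof (rule measurable_outer_intervals_bounded[OF A_meas k(2) eK])
      fix \<D> assume "countable \<D>"
      "\<And>Q. Q \<in> \<D> \<Longrightarrow> Q \<subseteq> cbox (- (k *\<^sub>R One)) (k *\<^sub>R One) \<and> Q \<noteq> {} \<and> (\<exists>c d. Q = cbox c d)"
      "pairwise (\<lambda>A B. interior A \<inter> interior B = {}) \<D>"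
      "\<And>u v. cbox u v \<in> \<D> \<Longrightarrow> \<exists>n. \<forall>i \<in> Basis. v \<bullet> i - u \<bullet> i = ((k *\<^sub>R One) \<bullet> i - (- (k *\<^sub>R One)) \<bullet> i)/2^n"
      "A \<subseteq> \<Union>\<D>" "\<Union>\<D> \<in> lmeasurable" "measure lebesgue (\<Union>\<D>) \<le> measure lebesgue A + e / K"
      then show thesis by (rule that)
    qed
    have "\<exists>C. C \<in> sets lborel \<and> S \<inter> \<Phi> -` Q \<subseteq> C \<and> emeasure lborel C \<le> ennreal K * emeasure lborel (interior Q)"
      if Q: "Q \<in> \<D>" for Q
    proof -
      obtain u v where uv: "Q = cbox u v" using \<D>(2)[OF Q] by blast
      obtain n where "\<forall>i \<in> Basis. v \<bullet> i - u \<bullet> i = ((k *\<^sub>R One) \<bullet> i - (- (k *\<^sub>R One)) \<bullet> i)/2^n"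
        using \<D>(4) Q uv by blast
      then have n: "v \<bullet> i - u \<bullet> i = 2 * k / 2 ^ n" if "i \<in> Basis" for i
        using that by simp
      have "2 * k / 2 ^ n \<ge> 0" using k(1) by simp
      then obtain C where "C \<in> sets lborel" "S \<inter> \<Phi> -` cbox u v \<subseteq> C"
        "emeasure lborel C \<le> ennreal ((2 * real DIM('a) / c) ^ DIM('a)) * emeasure lborel (box u v)"
        using expanding_vimage_cube[OF dim exp n] by blast
      then show ?thesis
        unfolding uv K_def interior_cbox by (intro exI[of _ C] conjI)
    qed
    then have "\<forall>Q\<in>\<D>. \<exists>C. C \<in> sets lborel \<and> S \<inter> \<Phi> -` Q \<subseteq> C \<and>
        emeasure lborel C \<le> ennreal K * emeasure lborel (interior Q)" by (rule ballI)
    from bchoice[OF this] obtain C where C: "\<And>Q. Q \<in> \<D> \<Longrightarrow> C Q \<in> sets lborel" "\<And>Q. Q \<in> \<D> \<Longrightarrow> S \<inter> \<Phi> -` Q \<subseteq> C Q"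
      "\<And>Q. Q \<in> \<D> \<Longrightarrow> emeasure lborel (C Q) \<le> ennreal K * emeasure lborel (interior Q)"
      by blast
    \<comment> \<open>The family \<open>\<D>\<close> may be finite; indices beyond it are padded with the empty set. Interiors are used
      in \<open>Y\<close> because the cubes may overlap along faces.\<close>
    define X where "X n = (if n \<in> to_nat_on \<D> ` \<D> then C (from_nat_into \<D> n) else {})" for n
    define Y where "Y n = (if n \<in> to_nat_on \<D> ` \<D> then interior (from_nat_into \<D> n) else {})" for n
    have enum: "from_nat_into \<D> (to_nat_on \<D> Q) = Q" if "Q \<in> \<D>" for Q
      using \<D>(1) that by simp
    have XY: "X n \<in> sets lborel" "Y n \<in> sets lborel" "emeasure lborel (X n) \<le> ennreal K * emeasure lborel (Y n)" for n
      using C enum by (auto simp: X_def Y_def)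
    have disj: "disjoint_family Y"
      unfolding disjoint_family_on_def
    proof (intro ballI impI)
      fix m n :: nat assume "m \<noteq> n"
      show "Y m \<inter> Y n = {}"
      proof (cases "m \<in> to_nat_on \<D> ` \<D> \<and> n \<in> to_nat_on \<D> ` \<D>")
        case True
        then obtain P Q where PQ: "P \<in> \<D>" "m = to_nat_on \<D> P" "Q \<in> \<D>" "n = to_nat_on \<D> Q" by blast
        then have "P \<noteq> Q" using \<open>m \<noteq> n\<close> by blast
        then have "interior P \<inter> interior Q = {}"
          using \<D>(3) PQ by (simp add: pairwise_def)
        then show ?thesis
          using True PQ enum by (simp add: Y_def)
      qed (auto simp: Y_def)
    qed
    have "(\<Sum>n. emeasure lborel (Y n)) = emeasure lborel (\<Union>n. Y n)"
      using XY(2) disj by (intro suminf_emeasure) auto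
    also have "emeasure lborel (\<Union>n. Y n) = emeasure lebesgue (\<Union>n. Y n)"
      using XY(2) by (subst emeasure_completion) auto
    also have "\<dots> \<le> emeasure lebesgue (\<Union>\<D>)"
    proof (rule emeasure_mono)
      show "(\<Union>n. Y n) \<subseteq> \<Union>\<D>"
        using enum interior_subset by (fastforce simp: Y_def split: if_splits)
    qed (use \<D>(6) in auto)
    also have "\<dots> = ennreal (measure lebesgue (\<Union>\<D>))"
      using \<D>(6) by (simp add: emeasure_eq_measure2)
    also have "\<dots> \<le> ennreal (measure lebesgue A + e / K)"
      using \<D>(7) by (rule ennreal_leI)
    finally have Y_le: "(\<Sum>n. emeasure lborel (Y n)) \<le> ennreal (measure lebesgue A + e / K)" .
    have "S \<inter> \<Phi> -` A \<subseteq> (\<Union>n. X n)"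
    proof
      fix x assume x: "x \<in> S \<inter> \<Phi> -` A"
      then obtain Q where Q: "Q \<in> \<D>" "\<Phi> x \<in> Q" using \<D>(5) by blast
      then have "x \<in> C Q" using C(2) x by blast
      then have "x \<in> X (to_nat_on \<D> Q)"
        using Q enum by (simp add: X_def)
      then show "x \<in> (\<Union>n. X n)" by blast
    qed
    moreover have "(\<Union>n. X n) \<in> sets lborel"
      using XY(1) by blast
    ultimately have "emeasure lborel (S \<inter> \<Phi> -` A) \<le> emeasure lborel (\<Union>n. X n)"
      by (rule emeasure_mono)
    also have "\<dots> \<le> (\<Sum>n. emeasure lborel (X n))"
      using XY(1) by (intro emeasure_subadditive_countably) auto
    also have "\<dots> \<le> (\<Sum>n. ennreal K * emeasure lborel (Y n))"
      using XY(3) by (intro suminf_le) auto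
    also have "\<dots> = ennreal K * (\<Sum>n. emeasure lborel (Y n))"
      by simp
    also have "\<dots> \<le> ennreal K * ennreal (measure lebesgue A + e / K)"
      using Y_le by (rule mult_left_mono) simp
    also have "ennreal K * ennreal (measure lebesgue A + e / K) = ennreal K * emeasure lborel A + ennreal e"
    proof -
      have "ennreal K * ennreal (measure lebesgue A + e / K) = ennreal (K * (measure lebesgue A + e / K))"
        using K by (intro ennreal_mult[symmetric]) (use \<open>e > 0\<close> in auto)
      also have "K * (measure lebesgue A + e / K) = K * measure lebesgue A + e"
        using K by (simp add: distrib_left)
      also have "ennreal \<dots> = ennreal (K * measure lebesgue A) + ennreal e"
        using K \<open>e > 0\<close> by (intro ennreal_plus) auto
      also have "ennreal (K * measure lebesgue A) = ennreal K * emeasure lborel A"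
        using K unfolding A_fin by (intro ennreal_mult) auto
      finally show ?thesis .
    qed
    finally show ?thesis .
  qed
  then show ?thesis
    unfolding K_def[symmetric] by (rule ennreal_le_epsilon)
qed

lemma expanding_vimage_emeasure_le:
  fixes \<Phi> :: "'c::euclidean_space \<Rightarrow> 'a::euclidean_space"
  assumes dim: "DIM('c) = DIM('a)" and exp: "expanding_on c S \<Phi>"
    and S: "S \<in> sets borel" "\<Phi> \<in> borel_measurable (restrict_space borel S)" and A: "A \<in> sets borel"
  shows "emeasure lborel (S \<inter> \<Phi> -` A) \<le> ennreal ((2 * real DIM('a) / c) ^ DIM('a)) * emeasure lborel A"
proof -
  let ?K = "ennreal ((2 * real DIM('a) / c) ^ DIM('a))"
  have meas: "S \<inter> \<Phi> -` B \<in> sets borel" if "B \<in> sets borel" for B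
    using measurable_sets[OF S(2) that] S(1)
    by (simp add: space_restrict_space sets_restrict_space_iff Int_commute)
  let ?A = "\<lambda>k::nat. A \<inter> cball 0 (real k)"
  have "emeasure lborel (\<Union>k. S \<inter> \<Phi> -` ?A k) = (SUP k. emeasure lborel (S \<inter> \<Phi> -` ?A k))"
  proof (rule SUP_emeasure_incseq[symmetric])
    show "range (\<lambda>k. S \<inter> \<Phi> -` ?A k) \<subseteq> sets lborel"
    proof clarify
      fix k :: nat
      have "S \<inter> \<Phi> -` ?A k \<in> sets borel"
        using A by (intro meas) auto
      then show "S \<inter> \<Phi> -` ?A k \<in> sets lborel" by simp
    qed
    show "incseq (\<lambda>k. S \<inter> \<Phi> -` ?A k)"
      by (auto simp: incseq_def)
  qed
  also have "(\<Union>k. S \<inter> \<Phi> -` ?A k) = S \<inter> \<Phi> -` A"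
    using real_arch_simple by auto
  also have "(SUP k. emeasure lborel (S \<inter> \<Phi> -` ?A k)) \<le> ?K * emeasure lborel A"
  proof (rule SUP_least)
    fix k :: nat
    have "emeasure lborel (S \<inter> \<Phi> -` ?A k) \<le> ?K * emeasure lborel (?A k)"
      using A by (intro expanding_vimage_emeasure_le_bounded[OF dim exp]) (auto intro: bounded_Int)
    also have "\<dots> \<le> ?K * emeasure lborel A"
      using A by (intro mult_left_mono emeasure_mono) auto
    finally show "emeasure lborel (S \<inter> \<Phi> -` ?A k) \<le> ?K * emeasure lborel A" .
  qed
  finally show ?thesis .
qed

text \<open>The set inequality says that the image measure of Lebesgue measure on \<open>S\<close> is at most a multiple of Lebesgue measure.\<close>

lemma expanding_nn_integral_le:
  fixes \<Phi> :: "'c::euclidean_space \<Rightarrow> 'a::euclidean_space"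
  assumes dim: "DIM('c) = DIM('a)" and exp: "expanding_on c S \<Phi>"
    and S: "S \<in> sets borel" "\<Phi> \<in> borel_measurable (restrict_space borel S)" and G: "G \<in> borel_measurable borel"
  shows "(\<integral>\<^sup>+x. G (\<Phi> x) * indicator S x \<partial>lborel) \<le>
    ennreal ((2 * real DIM('a) / c) ^ DIM('a)) * (\<integral>\<^sup>+y. G y \<partial>lborel)"
proof -
  let ?K = "ennreal ((2 * real DIM('a) / c) ^ DIM('a))"
  let ?M = "distr (restrict_space lborel S) borel \<Phi>"
  have \<Phi>: "\<Phi> \<in> measurable (restrict_space lborel S) borel"
    using S(2) measurable_cong_sets[OF sets_restrict_space_cong[OF sets_lborel] refl] by blast
  have "(\<integral>\<^sup>+x. G (\<Phi> x) * indicator S x \<partial>lborel) = (\<integral>\<^sup>+x. G (\<Phi> x) \<partial>restrict_space lborel S)"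
    using S(1) by (simp add: nn_integral_restrict_space)
  also have "\<dots> = (\<integral>\<^sup>+y. G y \<partial>?M)"
    using \<Phi> G by (simp add: nn_integral_distr)
  also have "\<dots> \<le> (\<integral>\<^sup>+y. G y \<partial>scale_measure ?K lborel)"
  proof (rule nn_integral_mono_measure)
    show "sets ?M = sets (scale_measure ?K lborel)" by simp
    have "emeasure ?M A \<le> ?K * emeasure lborel A" for A
    proof (cases "A \<in> sets borel")
      case True
      have "emeasure ?M A = emeasure (restrict_space lborel S) (\<Phi> -` A \<inter> S)"
        using \<Phi> True by (simp add: emeasure_distr space_restrict_space)
      also have "\<dots> = emeasure lborel (S \<inter> \<Phi> -` A)"
        using S(1) by (subst emeasure_restrict_space) (auto simp: Int_commute)
      also have "\<dots> \<le> ?K * emeasure lborel A"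
        using True by (rule expanding_vimage_emeasure_le[OF dim exp S])
      finally show ?thesis .
    qed (simp add: emeasure_notin_sets)
    then have "emeasure ?M \<le> emeasure (scale_measure ?K lborel)"
      by (intro le_funI) simp
    then show "?M \<le> scale_measure ?K lborel"
      by (simp add: le_measure_iff space_scale_measure)
  qed
  also have "\<dots> = ?K * (\<integral>\<^sup>+y. G y \<partial>lborel)"
    using G by (intro nn_integral_scale_measure) simp
  finally show ?thesis .
qed

section \<open>Lines transversal to an immersed hypersurface\<close>

lemma C1_on_imp_continuous_on: "C1_on U X \<Longrightarrow> continuous_on U X"
  unfolding C1_on_def
  by (simp add: continuous_at_imp_continuous_on differentiable_imp_continuous_within)

lemma onorm_diff_le_sum_Basis:
  fixes f g :: "'m::euclidean_space \<Rightarrow> 'a::euclidean_space"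
  assumes "linear f" "linear g"
  shows "onorm (\<lambda>h. f h - g h) \<le> (\<Sum>b\<in>Basis. norm (f b - g b))"
proof (rule onorm_le)
  fix h :: 'm
  have rep: "F h = (\<Sum>b\<in>Basis. (h \<bullet> b) *\<^sub>R F b)" if "linear F" for F :: "'m \<Rightarrow> 'a"
    by (subst euclidean_representation[of h, symmetric])
       (simp add: linear_sum[OF that] linear_scale[OF that])
  have "f h - g h = (\<Sum>b\<in>Basis. (h \<bullet> b) *\<^sub>R (f b - g b))"
    unfolding rep[OF assms(1)] rep[OF assms(2)] by (simp add: scaleR_diff_right sum_subtractf)
  also have "norm \<dots> \<le> (\<Sum>b\<in>Basis. norm h * norm (f b - g b))"
    by (intro sum_norm_le) (simp add: Basis_le_norm mult_right_mono)
  also have "\<dots> = (\<Sum>b\<in>Basis. norm (f b - g b)) * norm h"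
    by (simp add: sum_distrib_left[symmetric] mult.commute)
  finally show "norm (f h - g h) \<le> (\<Sum>b\<in>Basis. norm (f b - g b)) * norm h" .
qed

text \<open>The linear map \<open>(h, t) \<mapsto> L h + t \<nu>\<close> with \<open>L\<close> the derivative of \<open>X\<close> at \<open>\<theta>0\<close> is injective, hence bounded below by some \<open>B\<close>.
On a ball on which the derivative of \<open>X\<close> differs from \<open>L\<close> by at most \<open>B / 2\<close>, the nonlinear map keeps the lower bound
\<open>B / 2\<close>. It is affine in \<open>t\<close>, so no restriction on \<open>t\<close> arises.\<close>

lemma transversal_expanding:
  fixes X :: "'m::euclidean_space \<Rightarrow> 'a::euclidean_space"
  assumes dim: "DIM('a) = DIM('m) + 1" and X: "C1_on U X" and \<theta>0: "\<theta>0 \<in> U"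
    and inj: "inj (frechet_derivative X (at \<theta>0))"
  obtains \<nu> r c where "\<nu> \<noteq> 0" "r > 0" "ball \<theta>0 r \<subseteq> U"
    "expanding_on c (ball \<theta>0 r \<times> UNIV) (\<lambda>(\<theta>, t::real). X \<theta> + t *\<^sub>R \<nu>)"
proof -
  define L where "L = frechet_derivative X (at \<theta>0)"
  have openU: "open U" and der: "\<And>x. x \<in> U \<Longrightarrow> (X has_derivative frechet_derivative X (at x)) (at x)"
    and cont: "\<And>b. b \<in> Basis \<Longrightarrow> continuous_on U (partial_deriv b X)"
    using X by (auto simp: C1_on_def frechet_derivative_works)
  have lin: "linear (frechet_derivative X (at x))" if "x \<in> U" for x
    using der[OF that] has_derivative_linear by blast
  then have linL: "linear L" and injL: "inj L"
    using \<theta>0 inj by (auto simp: L_def)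
  have "dim (range L) < DIM('a)"
    using dim_image_le[OF linL, of UNIV] dim by simp
  then have "range L \<noteq> UNIV" by auto
  then obtain \<nu> where \<nu>: "\<nu> \<notin> range L" by blast
  have \<nu>0: "\<nu> \<noteq> 0"
    using \<nu> linear_0[OF linL] rangeI[of L 0] by auto
  let ?\<Lambda> = "\<lambda>(h, t::real). L h + t *\<^sub>R \<nu>"
  have lin\<Lambda>: "linear ?\<Lambda>"
    by (rule linearI) (simp_all add: split_beta linear_add[OF linL] linear_scale[OF linL] scaleR_add_left scaleR_add_right)
  have "inj ?\<Lambda>"
  proof (subst linear_injective_0[OF lin\<Lambda>], clarify)
    fix h t assume eq: "L h + t *\<^sub>R \<nu> = 0"
    have "t = 0"
    proof (rule ccontr)
      assume "t \<noteq> 0"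
      have "t *\<^sub>R \<nu> = - L h"
        using eq by (simp add: eq_neg_iff_add_eq_0 add.commute)
      then have "inverse t *\<^sub>R (t *\<^sub>R \<nu>) = inverse t *\<^sub>R (- L h)"
        by (rule arg_cong)
      then have "\<nu> = L ((- inverse t) *\<^sub>R h)"
        using \<open>t \<noteq> 0\<close> unfolding linear_scale[OF linL] by simp
      with \<nu> show False by blast
    qed
    moreover from this have "h = 0"
      using eq injL linear_injective_0[OF linL] by simp
    ultimately show "(h, t) = 0" by (simp add: zero_prod_def)
  qed
  then obtain B where B: "B > 0" "\<And>p. B * norm p \<le> norm (?\<Lambda> p)"
    using linear_inj_bounded_below_pos[OF lin\<Lambda>] by blast
  \<comment> \<open>Dominates the operator norm of the difference of the derivatives at \<open>x\<close> and at \<open>\<theta>0\<close>.\<close>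
  define osc where "osc x = (\<Sum>b\<in>Basis. norm (partial_deriv b X x - partial_deriv b X \<theta>0))" for x
  have "continuous_on U osc"
    unfolding osc_def by (intro continuous_intros cont)
  then have "osc \<midarrow>\<theta>0\<rightarrow> osc \<theta>0"
    using openU \<theta>0 by (simp add: continuous_on_eq_continuous_at isCont_def)
  moreover have osc0: "osc \<theta>0 < B / 2"
    using B(1) by (simp add: osc_def)
  ultimately have "\<forall>\<^sub>F x in at \<theta>0. osc x < B / 2"
    by (rule order_tendstoD(2))
  then have "\<forall>\<^sub>F x in nhds \<theta>0. osc x < B / 2"
    unfolding eventually_at_filter by eventually_elim (use osc0 in auto)
  then have "\<forall>\<^sub>F x in nhds \<theta>0. osc x < B / 2 \<and> x \<in> U"
    using eventually_nhds_in_open[OF openU \<theta>0] by (rule eventually_conj)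
  then obtain r where r: "r > 0" "\<And>x. x \<in> ball \<theta>0 r \<Longrightarrow> osc x < B / 2 \<and> x \<in> U"
    by (auto simp: eventually_nhds_metric dist_commute)
  have ballU: "ball \<theta>0 r \<subseteq> U" using r by blast
  have close: "norm (X x - X y - L (x - y)) \<le> norm (x - y) * (B / 2)"
    if x: "x \<in> ball \<theta>0 r" and y: "y \<in> ball \<theta>0 r" for x y
    unfolding L_def
  proof (rule differentiable_bound_linearization[where S = "ball \<theta>0 r"])
    show "y + t *\<^sub>R (x - y) \<in> ball \<theta>0 r" if "t \<in> {0..1}" for t
    proof -
      have "(1 - t) *\<^sub>R y + t *\<^sub>R x \<in> ball \<theta>0 r"
        using convex_ball x y that by (intro convexD) auto
      then show ?thesis by (simp add: algebra_simps)
    qed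
    show "(X has_derivative frechet_derivative X (at z)) (at z within ball \<theta>0 r)" if "z \<in> ball \<theta>0 r" for z
      using der ballU that has_derivative_at_withinI by blast
    show "onorm (frechet_derivative X (at z) - frechet_derivative X (at \<theta>0)) \<le> B / 2" if z: "z \<in> ball \<theta>0 r" for z
    proof -
      have "onorm (\<lambda>h. frechet_derivative X (at z) h - frechet_derivative X (at \<theta>0) h) \<le> osc z"
        unfolding osc_def partial_deriv_def using lin ballU z \<theta>0 by (intro onorm_diff_le_sum_Basis) auto
      then show ?thesis
        using r(2)[OF z] by (simp add: fun_diff_def)
    qed
    show "\<theta>0 \<in> ball \<theta>0 r" using r by simp
  qed
  have "expanding_on (B / 2) (ball \<theta>0 r \<times> UNIV) (\<lambda>(\<theta>, t::real). X \<theta> + t *\<^sub>R \<nu>)"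
    unfolding expanding_on_def
  proof (intro conjI ballI)
    show "B / 2 > 0" using B by simp
    fix p q :: "'m \<times> real" assume "p \<in> ball \<theta>0 r \<times> UNIV" "q \<in> ball \<theta>0 r \<times> UNIV"
    then obtain x s y t where pq: "p = (x, s)" "q = (y, t)" "x \<in> ball \<theta>0 r" "y \<in> ball \<theta>0 r"
      by auto
    have "B * norm (p - q) \<le> norm (L (x - y) + (s - t) *\<^sub>R \<nu>)"
      using B(2)[of "p - q"] by (simp add: pq)
    also have "L (x - y) + (s - t) *\<^sub>R \<nu> =
        ((X x + s *\<^sub>R \<nu>) - (X y + t *\<^sub>R \<nu>)) - (X x - X y - L (x - y))"
      by (simp add: algebra_simps)
    also have "norm \<dots> \<le> norm ((X x + s *\<^sub>R \<nu>) - (X y + t *\<^sub>R \<nu>)) + norm (X x - X y - L (x - y))"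
      by (rule norm_triangle_ineq4)
    also have "norm (X x - X y - L (x - y)) \<le> norm (x - y) * (B / 2)"
      using close pq by blast
    also have "\<dots> \<le> norm (p - q) * (B / 2)"
      using B(1) norm_fst_le[of "x - y" "s - t"] by (intro mult_right_mono) (auto simp: pq)
    finally show "B / 2 * dist p q \<le> dist (case p of (\<theta>, t) \<Rightarrow> X \<theta> + t *\<^sub>R \<nu>) (case q of (\<theta>, t) \<Rightarrow> X \<theta> + t *\<^sub>R \<nu>)"
      by (simp add: pq(1,2) dist_norm algebra_simps)
  qed
  with that \<nu>0 r(1) ballU show thesis by blast
qed

section \<open>The trace inequality\<close>

lemma abs_powr_has_derivative:
  fixes s r :: real
  assumes r: "r > 1"
  shows "((\<lambda>s. \<bar>s\<bar> powr r) has_real_derivative r * \<bar>s\<bar> powr (r - 1) * sgn s) (at s)"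
proof -
  consider "s > 0" | "s < 0" | "s = 0" by linarith
  then show ?thesis
  proof cases
    case 1
    have "((\<lambda>s. s powr r) has_real_derivative r * s powr (r - 1)) (at s)"
      by (rule has_real_derivative_powr) (rule 1)
    then have "((\<lambda>s. \<bar>s\<bar> powr r) has_real_derivative r * s powr (r - 1)) (at s)"
      by (rule has_field_derivative_transform_within_open[where S = "{0<..}"]) (use 1 in auto)
    then show ?thesis using 1 by simp
  next
    case 2
    have "((\<lambda>s. (- s) powr r) has_real_derivative r * (- s) powr (r - 1) * (- 1)) (at s)"
      by (rule DERIV_chain2[OF has_real_derivative_powr]) (use 2 in \<open>auto intro!: derivative_eq_intros\<close>)
    then have "((\<lambda>s. \<bar>s\<bar> powr r) has_real_derivative r * (- s) powr (r - 1) * (- 1)) (at s)"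
      by (rule has_field_derivative_transform_within_open[where S = "{..<0}"]) (use 2 in auto)
    then show ?thesis using 2 by simp
  next
    case 3
    have "((\<lambda>h::real. \<bar>h\<bar> powr (r - 1)) \<longlongrightarrow> 0) (at 0)"
      using r by (intro tendsto_zero_powrI[where b = "r - 1"] tendsto_rabs_zero tendsto_intros) auto
    then have "((\<lambda>h::real. \<bar>h\<bar> powr r / h) \<longlongrightarrow> 0) (at 0)"
    proof (rule Lim_null_comparison[rotated])
      show "\<forall>\<^sub>F h in at (0::real). norm (\<bar>h\<bar> powr r / h) \<le> \<bar>h\<bar> powr (r - 1)"
        by (auto simp: eventually_at_filter powr_diff)
    qed
    then show ?thesis
      unfolding 3 using r by (simp add: DERIV_def)
  qed
qed

text \<open>The left-hand side is at most the \<open>r\<close>-th power of the larger of \<open>a\<close> and \<open>b\<close>.\<close>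

lemma mult_powr_le_sum_powr:
  fixes a b r :: real
  assumes "r \<ge> 1" "a \<ge> 0" "b \<ge> 0"
  shows "a powr (r - 1) * b \<le> a powr r + b powr r"
proof (cases "a = 0 \<or> b = 0")
  case False
  then have pos: "a > 0" "b > 0" using assms by auto
  show ?thesis
  proof (cases "b \<le> a")
    case True
    then have "a powr (r - 1) * b \<le> a powr (r - 1) * a powr 1"
      using pos by (intro mult_left_mono) auto
    also have "\<dots> = a powr r" by (subst powr_add[symmetric]) simp
    finally show ?thesis by (simp add: add_increasing2)
  next
    case False
    then have "a powr (r - 1) * b \<le> b powr (r - 1) * b powr 1"
      using pos assms by (intro mult_mono powr_mono2) auto
    also have "\<dots> = b powr r" by (subst powr_add[symmetric]) simp
    finally show ?thesis by (simp add: add_increasing)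
  qed
qed (use assms in auto)

text \<open>Integrand of the \<open>r\<close>-th power of the first-order Sobolev norm.\<close>

definition energy :: "real \<Rightarrow> ('a::euclidean_space \<Rightarrow> real) \<Rightarrow> 'a \<Rightarrow> real" where
  "energy r \<psi> y = \<bar>\<psi> y\<bar> powr r + (\<Sum>b\<in>Basis. \<bar>partial_deriv b \<psi> y\<bar> powr r)"

lemma energy_nonneg: "0 \<le> energy r \<psi> y"
  by (simp add: energy_def sum_nonneg)

lemma continuous_on_abs_powr:
  fixes f :: "'a::topological_space \<Rightarrow> real"
  assumes "continuous_on S f" "r > 0"
  shows "continuous_on S (\<lambda>x. \<bar>f x\<bar> powr r)"
  by (rule continuous_on_powr'[OF continuous_on_rabs[OF assms(1)] continuous_on_const]) (use assms(2) in auto)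

lemma energy_continuous:
  assumes "\<psi> \<in> test_functions \<Omega>" "r > 0"
  shows "continuous_on UNIV (energy r \<psi>)"
  unfolding energy_def[abs_def] using assms test_function_props(4,5)[OF assms(1)]
  by (intro continuous_on_add continuous_on_sum continuous_on_abs_powr) auto

lemma powr_directional_deriv_le_energy:
  fixes \<nu> :: "'a::euclidean_space"
  assumes \<psi>: "\<psi> \<in> test_functions \<Omega>" and r: "r > 1"
  shows "r * \<bar>\<psi> y\<bar> powr (r - 1) * \<bar>partial_deriv \<nu> \<psi> y\<bar> \<le> r * norm \<nu> * real DIM('a) * energy r \<psi> y"
proof -
  let ?a = "\<bar>\<psi> y\<bar>"
  have "\<bar>partial_deriv \<nu> \<psi> y\<bar> \<le> (\<Sum>b\<in>Basis. norm \<nu> * \<bar>partial_deriv b \<psi> y\<bar>)"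
    unfolding partial_deriv_direction[OF test_function_props(3)[OF \<psi>], of \<nu>]
    by (rule order_trans[OF sum_abs]) (auto intro!: sum_mono mult_right_mono simp: abs_mult Basis_le_norm)
  then have "?a powr (r - 1) * \<bar>partial_deriv \<nu> \<psi> y\<bar> \<le> ?a powr (r - 1) * (\<Sum>b\<in>Basis. norm \<nu> * \<bar>partial_deriv b \<psi> y\<bar>)"
    by (rule mult_left_mono) simp
  also have "\<dots> = norm \<nu> * (\<Sum>b\<in>Basis. ?a powr (r - 1) * \<bar>partial_deriv b \<psi> y\<bar>)"
    by (simp add: sum_distrib_left mult_ac)
  also have "\<dots> \<le> norm \<nu> * (\<Sum>b\<in>(Basis::'a set). energy r \<psi> y)"
  proof (intro mult_left_mono sum_mono)
    fix b :: 'a assume b: "b \<in> Basis"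
    have "?a powr (r - 1) * \<bar>partial_deriv b \<psi> y\<bar> \<le> ?a powr r + \<bar>partial_deriv b \<psi> y\<bar> powr r"
      using r by (intro mult_powr_le_sum_powr) auto
    also have "\<dots> \<le> energy r \<psi> y"
      unfolding energy_def using b by (intro add_left_mono member_le_sum) auto
    finally show "?a powr (r - 1) * \<bar>partial_deriv b \<psi> y\<bar> \<le> energy r \<psi> y" .
  qed simp
  finally show ?thesis
    using r by (simp add: mult_ac mult_left_mono)
qed

text \<open>Far out on the line \<open>\<psi>\<close> vanishes, so \<open>\<bar>\<psi> x\<bar>\<^sup>r\<close> is minus the integral of the derivative of \<open>t \<mapsto> \<bar>\<psi> (x + t \<nu>)\<bar>\<^sup>r\<close>.\<close>

lemma powr_le_line_integral:
  fixes \<nu> x :: "'a::euclidean_space"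
  assumes \<psi>: "\<psi> \<in> test_functions \<Omega>" and r: "r > 1" and \<nu>: "\<nu> \<noteq> 0"
  shows "ennreal (\<bar>\<psi> x\<bar> powr r) \<le> (\<integral>\<^sup>+t. ennreal (r * norm \<nu> * real DIM('a) * energy r \<psi> (x + t *\<^sub>R \<nu>)) \<partial>lborel)"
proof -
  note p = test_function_props[OF \<psi>]
  obtain R where R: "R > 0" "\<And>y. y \<in> test_supp \<psi> \<Longrightarrow> norm y \<le> R"
    using compact_imp_bounded[OF p(1)] by (meson bounded_pos)
  \<comment> \<open>Chosen such that the point with parameter \<open>T\<close> has norm at least \<open>R + 1\<close>, outside the support.\<close>
  define T where "T = (R + norm x + 1) / norm \<nu>"
  have T: "T > 0" using R \<nu> by (simp add: T_def add_pos_nonneg)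
  have "norm (T *\<^sub>R \<nu>) = R + norm x + 1"
    using \<nu> T R by (simp add: T_def)
  then have "norm (x + T *\<^sub>R \<nu>) > R"
    using norm_triangle_ineq4[of "x + T *\<^sub>R \<nu>" x] by simp
  then have end0: "\<psi> (x + T *\<^sub>R \<nu>) = 0"
    using R p(6) by (meson not_less)
  let ?g = "\<lambda>t. r * norm \<nu> * real DIM('a) * energy r \<psi> (x + t *\<^sub>R \<nu>)"
  have g_cont: "continuous_on UNIV ?g"
    by (intro continuous_intros continuous_on_compose2[OF energy_continuous[OF \<psi>]]) (use r in auto)
  let ?h' = "\<lambda>t. r * \<bar>\<psi> (x + t *\<^sub>R \<nu>)\<bar> powr (r - 1) * sgn (\<psi> (x + t *\<^sub>R \<nu>)) * partial_deriv \<nu> \<psi> (x + t *\<^sub>R \<nu>)"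
  have "(?h' has_integral (\<bar>\<psi> (x + T *\<^sub>R \<nu>)\<bar> powr r - \<bar>\<psi> (x + 0 *\<^sub>R \<nu>)\<bar> powr r)) {0..T}"
  proof (rule fundamental_theorem_of_calculus)
    fix t
    have "((\<lambda>t. \<bar>\<psi> (x + t *\<^sub>R \<nu>)\<bar> powr r) has_real_derivative ?h' t) (at t)"
      by (rule DERIV_chain2[OF abs_powr_has_derivative[OF r] has_derivative_along_line[OF p(3)]])
    then show "((\<lambda>t. \<bar>\<psi> (x + t *\<^sub>R \<nu>)\<bar> powr r) has_vector_derivative ?h' t) (at t within {0..T})"
      by (simp add: has_real_derivative_iff_has_vector_derivative has_vector_derivative_at_within)
  qed (use T in simp)
  then have h': "(?h' has_integral (- (\<bar>\<psi> x\<bar> powr r))) {0..T}"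
    using r by (simp add: end0)
  have g_int: "?g integrable_on {0..T}"
    by (rule integrable_continuous_real) (rule continuous_on_subset[OF g_cont], simp)
  have "\<bar>?h' t\<bar> \<le> ?g t" for t
    using powr_directional_deriv_le_energy[OF \<psi> r, of "x + t *\<^sub>R \<nu>" \<nu>] r energy_nonneg[of r \<psi> "x + t *\<^sub>R \<nu>"]
    by (cases "\<psi> (x + t *\<^sub>R \<nu>) = 0") (auto simp: abs_mult abs_sgn_eq)
  then have "norm (integral {0..T} ?h') \<le> integral {0..T} ?g"
    using h' g_int by (intro integral_norm_bound_integral) (auto intro: has_integral_integrable)
  then have le: "\<bar>\<psi> x\<bar> powr r \<le> integral {0..T} ?g"
    using integral_unique[OF h'] by simp
  have "((\<lambda>t. if t \<in> {0..T} then ?g t else 0) has_integral integral {0..T} ?g) UNIV"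
    using g_int by (simp only: has_integral_restrict_UNIV integrable_integral)
  moreover have "(\<lambda>t. if t \<in> {0..T} then ?g t else 0) \<in> borel_measurable borel"
    using g_cont by (intro measurable_If_set) (auto intro: borel_measurable_continuous_onI)
  ultimately have "(\<integral>\<^sup>+t. ennreal (if t \<in> {0..T} then ?g t else 0) \<partial>lborel) = ennreal (integral {0..T} ?g)"
    using r by (intro nn_integral_has_integral_lborel) (auto simp: energy_nonneg)
  then have "ennreal (\<bar>\<psi> x\<bar> powr r) \<le> (\<integral>\<^sup>+t. ennreal (if t \<in> {0..T} then ?g t else 0) \<partial>lborel)"
    using le by (simp add: ennreal_leI)
  also have "\<dots> \<le> (\<integral>\<^sup>+t. ennreal (?g t) \<partial>lborel)"
    using r by (intro nn_integral_mono ennreal_leI) (auto simp: energy_nonneg)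
  finally show ?thesis .
qed

text \<open>Integrate the line inequality over the parameters in \<open>B\<close>, combine the two integrations by Tonelli's theorem, and compare
the result with an integral over the target space.\<close>

lemma local_trace_inequality:
  fixes X :: "'m::euclidean_space \<Rightarrow> 'a::euclidean_space"
  assumes dim: "DIM('a) = DIM('m) + 1" and X: "continuous_on B X" and B: "B \<in> sets borel"
    and \<nu>: "\<nu> \<noteq> 0" and exp: "expanding_on c (B \<times> UNIV) (\<lambda>(\<theta>, t::real). X \<theta> + t *\<^sub>R \<nu>)"
    and r: "r > 1" and \<psi>: "\<psi> \<in> test_functions \<Omega>"
  shows "(\<integral>\<^sup>+\<theta>. ennreal (\<bar>\<psi> (X \<theta>)\<bar> powr r) * indicator B \<theta> \<partial>lborel) \<le>
    ennreal ((2 * real DIM('a) / c) ^ DIM('a) * (r * norm \<nu> * real DIM('a))) * (\<integral>\<^sup>+y. ennreal (energy r \<psi> y) \<partial>lborel)"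
proof -
  let ?k = "r * norm \<nu> * real DIM('a)"
  let ?\<Phi> = "\<lambda>(\<theta>, t::real). X \<theta> + t *\<^sub>R \<nu>"
  let ?S = "B \<times> (UNIV :: real set)"
  let ?G = "\<lambda>y. ennreal (?k * energy r \<psi> y)"
  let ?K = "(2 * real DIM('a) / c) ^ DIM('a)"
  have c: "c > 0" using exp by (simp add: expanding_on_def)
  have E: "energy r \<psi> \<in> borel_measurable borel"
    using energy_continuous[OF \<psi>] r by (intro borel_measurable_continuous_onI) auto
  have S: "?S \<in> sets borel"
    using B by (simp add: borel_prod[symmetric])
  have "continuous_on ?S ?\<Phi>"
    unfolding split_beta
    by (intro continuous_intros continuous_on_compose2[OF X]) auto
  then have \<Phi>: "?\<Phi> \<in> borel_measurable (restrict_space borel ?S)"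
    by (rule borel_measurable_continuous_on_restrict)
  have "(\<lambda>p. ?G (?\<Phi> p)) \<in> borel_measurable (restrict_space borel ?S)"
    using measurable_compose[OF \<Phi>, of ?G] E by simp
  then have meas: "(\<lambda>p. ?G (?\<Phi> p) * indicator ?S p) \<in> borel_measurable (lborel \<Otimes>\<^sub>M lborel)"
    using S borel_measurable_restrict_space_iff_ennreal[of ?S borel "\<lambda>p. ?G (?\<Phi> p)"]
    by (simp add: lborel_prod)
  have "(\<integral>\<^sup>+\<theta>. ennreal (\<bar>\<psi> (X \<theta>)\<bar> powr r) * indicator B \<theta> \<partial>lborel) \<le>
      (\<integral>\<^sup>+\<theta>. (\<integral>\<^sup>+t. ?G (X \<theta> + t *\<^sub>R \<nu>) * indicator ?S (\<theta>, t) \<partial>lborel) \<partial>lborel)"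
  proof (rule nn_integral_mono)
    fix \<theta>
    show "ennreal (\<bar>\<psi> (X \<theta>)\<bar> powr r) * indicator B \<theta> \<le> (\<integral>\<^sup>+t. ?G (X \<theta> + t *\<^sub>R \<nu>) * indicator ?S (\<theta>, t) \<partial>lborel)"
      using powr_le_line_integral[OF \<psi> r \<nu>, of "X \<theta>"] by (cases "\<theta> \<in> B") auto
  qed
  also have "\<dots> = (\<integral>\<^sup>+p. ?G (?\<Phi> p) * indicator ?S p \<partial>(lborel \<Otimes>\<^sub>M lborel))"
    using lborel.nn_integral_fst[OF meas] by simp
  also have "\<dots> = (\<integral>\<^sup>+p. ?G (?\<Phi> p) * indicator ?S p \<partial>lborel)"
    by (simp add: lborel_prod)
  also have "\<dots> \<le> ennreal ?K * (\<integral>\<^sup>+y. ?G y \<partial>lborel)"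
    using dim E by (intro expanding_nn_integral_le[OF _ exp S \<Phi>]) auto
  also have "(\<integral>\<^sup>+y. ?G y \<partial>lborel) = ennreal ?k * (\<integral>\<^sup>+y. ennreal (energy r \<psi> y) \<partial>lborel)"
    using r E by (subst nn_integral_cmult[symmetric]) (auto simp: ennreal_mult energy_nonneg)
  also have "ennreal ?K * (ennreal ?k * (\<integral>\<^sup>+y. ennreal (energy r \<psi> y) \<partial>lborel)) =
      ennreal (?K * ?k) * (\<integral>\<^sup>+y. ennreal (energy r \<psi> y) \<partial>lborel)"
    using c r by (simp add: ennreal_mult mult.assoc)
  finally show ?thesis .
qed

text \<open>Finitely many balls on which the local inequality holds cover the closure of \<open>\<Theta>\<close>; the constants add up.\<close>

lemma trace_inequality:
  fixes X :: "'m::euclidean_space \<Rightarrow> 'a::euclidean_space"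
  assumes dim: "DIM('a) = DIM('m) + 1" and \<Theta>: "bounded \<Theta>" "\<Theta> \<in> sets lebesgue" and U: "closure \<Theta> \<subseteq> U" and X: "C1_on U X"
    and inj: "\<And>\<theta>. \<theta> \<in> closure \<Theta> \<Longrightarrow> inj (frechet_derivative X (at \<theta>))" and r: "r > 1"
  obtains C where "C \<ge> 0" "\<And>\<psi> :: 'a \<Rightarrow> real. \<And>\<Omega>. \<psi> \<in> test_functions \<Omega> \<Longrightarrow>
    (\<integral>\<^sup>+\<theta>. ennreal (\<bar>\<psi> (X \<theta>)\<bar> powr r) \<partial>lebesgue_on \<Theta>) \<le> ennreal C * (\<integral>\<^sup>+y. ennreal (energy r \<psi> y) \<partial>lborel)"
proof -
  have Xc: "continuous_on U X" using X by (rule C1_on_imp_continuous_on)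
  \<comment> \<open>The constant must be found before the test function, as it has to serve all of them.\<close>
  define good where "good \<theta> \<rho> C \<longleftrightarrow> \<rho> > 0 \<and> C \<ge> 0 \<and> ball \<theta> \<rho> \<subseteq> U \<and>
      (\<forall>(\<psi> :: 'a \<Rightarrow> real) \<Omega>. \<psi> \<in> test_functions \<Omega> \<longrightarrow>
        (\<integral>\<^sup>+x. ennreal (\<bar>\<psi> (X x)\<bar> powr r) * indicator (ball \<theta> \<rho>) x \<partial>lborel) \<le>
          ennreal C * (\<integral>\<^sup>+y. ennreal (energy r \<psi> y) \<partial>lborel))" for \<theta> \<rho> C
  have "\<exists>\<rho> C. good \<theta> \<rho> C" if \<theta>: "\<theta> \<in> closure \<Theta>" for \<theta>
  proof -
    have "\<theta> \<in> U" using \<theta> U by blast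
    then obtain \<nu> \<rho> c where *: "\<nu> \<noteq> 0" "\<rho> > 0" "ball \<theta> \<rho> \<subseteq> U"
      "expanding_on c (ball \<theta> \<rho> \<times> UNIV) (\<lambda>(\<theta>, t::real). X \<theta> + t *\<^sub>R \<nu>)"
      by (rule transversal_expanding[OF dim X _ inj[OF \<theta>]])
    let ?C = "(2 * real DIM('a) / c) ^ DIM('a) * (r * norm \<nu> * real DIM('a))"
    have "c > 0" using *(4) by (simp add: expanding_on_def)
    then have "?C \<ge> 0" using r by simp
    moreover have "continuous_on (ball \<theta> \<rho>) X" using Xc *(3) by (rule continuous_on_subset)
    ultimately have "good \<theta> \<rho> ?C"
      unfolding good_def using *(2,3) local_trace_inequality[OF dim _ _ *(1,4) r] by simp
    then show ?thesis by blast
  qed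
  then obtain \<rho> C where "\<And>\<theta>. \<theta> \<in> closure \<Theta> \<Longrightarrow> good \<theta> (\<rho> \<theta>) (C \<theta>)"
    by metis
  then have \<rho>C: "\<rho> \<theta> > 0" "C \<theta> \<ge> 0" "ball \<theta> (\<rho> \<theta>) \<subseteq> U"
    "\<And>(\<psi> :: 'a \<Rightarrow> real) \<Omega>. \<psi> \<in> test_functions \<Omega> \<Longrightarrow>
      (\<integral>\<^sup>+x. ennreal (\<bar>\<psi> (X x)\<bar> powr r) * indicator (ball \<theta> (\<rho> \<theta>)) x \<partial>lborel) \<le>
        ennreal (C \<theta>) * (\<integral>\<^sup>+y. ennreal (energy r \<psi> y) \<partial>lborel)" if "\<theta> \<in> closure \<Theta>" for \<theta>
    using that unfolding good_def by blast+
  have "compact (closure \<Theta>)" using \<Theta>(1) by (simp add: compact_closure)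
  then obtain D where D: "D \<subseteq> closure \<Theta>" "finite D" "closure \<Theta> \<subseteq> (\<Union>\<theta>\<in>D. ball \<theta> (\<rho> \<theta>))"
  proof (rule compactE_image)
    show "closure \<Theta> \<subseteq> (\<Union>\<theta>\<in>closure \<Theta>. ball \<theta> (\<rho> \<theta>))"
      using \<rho>C(1) centre_in_ball by blast
  qed auto
  have D_good: "C \<theta> \<ge> 0" "ball \<theta> (\<rho> \<theta>) \<subseteq> U" if "\<theta> \<in> D" for \<theta>
    using \<rho>C(2,3) subsetD[OF D(1) that] by blast+
  show thesis
  proof
    show "(\<Sum>\<theta>\<in>D. C \<theta>) \<ge> 0" using D_good(1) by (rule sum_nonneg)
    fix \<psi> :: "'a \<Rightarrow> real" and \<Omega> assume \<psi>: "\<psi> \<in> test_functions \<Omega>"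
    let ?E = "\<integral>\<^sup>+y. ennreal (energy r \<psi> y) \<partial>lborel"
    let ?f = "\<lambda>x. ennreal (\<bar>\<psi> (X x)\<bar> powr r)"
    have meas: "(\<lambda>x. ?f x * indicator (ball \<theta> (\<rho> \<theta>)) x) \<in> borel_measurable lborel" if "\<theta> \<in> D" for \<theta>
    proof -
      have "continuous_on (ball \<theta> (\<rho> \<theta>)) (\<lambda>x. \<bar>\<psi> (X x)\<bar> powr r)"
      proof (rule continuous_on_abs_powr)
        have "continuous_on (ball \<theta> (\<rho> \<theta>)) X"
          by (rule continuous_on_subset[OF Xc D_good(2)[OF that]])
        then show "continuous_on (ball \<theta> (\<rho> \<theta>)) (\<lambda>x. \<psi> (X x))"
          by (rule continuous_on_compose2[OF test_function_props(4)[OF \<psi>]]) (rule subset_UNIV)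
      qed (use r in simp)
      then have "?f \<in> borel_measurable (restrict_space borel (ball \<theta> (\<rho> \<theta>)))"
        by (intro measurable_compose[OF borel_measurable_continuous_on_restrict measurable_ennreal])
      then show ?thesis
        by (subst (asm) borel_measurable_restrict_space_iff_ennreal) auto
    qed
    have "(\<integral>\<^sup>+\<theta>. ?f \<theta> \<partial>lebesgue_on \<Theta>) = (\<integral>\<^sup>+x. ?f x * indicator \<Theta> x \<partial>lborel)"
      using \<Theta>(2) by (simp add: nn_integral_restrict_space nn_integral_completion)
    also have "\<dots> \<le> (\<integral>\<^sup>+x. (\<Sum>\<theta>\<in>D. ?f x * indicator (ball \<theta> (\<rho> \<theta>)) x) \<partial>lborel)"
    proof (rule nn_integral_mono)
      fix x
      show "?f x * indicator \<Theta> x \<le> (\<Sum>\<theta>\<in>D. ?f x * indicator (ball \<theta> (\<rho> \<theta>)) x)"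
      proof (cases "x \<in> \<Theta>")
        case True
        then obtain \<theta> where "\<theta> \<in> D" "x \<in> ball \<theta> (\<rho> \<theta>)"
          using D(3) closure_subset by blast
        then show ?thesis
          using True D(2) member_le_sum[of \<theta> D "\<lambda>\<theta>. ?f x * indicator (ball \<theta> (\<rho> \<theta>)) x"] by simp
      qed simp
    qed
    also have "\<dots> = (\<Sum>\<theta>\<in>D. \<integral>\<^sup>+x. ?f x * indicator (ball \<theta> (\<rho> \<theta>)) x \<partial>lborel)"
      using meas by (rule nn_integral_sum)
    also have "\<dots> \<le> (\<Sum>\<theta>\<in>D. ennreal (C \<theta>) * ?E)"
      by (intro sum_mono \<rho>C(4)[OF subsetD[OF D(1)] \<psi>])
    also have "\<dots> = ennreal (\<Sum>\<theta>\<in>D. C \<theta>) * ?E"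
      using D_good(1) by (simp add: sum_distrib_right[symmetric] sum_ennreal)
    finally show "(\<integral>\<^sup>+\<theta>. ?f \<theta> \<partial>lebesgue_on \<Theta>) \<le> ennreal (\<Sum>\<theta>\<in>D. C \<theta>) * ?E" .
  qed
qed

section \<open>The boundary functional on test functions\<close>

lemma test_functions_add:
  assumes "\<psi> \<in> test_functions \<Omega>" "\<phi> \<in> test_functions \<Omega>"
  shows "(\<lambda>x. \<psi> x + \<phi> x) \<in> test_functions \<Omega>"
proof -
  have "{x. \<psi> x + \<phi> x \<noteq> 0} \<subseteq> {x. \<psi> x \<noteq> 0} \<union> {x. \<phi> x \<noteq> 0}" by auto
  then have sub: "closure {x. \<psi> x + \<phi> x \<noteq> 0} \<subseteq> closure {x. \<psi> x \<noteq> 0} \<union> closure {x. \<phi> x \<noteq> 0}"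
    unfolding closure_Un[symmetric] by (rule closure_mono)
  moreover have "compact (closure {x. \<psi> x \<noteq> 0} \<union> closure {x. \<phi> x \<noteq> 0})"
    using assms by (intro compact_Un) (simp_all add: test_functions_def)
  ultimately have "compact (closure {x. \<psi> x + \<phi> x \<noteq> 0})"
    unfolding compact_eq_bounded_closed using bounded_subset closed_closure by blast
  moreover have "closure {x. \<psi> x + \<phi> x \<noteq> 0} \<subseteq> \<Omega>"
    using sub assms unfolding test_functions_def by blast
  ultimately show ?thesis
    using assms by (simp add: test_functions_def Ck_add)
qed

lemma test_functions_scale:
  assumes "\<psi> \<in> test_functions \<Omega>"
  shows "(\<lambda>x. c * \<psi> x) \<in> test_functions \<Omega>"
proof (cases "c = 0")
  case True
  then show ?thesis by (simp add: test_functions_def Ck_const)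
next
  case False
  then show ?thesis
    using assms by (simp add: test_functions_def Ck_mult Ck_const)
qed

lemma conj_exponent_cases:
  assumes "1 \<le> p" "p < \<infinity>"
  obtains "p = ennreal 1" "conj_exponent p = \<infinity>"
  | s r where "s > 1" "r > 1" "1 / s + 1 / r = 1" "p = ennreal s" "conj_exponent p = ennreal r"
proof -
  obtain s where s: "s \<ge> 1" "p = ennreal s"
    using assms by (cases rule: exponent_cases[OF assms(1)]) auto
  show thesis
  proof (cases "s = 1")
    case True
    then show thesis using that(1) s by (simp add: conj_exponent_def)
  next
    case False
    with s have s1: "s > 1" by simp
    then have pos: "1 - inverse s > 0" by (simp add: field_simps)
    have "conj_exponent p = ennreal (inverse (1 - inverse s))"
      using s s1 pos by (simp add: conj_exponent_def inverse_ennreal ennreal_minus flip: ennreal_1)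
    moreover have "inverse (1 - inverse s) > 1" "1 / s + 1 / inverse (1 - inverse s) = 1"
      using s1 pos by (auto simp: field_simps)
    ultimately show thesis using that(2)[OF s1] s(2) by blast
  qed
qed

text \<open>The points violating the inequality form an open null set.\<close>

lemma abs_le_Lp_norm_infinity:
  fixes \<psi> :: "'a::euclidean_space \<Rightarrow> real"
  assumes \<Omega>: "open \<Omega>" "\<Omega> \<noteq> {}" and \<psi>: "continuous_on \<Omega> \<psi>" "\<psi> \<in> Lp_space (lebesgue_on \<Omega>) \<infinity>" and x: "x \<in> \<Omega>"
  shows "\<bar>\<psi> x\<bar> \<le> Lp_norm (lebesgue_on \<Omega>) \<infinity> \<psi>"
proof -
  let ?N = "Lp_norm (lebesgue_on \<Omega>) \<infinity> \<psi>"
  let ?S = "{x \<in> \<Omega>. ?N < \<bar>\<psi> x\<bar>}"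
  have "open ?S"
    using continuous_open_preimage[OF continuous_on_rabs[OF \<psi>(1)] \<Omega>(1) open_greaterThan[of ?N]]
    by (simp add: vimage_def Int_def)
  moreover have "AE x in lebesgue. x \<in> \<Omega> \<longrightarrow> \<bar>\<psi> x\<bar> \<le> ?N"
    using Lp_norm_infinity_AE[OF \<psi>(2) lebesgue_on_open_nonnull[OF \<Omega>]] \<Omega>(1)
    by (simp add: AE_restrict_space_iff)
  then have "negligible {x. \<not> (x \<in> \<Omega> \<longrightarrow> \<bar>\<psi> x\<bar> \<le> ?N)}"
    by (simp add: AE_iff_null_sets negligible_iff_null_sets completion.AE_iff_null_sets Compl_eq)
  then have "negligible ?S"
    by (simp add: not_le)
  ultimately have "?S = {}"
    using open_not_negligible by blast
  then have "x \<notin> ?S" by (simp only: empty_iff not_False_eq_True)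
  then show ?thesis using x by (simp add: not_less)
qed

lemma integral_energy_le:
  fixes \<psi> :: "'a::euclidean_space \<Rightarrow> real"
  assumes \<Omega>: "open \<Omega>" "\<Omega> \<noteq> {}" and r: "r > 1" and \<psi>: "\<psi> \<in> test_functions \<Omega>"
  shows "integrable lborel (energy r \<psi>)"
    "integral\<^sup>L lborel (energy r \<psi>) \<le> (1 + real DIM('a)) * W1_norm \<Omega> (ennreal r) \<psi> powr r"
proof -
  note p = test_function_props[OF \<psi>]
  let ?L = "Lp_norm (lebesgue_on \<Omega>) (ennreal r)"
  let ?N = "W1_norm \<Omega> (ennreal r) \<psi>"
  have L: "integrable lborel (\<lambda>x. \<bar>f x\<bar> powr r)" "(LINT x|lborel. \<bar>f x\<bar> powr r) = ?L f powr r"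
    if f: "continuous_on UNIV f" "\<And>x. x \<notin> test_supp \<psi> \<Longrightarrow> f x = 0" for f :: "'a \<Rightarrow> real"
  proof -
    have c: "continuous_on UNIV (\<lambda>x. \<bar>f x\<bar> powr r)"
      using f(1) r by (intro continuous_on_abs_powr) auto
    show "integrable lborel (\<lambda>x. \<bar>f x\<bar> powr r)"
      by (rule integrable_lborel_compact_support[OF c p(1)]) (simp add: f(2))
    have "f x = 0" if "x \<notin> \<Omega>" for x
      using f(2) p(2) that by blast
    then show "(LINT x|lborel. \<bar>f x\<bar> powr r) = ?L f powr r"
      using integral_lebesgue_on_eq_lborel(1)[OF c, of \<Omega>] \<Omega>(1) r by (simp add: Lp_norm_finite_powr)
  qed
  note L\<psi> = L[OF p(4) p(6)] and Ld = L[OF p(5) p(7)]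
  show "integrable lborel (energy r \<psi>)"
    unfolding energy_def using L\<psi>(1) Ld(1) by (intro Bochner_Integration.integrable_add integrable_sum) auto
  have nn: "0 \<le> ?L f" for f
    using r by (simp add: Lp_norm_finite)
  have N: "?N = ?L \<psi> + (\<Sum>b\<in>Basis. ?L (partial_deriv b \<psi>))"
    using test_function_W1(2)[OF \<Omega> _ \<psi>] r by simp
  have le: "?L \<psi> \<le> ?N" "b \<in> Basis \<Longrightarrow> ?L (partial_deriv b \<psi>) \<le> ?N" for b
    unfolding N using nn by (auto intro!: add_increasing2 add_increasing sum_nonneg member_le_sum)
  have "integral\<^sup>L lborel (energy r \<psi>) = ?L \<psi> powr r + (\<Sum>b\<in>Basis. ?L (partial_deriv b \<psi>) powr r)"
    unfolding energy_def using L\<psi> Ld by (simp add: integral_sum)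
  also have "\<dots> \<le> ?N powr r + (\<Sum>b\<in>(Basis::'a set). ?N powr r)"
    using le nn r by (intro add_mono sum_mono powr_mono2) auto
  also have "\<dots> = (1 + real DIM('a)) * ?N powr r"
    by (simp add: algebra_simps)
  finally show "integral\<^sup>L lborel (energy r \<psi>) \<le> (1 + real DIM('a)) * ?N powr r" .
qed

text \<open>Turns an estimate by powers into one by the norm: take \<open>t = 1 / N\<close>, and for \<open>N = 0\<close> let \<open>t\<close> grow.\<close>

lemma linear_bound_from_scaled_bound:
  fixes I A C N r :: real
  assumes r: "r > 0" and nn: "A \<ge> 0" "C \<ge> 0" "N \<ge> 0" and le: "\<And>t. t > 0 \<Longrightarrow> t * I \<le> A + C * (t * N) powr r"
  shows "I \<le> (A + C) * N"
proof (cases "N = 0")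
  case True
  show ?thesis
  proof (rule ccontr)
    assume "\<not> ?thesis"
    then have "I > 0" using True by simp
    then show False
      using le[of "(A + 1) / I"] nn True by simp
  qed
next
  case False
  then have "N > 0" using nn by simp
  then show ?thesis
    using le[of "1 / N"] by (simp add: field_simps)
qed

lemma boundary_functional_bounded:
  fixes X :: "'m::euclidean_space \<Rightarrow> 'a::euclidean_space"
  assumes dim: "DIM('a) = DIM('m) + 1" and \<Omega>: "open \<Omega>" "\<Omega> \<noteq> {}"
    and \<Theta>: "bounded \<Theta>" "\<Theta> \<in> sets lebesgue" and U: "closure \<Theta> \<subseteq> U" and X: "C1_on U X"
    and inj: "\<And>\<theta>. \<theta> \<in> closure \<Theta> \<Longrightarrow> inj (frechet_derivative X (at \<theta>))"
    and p: "1 \<le> p" "p < \<infinity>" and F: "F \<in> Lp_space (lebesgue_on \<Theta>) p"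
  shows "\<exists>K\<ge>0. \<forall>\<psi>\<in>test_functions \<Omega>. integrable (lebesgue_on \<Theta>) (\<lambda>\<theta>. F \<theta> * \<psi> (X \<theta>)) \<and>
    \<bar>LINT \<theta>|lebesgue_on \<Theta>. F \<theta> * \<psi> (X \<theta>)\<bar> \<le> K * W1_norm \<Omega> (conj_exponent p) \<psi>"
proof -
  have F_meas: "F \<in> borel_measurable (lebesgue_on \<Theta>)"
    using F by (simp add: Lp_space_def)
  have \<Theta>U: "\<Theta> \<subseteq> U" using U closure_subset by blast
  have meas: "(\<lambda>\<theta>. \<psi> (X \<theta>)) \<in> borel_measurable (lebesgue_on \<Theta>)" if "\<psi> \<in> test_functions \<Omega>" for \<psi>
  proof -
    have "continuous_on \<Theta> X"
      by (rule continuous_on_subset[OF C1_on_imp_continuous_on[OF X] \<Theta>U])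
    then have "continuous_on \<Theta> (\<lambda>\<theta>. \<psi> (X \<theta>))"
      by (rule continuous_on_compose2[OF test_function_props(4)[OF that]]) (rule subset_UNIV)
    then show ?thesis
      using \<Theta>(2) by (rule continuous_imp_measurable_on_sets_lebesgue)
  qed
  show ?thesis
  proof (cases rule: conj_exponent_cases[OF p])
    case 1
    have F_int: "integrable (lebesgue_on \<Theta>) F"
      using F F_meas unfolding 1(1) by (subst (asm) Lp_space_finite_iff) (auto simp: integrable_abs_iff)
    let ?K = "LINT \<theta>|lebesgue_on \<Theta>. \<bar>F \<theta>\<bar>"
    have bd: "\<bar>\<psi> x\<bar> \<le> W1_norm \<Omega> \<infinity> \<psi>" if \<psi>: "\<psi> \<in> test_functions \<Omega>" for \<psi> x
    proof -
      note t = test_function_W1[OF \<Omega> _ \<psi>, of \<infinity>, simplified]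
      have Lp: "\<psi> \<in> Lp_space (lebesgue_on \<Omega>) \<infinity>"
        using t(1) by (simp add: W1_def)
      note M = lebesgue_on_open_nonnull[OF \<Omega>]
      have "0 \<le> Lp_norm (lebesgue_on \<Omega>) \<infinity> (weak_partial \<Omega> b \<psi>)" if "b \<in> Basis" for b
        using W1_weak_partial(2)[OF \<Omega>(1) t(1)] that by (intro Lp_norm_nonneg[OF M]) simp
      then have le: "Lp_norm (lebesgue_on \<Omega>) \<infinity> \<psi> \<le> W1_norm \<Omega> \<infinity> \<psi>"
        unfolding W1_norm_def by (simp add: sum_nonneg)
      show ?thesis
      proof (cases "x \<in> \<Omega>")
        case True
        have "continuous_on \<Omega> \<psi>"
          using test_function_props(4)[OF \<psi>] continuous_on_subset by blast
        from abs_le_Lp_norm_infinity[OF \<Omega> this Lp True] le show ?thesis by simp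
      next
        case False
        then have "\<psi> x = 0" using test_function_props(2,6)[OF \<psi>] by blast
        then show ?thesis using le Lp_norm_nonneg[OF M Lp] by simp
      qed
    qed
    have le: "\<bar>F \<theta> * \<psi> (X \<theta>)\<bar> \<le> \<bar>F \<theta>\<bar> * W1_norm \<Omega> \<infinity> \<psi>" if "\<psi> \<in> test_functions \<Omega>" for \<psi> \<theta>
      using bd[OF that] by (simp add: abs_mult mult_left_mono)
    have int: "integrable (lebesgue_on \<Theta>) (\<lambda>\<theta>. F \<theta> * \<psi> (X \<theta>))" if "\<psi> \<in> test_functions \<Omega>" for \<psi>
    proof (rule Bochner_Integration.integrable_bound)
      show "integrable (lebesgue_on \<Theta>) (\<lambda>\<theta>. \<bar>F \<theta>\<bar> * W1_norm \<Omega> \<infinity> \<psi>)"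
        using F_int by simp
      show "AE \<theta> in lebesgue_on \<Theta>. norm (F \<theta> * \<psi> (X \<theta>)) \<le> norm (\<bar>F \<theta>\<bar> * W1_norm \<Omega> \<infinity> \<psi>)"
        using order_trans[OF le[OF that] abs_ge_self] by simp
    qed (use F_meas meas[OF that] in simp)
    show ?thesis
    proof (intro exI[of _ ?K] conjI ballI)
      show "\<bar>LINT \<theta>|lebesgue_on \<Theta>. F \<theta> * \<psi> (X \<theta>)\<bar> \<le> ?K * W1_norm \<Omega> (conj_exponent p) \<psi>"
        if \<psi>: "\<psi> \<in> test_functions \<Omega>" for \<psi>
      proof -
        have "\<bar>LINT \<theta>|lebesgue_on \<Theta>. F \<theta> * \<psi> (X \<theta>)\<bar> \<le> (LINT \<theta>|lebesgue_on \<Theta>. \<bar>F \<theta> * \<psi> (X \<theta>)\<bar>)"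
          by (rule integral_abs_bound)
        also have "\<dots> \<le> (LINT \<theta>|lebesgue_on \<Theta>. \<bar>F \<theta>\<bar> * W1_norm \<Omega> \<infinity> \<psi>)"
          using int[OF \<psi>] F_int le[OF \<psi>] by (intro integral_mono) auto
        finally show ?thesis by (simp add: 1(2))
      qed
    qed (use int in simp_all)
  next
    case (2 s r)
    obtain C where C: "C \<ge> 0" "\<And>\<psi> :: 'a \<Rightarrow> real. \<And>\<Omega>. \<psi> \<in> test_functions \<Omega> \<Longrightarrow>
        (\<integral>\<^sup>+\<theta>. ennreal (\<bar>\<psi> (X \<theta>)\<bar> powr r) \<partial>lebesgue_on \<Theta>) \<le> ennreal C * (\<integral>\<^sup>+y. ennreal (energy r \<psi> y) \<partial>lborel)"
      using trace_inequality[OF dim \<Theta> U X inj 2(2)] by blast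
    have F_int: "integrable (lebesgue_on \<Theta>) (\<lambda>\<theta>. \<bar>F \<theta>\<bar> powr s)"
      using F 2 by (simp add: Lp_space_finite_iff)
    let ?A = "LINT \<theta>|lebesgue_on \<Theta>. \<bar>F \<theta>\<bar> powr s"
    let ?B = "C * (1 + real DIM('a))"
    have A: "?A \<ge> 0" by simp
    have B: "?B \<ge> 0" using C(1) by simp
    have young: "\<bar>F \<theta>\<bar> * \<bar>y\<bar> \<le> \<bar>F \<theta>\<bar> powr s + \<bar>y\<bar> powr r" for \<theta> y
    proof -
      have "\<bar>F \<theta>\<bar> * \<bar>y\<bar> \<le> \<bar>F \<theta>\<bar> powr s / s + \<bar>y\<bar> powr r / r"
        using Youngs_inequality[OF 2(1-3)] by simp
      also have "\<dots> \<le> \<bar>F \<theta>\<bar> powr s + \<bar>y\<bar> powr r"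
        using 2(1,2) by (intro add_mono) (auto simp: divide_le_eq mult_left_le mult_le_cancel_left1)
      finally show ?thesis .
    qed
    have main: "integrable (lebesgue_on \<Theta>) (\<lambda>\<theta>. F \<theta> * \<psi> (X \<theta>)) \<and>
       \<bar>LINT \<theta>|lebesgue_on \<Theta>. F \<theta> * \<psi> (X \<theta>)\<bar> \<le> (?A + ?B) * W1_norm \<Omega> (conj_exponent p) \<psi>"
      if \<psi>: "\<psi> \<in> test_functions \<Omega>" for \<psi>
    proof -
      note e = integral_energy_le[OF \<Omega> 2(2) \<psi>]
      let ?N = "W1_norm \<Omega> (ennreal r) \<psi>"
      have N: "?N \<ge> 0"
        using test_function_W1(1)[OF \<Omega> _ \<psi>, of "ennreal r"] 2(2) by (intro W1_norm_nonneg[OF \<Omega>]) simp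
      have "(\<integral>\<^sup>+\<theta>. ennreal (\<bar>\<psi> (X \<theta>)\<bar> powr r) \<partial>lebesgue_on \<Theta>) \<le> ennreal C * (\<integral>\<^sup>+y. ennreal (energy r \<psi> y) \<partial>lborel)"
        by (rule C(2)[OF \<psi>])
      also have "\<dots> = ennreal (C * integral\<^sup>L lborel (energy r \<psi>))"
        using e(1) C(1) by (simp add: nn_integral_eq_integral energy_nonneg ennreal_mult)
      also have "\<dots> \<le> ennreal (?B * ?N powr r)"
        using mult_left_mono[OF e(2) C(1)] by (intro ennreal_leI) (simp add: mult.assoc)
      finally have nn: "(\<integral>\<^sup>+\<theta>. ennreal (\<bar>\<psi> (X \<theta>)\<bar> powr r) \<partial>lebesgue_on \<Theta>) \<le> ennreal (?B * ?N powr r)" .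
      have \<psi>_int: "integrable (lebesgue_on \<Theta>) (\<lambda>\<theta>. \<bar>\<psi> (X \<theta>)\<bar> powr r)"
        using nn meas[OF \<psi>] by (intro integrableI_bounded) (auto intro: le_less_trans)
      then have tr: "(LINT \<theta>|lebesgue_on \<Theta>. \<bar>\<psi> (X \<theta>)\<bar> powr r) \<le> ?B * ?N powr r"
        using nn B by (simp add: nn_integral_eq_integral ennreal_le_iff)
      have int: "integrable (lebesgue_on \<Theta>) (\<lambda>\<theta>. F \<theta> * \<psi> (X \<theta>))"
      proof (rule Bochner_Integration.integrable_bound)
        show "integrable (lebesgue_on \<Theta>) (\<lambda>\<theta>. \<bar>F \<theta>\<bar> powr s + \<bar>\<psi> (X \<theta>)\<bar> powr r)"
          using F_int \<psi>_int by simp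
        show "AE \<theta> in lebesgue_on \<Theta>. norm (F \<theta> * \<psi> (X \<theta>)) \<le> norm (\<bar>F \<theta>\<bar> powr s + \<bar>\<psi> (X \<theta>)\<bar> powr r)"
          using young by (intro AE_I2) (simp add: abs_mult)
      qed (use F_meas meas[OF \<psi>] in simp)
      \<comment> \<open>Young's inequality for \<open>F\<close> and the rescaled function \<open>t \<psi>\<close>, followed by the trace inequality.\<close>
      have "t * \<bar>LINT \<theta>|lebesgue_on \<Theta>. F \<theta> * \<psi> (X \<theta>)\<bar> \<le> ?A + ?B * (t * ?N) powr r" if t: "t > 0" for t
      proof -
        have "t * \<bar>LINT \<theta>|lebesgue_on \<Theta>. F \<theta> * \<psi> (X \<theta>)\<bar> = \<bar>LINT \<theta>|lebesgue_on \<Theta>. F \<theta> * (t * \<psi> (X \<theta>))\<bar>"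
          using t by (simp add: mult.left_commute[of _ t] abs_mult)
        also have "\<dots> \<le> (LINT \<theta>|lebesgue_on \<Theta>. \<bar>F \<theta> * (t * \<psi> (X \<theta>))\<bar>)"
          by (rule integral_abs_bound)
        also have "\<dots> \<le> (LINT \<theta>|lebesgue_on \<Theta>. \<bar>F \<theta>\<bar> powr s + t powr r * \<bar>\<psi> (X \<theta>)\<bar> powr r)"
        proof (rule integral_mono)
          show "integrable (lebesgue_on \<Theta>) (\<lambda>\<theta>. \<bar>F \<theta> * (t * \<psi> (X \<theta>))\<bar>)"
            using int by (simp add: mult.left_commute[of _ t])
          show "integrable (lebesgue_on \<Theta>) (\<lambda>\<theta>. \<bar>F \<theta>\<bar> powr s + t powr r * \<bar>\<psi> (X \<theta>)\<bar> powr r)"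
            using F_int \<psi>_int by simp
          show "\<bar>F \<theta> * (t * \<psi> (X \<theta>))\<bar> \<le> \<bar>F \<theta>\<bar> powr s + t powr r * \<bar>\<psi> (X \<theta>)\<bar> powr r" for \<theta>
            using young[of \<theta> "t * \<psi> (X \<theta>)"] t by (simp add: abs_mult powr_mult)
        qed
        also have "\<dots> = ?A + t powr r * (LINT \<theta>|lebesgue_on \<Theta>. \<bar>\<psi> (X \<theta>)\<bar> powr r)"
          using F_int \<psi>_int by simp
        also have "\<dots> \<le> ?A + t powr r * (?B * ?N powr r)"
          using tr by (intro add_left_mono mult_left_mono) auto
        also have "\<dots> = ?A + ?B * (t * ?N) powr r"
          by (simp add: powr_mult mult_ac)
        finally show ?thesis .
      qed
      then have "\<bar>LINT \<theta>|lebesgue_on \<Theta>. F \<theta> * \<psi> (X \<theta>)\<bar> \<le> (?A + ?B) * ?N"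
        using 2(2) A B N by (intro linear_bound_from_scaled_bound[of r]) auto
      with int show ?thesis by (simp add: 2(5))
    qed
    have "?A + ?B \<ge> 0" using A B by (rule add_nonneg_nonneg)
    with main show ?thesis by blast
  qed
qed

section \<open>Hahn--Banach extension of seminorm-dominated functionals\<close>

text \<open>Partial extensions are represented by their graphs, that is, by linear relations in \<open>W \<times> \<real>\<close> lying below \<open>N\<close>. Such a
relation is automatically single-valued, since \<open>N 0 = 0\<close>, and unions of chains are again of this kind, so Zorn's
lemma yields a maximal graph; the usual one-dimensional extension step shows that its domain is all of \<open>W\<close>.\<close>

lemma Hahn_Banach_seminorm:
  fixes scale :: "real \<Rightarrow> 'v::ab_group_add \<Rightarrow> 'v" (infixr "\<odot>" 75)
    and N f0 :: "'v \<Rightarrow> real"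
  assumes vs: "vector_space scale" and V: "module.subspace scale V" and W: "module.subspace scale W"
    and VW: "V \<subseteq> W"
    and N_add: "\<And>u v. u \<in> W \<Longrightarrow> v \<in> W \<Longrightarrow> N (u + v) \<le> N u + N v"
    and N_scale: "\<And>c u. u \<in> W \<Longrightarrow> N (c \<odot> u) = \<bar>c\<bar> * N u"
    and f0_add: "\<And>u v. u \<in> V \<Longrightarrow> v \<in> V \<Longrightarrow> f0 (u + v) = f0 u + f0 v"
    and f0_scale: "\<And>c u. u \<in> V \<Longrightarrow> f0 (c \<odot> u) = c * f0 u"
    and f0_le: "\<And>u. u \<in> V \<Longrightarrow> f0 u \<le> N u"
  shows "\<exists>f. (\<forall>u\<in>W. \<forall>v\<in>W. f (u + v) = f u + f v) \<and> (\<forall>c. \<forall>u\<in>W. f (c \<odot> u) = c * f u) \<and>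
    (\<forall>u\<in>W. \<bar>f u\<bar> \<le> N u) \<and> (\<forall>u\<in>V. f u = f0 u)"
proof -
  interpret vector_space scale by (rule vs)
  note W_ops = subspace_add[OF W] subspace_scale[OF W] subspace_diff[OF W]
  define ext :: "('v \<times> real) set \<Rightarrow> bool" where
    "ext G \<longleftrightarrow> (\<lambda>u. (u, f0 u)) ` V \<subseteq> G \<and>
      (\<forall>u r v s. (u, r) \<in> G \<longrightarrow> (v, s) \<in> G \<longrightarrow> (u + v, r + s) \<in> G) \<and>
      (\<forall>c u r. (u, r) \<in> G \<longrightarrow> (c \<odot> u, c * r) \<in> G) \<and>
      (\<forall>u r. (u, r) \<in> G \<longrightarrow> u \<in> W \<and> r \<le> N u)" for G
  have "\<exists>M\<in>Collect ext. \<forall>X\<in>Collect ext. M \<subseteq> X \<longrightarrow> X = M"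
  proof (rule subset_Zorn_nonempty)
    have "ext ((\<lambda>u. (u, f0 u)) ` V)"
      unfolding ext_def
    proof (intro conjI allI impI)
      fix u r v s assume "(u, r) \<in> (\<lambda>u. (u, f0 u)) ` V" "(v, s) \<in> (\<lambda>u. (u, f0 u)) ` V"
      then show "(u + v, r + s) \<in> (\<lambda>u. (u, f0 u)) ` V"
        using f0_add subspace_add[OF V] by (auto intro!: image_eqI[of _ _ "u + v"])
    next
      fix c u r assume "(u, r) \<in> (\<lambda>u. (u, f0 u)) ` V"
      then show "(c \<odot> u, c * r) \<in> (\<lambda>u. (u, f0 u)) ` V"
        using f0_scale subspace_scale[OF V] by (auto intro!: image_eqI[of _ _ "c \<odot> u"])
    next
      fix u r assume "(u, r) \<in> (\<lambda>u. (u, f0 u)) ` V"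
      then show "u \<in> W" "r \<le> N u"
        using f0_le VW by auto
    qed simp
    then show "Collect ext \<noteq> {}" by blast
  next
    fix \<C> assume "\<C> \<noteq> {}" and chain: "subset.chain (Collect ext) \<C>"
    then have ext: "\<And>G. G \<in> \<C> \<Longrightarrow> ext G"
      by (auto simp: subset_chain_def)
    have common: "\<exists>G\<in>\<C>. x \<in> G \<and> y \<in> G" if xy: "x \<in> \<Union>\<C>" "y \<in> \<Union>\<C>" for x y
    proof -
      obtain A B where AB: "A \<in> \<C>" "x \<in> A" "B \<in> \<C>" "y \<in> B"
        using xy by blast
      then have "A \<subseteq> B \<or> B \<subseteq> A"
        using chain unfolding subset_chain_def by blast
      with AB show ?thesis by blast
    qed
    have "(u + v, r + s) \<in> \<Union>\<C>" if uv: "(u, r) \<in> \<Union>\<C>" "(v, s) \<in> \<Union>\<C>" for u r v s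
    proof -
      obtain G where G: "G \<in> \<C>" "(u, r) \<in> G" "(v, s) \<in> G"
        using common[OF uv] by blast
      then have "(u + v, r + s) \<in> G"
        using ext[OF G(1)] unfolding ext_def by blast
      then show ?thesis using G(1) by blast
    qed
    moreover have "(\<lambda>u. (u, f0 u)) ` V \<subseteq> \<Union>\<C>"
      using \<open>\<C> \<noteq> {}\<close> ext unfolding ext_def by blast
    moreover have "(c \<odot> u, c * r) \<in> \<Union>\<C>" "u \<in> W" "r \<le> N u" if ur: "(u, r) \<in> \<Union>\<C>" for c u r
    proof -
      obtain G where G: "G \<in> \<C>" "(u, r) \<in> G"
        using ur by blast
      then have "(c \<odot> u, c * r) \<in> G" "u \<in> W" "r \<le> N u"
        using ext[OF G(1)] unfolding ext_def by blast+
      then show "(c \<odot> u, c * r) \<in> \<Union>\<C>" "u \<in> W" "r \<le> N u"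
        using G(1) by blast+
    qed
    ultimately have "ext (\<Union>\<C>)"
      unfolding ext_def by (intro conjI allI impI)
    then show "\<Union>\<C> \<in> Collect ext" by simp
  qed
  then obtain M where M: "ext M" and max: "\<And>X. ext X \<Longrightarrow> M \<subseteq> X \<Longrightarrow> X = M"
    by blast
  have M_add: "(u + v, r + s) \<in> M" if "(u, r) \<in> M" "(v, s) \<in> M" for u r v s
    using M that unfolding ext_def by blast
  have M_scale: "(c \<odot> u, c * r) \<in> M" if "(u, r) \<in> M" for c u r
    using M that unfolding ext_def by blast
  have M_W: "u \<in> W" and M_le: "r \<le> N u" if "(u, r) \<in> M" for u r
    using M that unfolding ext_def by blast+
  have M_f0: "(u, f0 u) \<in> M" if "u \<in> V" for u
    using M that unfolding ext_def by blast
  have M_0: "(0, 0) \<in> M"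
    using M_scale[OF M_f0[OF subspace_0[OF V]], of 0] by simp
  have unique: "r = s" if "(u, r) \<in> M" "(u, s) \<in> M" for u r s
  proof -
    have "r' \<le> s'" if "(u, r') \<in> M" "(u, s') \<in> M" for r' s'
      using M_le[OF M_add[OF that(1) M_scale[OF that(2), of "-1"]]] N_scale[OF M_W[OF M_0], of 0] by simp
    with that show ?thesis by (meson antisym)
  qed
  have total: "\<exists>r. (x, r) \<in> M" if x: "x \<in> W" for x
  proof (rule ccontr)
    assume no: "\<nexists>r. (x, r) \<in> M"
    have le: "r - N (u - x) \<le> N (v + x) - s" if "(u, r) \<in> M" "(v, s) \<in> M" for u r v s
    proof -
      have "r + s \<le> N (u + v)"
        using M_le M_add that by blast
      also have "u + v = (u - x) + (v + x)" by simp
      also have "N \<dots> \<le> N (u - x) + N (v + x)"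
        using M_W that x by (intro N_add W_ops)
      finally show ?thesis by simp
    qed
    \<comment> \<open>By \<open>le\<close>, any value between this supremum and the infimum of \<open>N (v + x) - s\<close> may be assigned to \<open>x\<close>.\<close>
    define a where "a = (SUP (u, r)\<in>M. r - N (u - x))"
    have bdd: "bdd_above ((\<lambda>(u, r). r - N (u - x)) ` M)"
      using le[OF _ M_0] by (intro bdd_aboveI2) auto
    have a_ge: "r - N (u - x) \<le> a" if "(u, r) \<in> M" for u r
      unfolding a_def using cSUP_upper[OF that bdd] by simp
    have a_le: "a \<le> N (v + x) - s" if "(v, s) \<in> M" for v s
      unfolding a_def using le[OF _ that] M_0 by (intro cSUP_least) auto
    define M' where "M' = {(u + t \<odot> x, r + t * a) |u r t. (u, r) \<in> M}"
    have dom: "r + t * a \<le> N (u + t \<odot> x)" if ur: "(u, r) \<in> M" for u r t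
    proof -
      consider "t = 0" | "t > 0" | "t < 0" by linarith
      then show ?thesis
      proof cases
        case 1
        then show ?thesis using M_le[OF ur] by simp
      next
        case 2
        have u': "(inverse t \<odot> u, inverse t * r) \<in> M"
          using M_scale ur by blast
        have "r + t * a \<le> t * N (inverse t \<odot> u + x)"
        proof -
          have "t * a \<le> t * (N (inverse t \<odot> u + x) - inverse t * r)"
            using a_le[OF u'] 2 by (intro mult_left_mono) auto
          moreover have "t * (inverse t * r) = r"
            using 2 by simp
          ultimately show ?thesis
            unfolding right_diff_distrib by linarith
        qed
        also have "\<dots> = N (t \<odot> (inverse t \<odot> u + x))"
          using N_scale[of _ t] 2 M_W[OF u'] x W_ops by simp
        also have "t \<odot> (inverse t \<odot> u + x) = u + t \<odot> x"
          using 2 by (simp add: scale_right_distrib)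
        finally show ?thesis .
      next
        case 3
        have u': "(inverse (- t) \<odot> u, inverse (- t) * r) \<in> M"
          using M_scale ur by blast
        have "r + t * a \<le> (- t) * N (inverse (- t) \<odot> u - x)"
        proof -
          have "(- t) * (inverse (- t) * r - N (inverse (- t) \<odot> u - x)) \<le> (- t) * a"
            using a_ge[OF u'] 3 by (intro mult_left_mono) auto
          moreover have "(- t) * (inverse (- t) * r) = r"
            using 3 by simp
          ultimately show ?thesis
            unfolding right_diff_distrib by linarith
        qed
        also have "\<dots> = N ((- t) \<odot> (inverse (- t) \<odot> u - x))"
          using N_scale[of _ "- t"] 3 M_W[OF u'] x W_ops by simp
        also have "(- t) \<odot> (inverse (- t) \<odot> u - x) = u + t \<odot> x"
          using 3 by (simp add: scale_right_diff_distrib)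
        finally show ?thesis .
      qed
    qed
    have M_M': "M \<subseteq> M'"
      unfolding M'_def by (clarsimp, metis add.right_neutral mult_zero_left scale_zero_left)
    have "ext M'"
      unfolding ext_def
    proof (intro conjI allI impI)
      show "(\<lambda>u. (u, f0 u)) ` V \<subseteq> M'"
        using M_M' M_f0 by blast
    next
      fix u r v s assume "(u, r) \<in> M'" "(v, s) \<in> M'"
      then obtain u' r' t v' s' t' where *: "(u', r') \<in> M" "u = u' + t \<odot> x" "r = r' + t * a"
        "(v', s') \<in> M" "v = v' + t' \<odot> x" "s = s' + t' * a"
        unfolding M'_def by blast
      then have "u + v = (u' + v') + (t + t') \<odot> x" "r + s = (r' + s') + (t + t') * a"
        by (auto simp: algebra_simps scale_left_distrib)
      then show "(u + v, r + s) \<in> M'"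
        using M_add[OF *(1) *(4)] unfolding M'_def by blast
    next
      fix c u r assume "(u, r) \<in> M'"
      then obtain u' r' t where *: "(u', r') \<in> M" "u = u' + t \<odot> x" "r = r' + t * a"
        unfolding M'_def by blast
      then have "c \<odot> u = c \<odot> u' + (c * t) \<odot> x" "c * r = c * r' + (c * t) * a"
        by (auto simp: algebra_simps scale_right_distrib)
      then show "(c \<odot> u, c * r) \<in> M'"
        using M_scale[OF *(1)] unfolding M'_def by blast
    next
      fix u r assume "(u, r) \<in> M'"
      then show "u \<in> W" "r \<le> N u"
        using dom M_W x W_ops by (auto simp: M'_def)
    qed
    then have "M' = M" using max M_M' by blast
    moreover have "(x, a) \<in> M'"
      unfolding M'_def using M_0 by (force intro: exI[of _ 0] exI[of _ 1])
    ultimately show False using no by blast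
  qed
  define f where "f u = (THE r. (u, r) \<in> M)" for u
  have f: "f u = r" if "(u, r) \<in> M" for u r
    unfolding f_def using that unique by blast
  have f_M: "(u, f u) \<in> M" if "u \<in> W" for u
    using total[OF that] f by blast
  show ?thesis
  proof (intro exI[of _ f] conjI ballI allI)
    show "f (u + v) = f u + f v" if "u \<in> W" "v \<in> W" for u v
      using f M_add f_M that by blast
    show "f (c \<odot> u) = c * f u" if "u \<in> W" for c u
      using f M_scale f_M that by blast
    show "f u = f0 u" if "u \<in> V" for u
      using f M_f0 that by blast
    show "\<bar>f u\<bar> \<le> N u" if "u \<in> W" for u
      using M_le[OF f_M[OF that]] M_le[OF M_scale[OF f_M[OF that], of "-1"]] N_scale[OF that, of "-1"]
      by simp
  qed
qed

text \<open>Pointwise operations make the real functions on any set an instance of the hypothesis of \<open>Hahn_Banach_seminorm\<close>.\<close>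

lemma vector_space_functions: "vector_space (\<lambda>c (u :: 'a \<Rightarrow> real) x. c * u x)"
  by unfold_locales (auto simp: fun_eq_iff algebra_simps)

section \<open>Extension to the Sobolev space\<close>

lemma boundary_functional_extends:
  fixes X :: "'m::euclidean_space \<Rightarrow> 'a::euclidean_space"
  assumes dim: "DIM('a) = DIM('m) + 1" and \<Omega>: "open \<Omega>" "\<Omega> \<noteq> {}"
    and \<Theta>: "bounded \<Theta>" "\<Theta> \<in> sets lebesgue" and U: "closure \<Theta> \<subseteq> U" and X: "C1_on U X"
    and inj: "\<And>\<theta>. \<theta> \<in> closure \<Theta> \<Longrightarrow> inj (frechet_derivative X (at \<theta>))"
    and p: "1 \<le> p" "p < \<infinity>" and F: "F \<in> Lp_space (lebesgue_on \<Theta>) p"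
  shows "\<exists>f \<in> dual_space (W1 \<Omega> (conj_exponent p)) (W1_norm \<Omega> (conj_exponent p)).
    \<forall>\<psi> \<in> test_functions \<Omega>. integrable (lebesgue_on \<Theta>) (\<lambda>\<theta>. F \<theta> * \<psi> (X \<theta>)) \<and>
      f \<psi> = (LINT \<theta>|lebesgue_on \<Theta>. F \<theta> * \<psi> (X \<theta>))"
proof -
  define q where "q = conj_exponent p"
  have q: "1 \<le> q"
    unfolding q_def by (cases rule: conj_exponent_cases[OF p]) auto
  obtain K where K: "K \<ge> 0"
    and int: "\<And>\<psi>. \<psi> \<in> test_functions \<Omega> \<Longrightarrow> integrable (lebesgue_on \<Theta>) (\<lambda>\<theta>. F \<theta> * \<psi> (X \<theta>))"
    and le: "\<And>\<psi>. \<psi> \<in> test_functions \<Omega> \<Longrightarrow> \<bar>LINT \<theta>|lebesgue_on \<Theta>. F \<theta> * \<psi> (X \<theta>)\<bar> \<le> K * W1_norm \<Omega> q \<psi>"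
    using boundary_functional_bounded[OF dim \<Omega> \<Theta> U X inj p F] unfolding q_def by blast
  let ?sc = "\<lambda>c (u :: 'a \<Rightarrow> real) x. c * u x"
  let ?f0 = "\<lambda>\<psi>. LINT \<theta>|lebesgue_on \<Theta>. F \<theta> * \<psi> (X \<theta>)"
  interpret fs: vector_space ?sc by (rule vector_space_functions)
  have zero: "(0 :: 'a \<Rightarrow> real) \<in> test_functions \<Omega>"
    by (simp add: test_functions_def zero_fun_def Ck_const)
  have V: "fs.subspace (test_functions \<Omega>)"
    unfolding fs.subspace_def plus_fun_def using zero test_functions_add test_functions_scale by blast
  have VW: "test_functions \<Omega> \<subseteq> W1 \<Omega> q"
    using test_function_W1(1)[OF \<Omega> q] by blast
  have W: "fs.subspace (W1 \<Omega> q)"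
    unfolding fs.subspace_def plus_fun_def using zero VW W1_add(1)[OF q \<Omega>] W1_scale(1)[OF q \<Omega>] by blast
  have "\<exists>f. (\<forall>u\<in>W1 \<Omega> q. \<forall>v\<in>W1 \<Omega> q. f (u + v) = f u + f v) \<and>
    (\<forall>c. \<forall>u\<in>W1 \<Omega> q. f (?sc c u) = c * f u) \<and>
    (\<forall>u\<in>W1 \<Omega> q. \<bar>f u\<bar> \<le> K * W1_norm \<Omega> q u) \<and> (\<forall>u\<in>test_functions \<Omega>. f u = ?f0 u)"
  proof (rule Hahn_Banach_seminorm[OF fs.vector_space_axioms V W VW])
    fix u v assume uv: "u \<in> W1 \<Omega> q" "v \<in> W1 \<Omega> q"
    show "K * W1_norm \<Omega> q (u + v) \<le> K * W1_norm \<Omega> q u + K * W1_norm \<Omega> q v"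
      using mult_left_mono[OF W1_add(2)[OF q \<Omega> uv] K] by (simp add: plus_fun_def distrib_left)
  next
    fix c u assume "u \<in> W1 \<Omega> q"
    then show "K * W1_norm \<Omega> q (?sc c u) = \<bar>c\<bar> * (K * W1_norm \<Omega> q u)"
      by (simp add: W1_scale(2)[OF q \<Omega>])
  next
    fix u v assume uv: "u \<in> test_functions \<Omega>" "v \<in> test_functions \<Omega>"
    then show "?f0 (u + v) = ?f0 u + ?f0 v"
      using int by (simp add: plus_fun_def distrib_left)
  next
    fix c u assume "u \<in> test_functions \<Omega>"
    show "?f0 (?sc c u) = c * ?f0 u"
      by (simp add: mult.left_commute[of _ c])
  next
    fix u assume "u \<in> test_functions \<Omega>"
    then show "?f0 u \<le> K * W1_norm \<Omega> q u"
      using le abs_le_D1 by blast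
  qed
  then obtain f where f: "\<forall>u\<in>W1 \<Omega> q. \<forall>v\<in>W1 \<Omega> q. f (u + v) = f u + f v"
    "\<forall>c. \<forall>u\<in>W1 \<Omega> q. f (?sc c u) = c * f u"
    "\<forall>u\<in>W1 \<Omega> q. \<bar>f u\<bar> \<le> K * W1_norm \<Omega> q u" "\<forall>u\<in>test_functions \<Omega>. f u = ?f0 u"
    by blast
  have "f \<in> dual_space (W1 \<Omega> q) (W1_norm \<Omega> q)"
    using f(1-3) unfolding dual_space_def plus_fun_def real_scaleR_def by blast
  then show ?thesis
    unfolding q_def[symmetric] using f(4) int by blast
qed

text \<open>Each component of \<open>F\<close> gives a scalar functional, and their sum acts on vector fields.\<close>

lemma boundary_force_in_dual:
  fixes X :: "'m::euclidean_space \<Rightarrow> real ^ 'n" and F :: "'m \<Rightarrow> real ^ 'n"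
  assumes dim: "CARD('n) = DIM('m) + 1" and \<Omega>: "open \<Omega>" "\<Omega> \<noteq> {}"
    and \<Theta>: "bounded \<Theta>" "\<Theta> \<in> sets lebesgue" and U: "closure \<Theta> \<subseteq> U" and X: "C1_on U X"
    and inj: "\<And>\<theta>. \<theta> \<in> closure \<Theta> \<Longrightarrow> inj (frechet_derivative X (at \<theta>))"
    and p: "1 \<le> p" "p < \<infinity>" and F: "F \<in> vec_space (Lp_space (lebesgue_on \<Theta>) p)"
  shows "\<exists>f \<in> W_minus1_vec \<Omega> p. \<forall>\<phi> \<in> vec_space (test_functions \<Omega>).
               integrable (lebesgue_on \<Theta>) (\<lambda>\<theta>. F \<theta> \<bullet> \<phi> (X \<theta>)) \<and>
               f \<phi> = (LINT \<theta>|lebesgue_on \<Theta>. F \<theta> \<bullet> \<phi> (X \<theta>))"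
proof -
  define q where "q = conj_exponent p"
  have dim': "DIM(real ^ 'n) = DIM('m) + 1" using dim by simp
  have "\<forall>i. \<exists>f. f \<in> dual_space (W1 \<Omega> q) (W1_norm \<Omega> q) \<and>
      (\<forall>\<psi> \<in> test_functions \<Omega>. integrable (lebesgue_on \<Theta>) (\<lambda>\<theta>. F \<theta> $ i * \<psi> (X \<theta>)) \<and>
        f \<psi> = (LINT \<theta>|lebesgue_on \<Theta>. F \<theta> $ i * \<psi> (X \<theta>)))"
  proof
    fix i
    have "(\<lambda>\<theta>. F \<theta> $ i) \<in> Lp_space (lebesgue_on \<Theta>) p"
      using F by (simp add: vec_space_def)
    from boundary_functional_extends[OF dim' \<Omega> \<Theta> U X inj p this]
    show "\<exists>f. f \<in> dual_space (W1 \<Omega> q) (W1_norm \<Omega> q) \<and>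
      (\<forall>\<psi> \<in> test_functions \<Omega>. integrable (lebesgue_on \<Theta>) (\<lambda>\<theta>. F \<theta> $ i * \<psi> (X \<theta>)) \<and>
        f \<psi> = (LINT \<theta>|lebesgue_on \<Theta>. F \<theta> $ i * \<psi> (X \<theta>)))"
      unfolding q_def by blast
  qed
  from choice[OF this] obtain f where f: "\<And>i. f i \<in> dual_space (W1 \<Omega> q) (W1_norm \<Omega> q)"
    "\<And>i \<psi>. \<psi> \<in> test_functions \<Omega> \<Longrightarrow> integrable (lebesgue_on \<Theta>) (\<lambda>\<theta>. F \<theta> $ i * \<psi> (X \<theta>))"
    "\<And>i \<psi>. \<psi> \<in> test_functions \<Omega> \<Longrightarrow> f i \<psi> = (LINT \<theta>|lebesgue_on \<Theta>. F \<theta> $ i * \<psi> (X \<theta>))"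
    by blast
  have "\<forall>i. \<exists>C. \<forall>u\<in>W1 \<Omega> q. \<bar>f i u\<bar> \<le> C * W1_norm \<Omega> q u"
    using f(1) by (simp add: dual_space_def)
  from choice[OF this] obtain C where C: "\<And>i u. u \<in> W1 \<Omega> q \<Longrightarrow> \<bar>f i u\<bar> \<le> C i * W1_norm \<Omega> q u"
    by blast
  have f_add: "f i (\<lambda>x. u x + v x) = f i u + f i v" if "u \<in> W1 \<Omega> q" "v \<in> W1 \<Omega> q" for i u v
    using f(1)[of i] that by (simp add: dual_space_def)
  have f_scale: "f i (\<lambda>x. c *\<^sub>R u x) = c * f i u" if "u \<in> W1 \<Omega> q" for i c u
    using f(1)[of i] that by (simp add: dual_space_def)
  define g where "g u = (\<Sum>i\<in>UNIV. f i (\<lambda>x. u x $ i))" for u :: "real ^ 'n \<Rightarrow> real ^ 'n"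
  have comp: "(\<lambda>x. u x $ i) \<in> W1 \<Omega> q" if "u \<in> vec_space (W1_0 \<Omega> q)" for u :: "real ^ 'n \<Rightarrow> real ^ 'n" and i
    using that by (simp add: vec_space_def W1_0_def)
  have "g \<in> W_minus1_vec \<Omega> p"
    unfolding W_minus1_vec_def dual_space_def q_def[symmetric]
  proof (intro CollectI conjI ballI allI)
    fix u v :: "real ^ 'n \<Rightarrow> real ^ 'n" assume "u \<in> vec_space (W1_0 \<Omega> q)" "v \<in> vec_space (W1_0 \<Omega> q)"
    then have "f i (\<lambda>x. u x $ i + v x $ i) = f i (\<lambda>x. u x $ i) + f i (\<lambda>x. v x $ i)" for i
      by (intro f_add comp)
    then show "g (\<lambda>x. u x + v x) = g u + g v"
      by (simp add: g_def sum.distrib)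
  next
    fix c and u :: "real ^ 'n \<Rightarrow> real ^ 'n" assume "u \<in> vec_space (W1_0 \<Omega> q)"
    then have "f i (\<lambda>x. c *\<^sub>R (u x $ i)) = c * f i (\<lambda>x. u x $ i)" for i
      by (intro f_scale comp)
    then show "g (\<lambda>x. c *\<^sub>R u x) = c * g u"
      by (simp add: g_def sum_distrib_left)
  next
    have "\<bar>g u\<bar> \<le> (\<Sum>i\<in>UNIV. \<bar>C i\<bar>) * vec_norm (W1_norm \<Omega> q) u" if u: "u \<in> vec_space (W1_0 \<Omega> q)" for u
    proof -
      have nn: "0 \<le> W1_norm \<Omega> q (\<lambda>x. u x $ i)" for i
        using comp[OF u] by (rule W1_norm_nonneg[OF \<Omega>])
      have "\<bar>g u\<bar> \<le> (\<Sum>i\<in>UNIV. \<bar>f i (\<lambda>x. u x $ i)\<bar>)"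
        unfolding g_def by (rule sum_abs)
      also have "\<dots> \<le> (\<Sum>i\<in>UNIV. (\<Sum>i\<in>UNIV. \<bar>C i\<bar>) * W1_norm \<Omega> q (\<lambda>x. u x $ i))"
      proof (rule sum_mono)
        fix i
        have "\<bar>f i (\<lambda>x. u x $ i)\<bar> \<le> C i * W1_norm \<Omega> q (\<lambda>x. u x $ i)"
          by (rule C[OF comp[OF u]])
        also have "\<dots> \<le> (\<Sum>i\<in>UNIV. \<bar>C i\<bar>) * W1_norm \<Omega> q (\<lambda>x. u x $ i)"
        proof (rule mult_right_mono[OF _ nn])
          have "\<bar>C i\<bar> \<le> (\<Sum>i\<in>UNIV. \<bar>C i\<bar>)"
            by (rule member_le_sum) auto
          then show "C i \<le> (\<Sum>i\<in>UNIV. \<bar>C i\<bar>)" by linarith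
        qed
        finally show "\<bar>f i (\<lambda>x. u x $ i)\<bar> \<le> (\<Sum>i\<in>UNIV. \<bar>C i\<bar>) * W1_norm \<Omega> q (\<lambda>x. u x $ i)" .
      qed
      also have "\<dots> = (\<Sum>i\<in>UNIV. \<bar>C i\<bar>) * vec_norm (W1_norm \<Omega> q) u"
        by (simp add: vec_norm_def sum_distrib_left)
      finally show ?thesis .
    qed
    then show "\<exists>C. \<forall>u\<in>vec_space (W1_0 \<Omega> q). \<bar>g u\<bar> \<le> C * vec_norm (W1_norm \<Omega> q) u"
      by blast
  qed
  moreover have "integrable (lebesgue_on \<Theta>) (\<lambda>\<theta>. F \<theta> \<bullet> \<phi> (X \<theta>)) \<and>
       g \<phi> = (LINT \<theta>|lebesgue_on \<Theta>. F \<theta> \<bullet> \<phi> (X \<theta>))" if "\<phi> \<in> vec_space (test_functions \<Omega>)" for \<phi>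
  proof -
    have t: "(\<lambda>x. \<phi> x $ i) \<in> test_functions \<Omega>" for i
      using that by (simp add: vec_space_def)
    show ?thesis
      using f(2)[OF t] f(3)[OF t] by (simp add: inner_vec_def g_def integral_sum)
  qed
  ultimately show ?thesis by blast
qed

section \<open>Non-degenerate Jacobians and the theorem\<close>

lemma partial_deriv_component:
  fixes X :: "'m::euclidean_space \<Rightarrow> real ^ 'n"
  assumes "X differentiable (at \<theta>)"
  shows "partial_deriv b (\<lambda>t. X t $ i) \<theta> = frechet_derivative X (at \<theta>) b $ i"
proof (rule partial_deriv_eqI)
  show "((\<lambda>t. X t $ i) has_derivative (\<lambda>h. frechet_derivative X (at \<theta>) h $ i)) (at \<theta>)"
    using assms unfolding frechet_derivative_works by (rule bounded_linear.has_derivative[OF bounded_linear_vec_nth])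
qed

lemma J2_nonzero_imp_inj:
  assumes X: "X differentiable (at \<theta>)" and J: "J2 X \<theta> \<noteq> 0"
  shows "inj (frechet_derivative X (at \<theta>))"
proof -
  let ?D = "frechet_derivative X (at \<theta>)"
  have lin: "linear ?D"
    using X unfolding frechet_derivative_works by (rule has_derivative_linear)
  have "?D 1 \<noteq> 0"
    using J by (auto simp: J2_def partial_deriv_component[OF X])
  moreover have "?D h = h *\<^sub>R ?D 1" for h
    using linear_scale[OF lin, of h 1] by simp
  ultimately show ?thesis
    unfolding linear_injective_0[OF lin] by (metis scaleR_eq_0_iff)
qed

text \<open>If a nontrivial combination of the two columns of the derivative vanishes, so do all \<open>2 \<times> 2\<close> minors.\<close>

lemma J3_nonzero_imp_inj:
  assumes X: "X differentiable (at \<theta>)" and J: "J3 X \<theta> \<noteq> 0"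
  shows "inj (frechet_derivative X (at \<theta>))"
proof -
  let ?D = "frechet_derivative X (at \<theta>)"
  let ?a = "?D (axis 1 1)" and ?b = "?D (axis 2 1)"
  have lin: "linear ?D"
    using X unfolding frechet_derivative_works by (rule has_derivative_linear)
  have D: "?D h = h $ 1 *\<^sub>R ?a + h $ 2 *\<^sub>R ?b" for h :: "real ^ 2"
  proof -
    have "h = h $ 1 *\<^sub>R axis 1 1 + h $ 2 *\<^sub>R axis 2 1"
      by (simp add: vec_eq_iff forall_2 axis_def)
    then show ?thesis
      by (metis linear_add[OF lin] linear_scale[OF lin])
  qed
  have "h = 0" if h: "?D h = 0" for h :: "real ^ 2"
  proof (rule ccontr)
    assume "h \<noteq> 0"
    then have ne: "h $ 1 \<noteq> 0 \<or> h $ 2 \<noteq> 0"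
      by (auto simp: vec_eq_iff forall_2)
    have c: "h $ 1 * ?a $ i + h $ 2 * ?b $ i = 0" for i
      using arg_cong[OF h[unfolded D[of h]], of "\<lambda>v. v $ i"] by simp
    have "jacobian_minor X i j \<theta> = 0" for i j
    proof -
      have m: "jacobian_minor X i j \<theta> = ?a $ i * ?b $ j - ?b $ i * ?a $ j"
        by (simp add: jacobian_minor_def partial_deriv_component[OF X])
      have "h $ 1 * jacobian_minor X i j \<theta> = 0" "h $ 2 * jacobian_minor X i j \<theta> = 0"
        unfolding m using c[of i] c[of j] by algebra+
      then show ?thesis using ne by auto
    qed
    then show False using J by (simp add: J3_def)
  qed
  then show ?thesis
    unfolding linear_injective_0[OF lin] by blast
qed

lemma immersed_boundary_force_in_dual:
  fixes X :: "'m::euclidean_space \<Rightarrow> real ^ 'n" and F :: "'m \<Rightarrow> real ^ 'n"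
  assumes dim: "CARD('n) = DIM('m) + 1" and B: "immersed_boundary \<Omega> \<Omega>\<^sub>0 \<Omega>\<^sub>1 \<Gamma> \<Theta> X"
    and inj: "\<And>\<theta>. \<theta> \<in> closure \<Theta> \<Longrightarrow> X differentiable (at \<theta>) \<Longrightarrow> inj (frechet_derivative X (at \<theta>))"
    and p: "1 \<le> p" "p < \<infinity>" and F: "F \<in> vec_space (Lp_space (lebesgue_on \<Theta>) p)"
  shows "\<exists>f \<in> W_minus1_vec \<Omega> p. \<forall>\<phi> \<in> vec_space (test_functions \<Omega>).
               integrable (lebesgue_on \<Theta>) (\<lambda>\<theta>. F \<theta> \<bullet> \<phi> (X \<theta>)) \<and>
               f \<phi> = (LINT \<theta>|lebesgue_on \<Theta>. F \<theta> \<bullet> \<phi> (X \<theta>))"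
proof -
  obtain U where U: "closure \<Theta> \<subseteq> U" "C1_on U X"
    using B by (auto simp: immersed_boundary_def)
  have "open \<Omega>" "\<Omega> \<noteq> {}" "bounded \<Theta>" "\<Theta> \<in> sets lebesgue"
    using B by (simp_all add: immersed_boundary_def polyhedral_domain_def)
  moreover have "inj (frechet_derivative X (at \<theta>))" if "\<theta> \<in> closure \<Theta>" for \<theta>
    using inj[OF that] subsetD[OF U(1) that] U(2) by (simp add: C1_on_def)
  ultimately show ?thesis
    by (intro boundary_force_in_dual[OF dim _ _ _ _ U _ p F])
qed

theorem proposition2:
  fixes p :: ennreal
  assumes "1 \<le> p" and "p < \<infinity>"
  shows "(\<forall>(\<Omega> :: (real ^ 2) set) \<Omega>\<^sub>0 \<Omega>\<^sub>1 \<Gamma> (\<Theta> :: real set) X (F :: real \<Rightarrow> real ^ 2).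
            immersed_boundary_2 \<Omega> \<Omega>\<^sub>0 \<Omega>\<^sub>1 \<Gamma> \<Theta> X \<and> F \<in> vec_space (Lp_space (lebesgue_on \<Theta>) p) \<longrightarrow>
            (\<exists>f \<in> W_minus1_vec \<Omega> p. \<forall>\<phi> \<in> vec_space (test_functions \<Omega>).
               integrable (lebesgue_on \<Theta>) (\<lambda>\<theta>. F \<theta> \<bullet> \<phi> (X \<theta>)) \<and>
               f \<phi> = (LINT \<theta>|lebesgue_on \<Theta>. F \<theta> \<bullet> \<phi> (X \<theta>)))) \<and>
         (\<forall>(\<Omega> :: (real ^ 3) set) \<Omega>\<^sub>0 \<Omega>\<^sub>1 \<Gamma> (\<Theta> :: (real ^ 2) set) X (F :: real ^ 2 \<Rightarrow> real ^ 3).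
            immersed_boundary_3 \<Omega> \<Omega>\<^sub>0 \<Omega>\<^sub>1 \<Gamma> \<Theta> X \<and> F \<in> vec_space (Lp_space (lebesgue_on \<Theta>) p) \<longrightarrow>
            (\<exists>f \<in> W_minus1_vec \<Omega> p. \<forall>\<phi> \<in> vec_space (test_functions \<Omega>).
               integrable (lebesgue_on \<Theta>) (\<lambda>\<theta>. F \<theta> \<bullet> \<phi> (X \<theta>)) \<and>
               f \<phi> = (LINT \<theta>|lebesgue_on \<Theta>. F \<theta> \<bullet> \<phi> (X \<theta>))))"
proof (intro conjI allI impI)
  fix \<Omega> \<Omega>\<^sub>0 \<Omega>\<^sub>1 \<Gamma> :: "(real ^ 2) set" and \<Theta> :: "real set" and X F :: "real \<Rightarrow> real ^ 2"
  assume "immersed_boundary_2 \<Omega> \<Omega>\<^sub>0 \<Omega>\<^sub>1 \<Gamma> \<Theta> X \<and> F \<in> vec_space (Lp_space (lebesgue_on \<Theta>) p)"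
  then show "\<exists>f \<in> W_minus1_vec \<Omega> p. \<forall>\<phi> \<in> vec_space (test_functions \<Omega>).
               integrable (lebesgue_on \<Theta>) (\<lambda>\<theta>. F \<theta> \<bullet> \<phi> (X \<theta>)) \<and>
               f \<phi> = (LINT \<theta>|lebesgue_on \<Theta>. F \<theta> \<bullet> \<phi> (X \<theta>))"
    unfolding immersed_boundary_2_def using J2_nonzero_imp_inj assms
    by (intro immersed_boundary_force_in_dual[where \<Omega>\<^sub>0 = \<Omega>\<^sub>0 and \<Omega>\<^sub>1 = \<Omega>\<^sub>1 and \<Gamma> = \<Gamma>]) simp_all
next
  fix \<Omega> \<Omega>\<^sub>0 \<Omega>\<^sub>1 \<Gamma> :: "(real ^ 3) set" and \<Theta> :: "(real ^ 2) set" and X F :: "real ^ 2 \<Rightarrow> real ^ 3"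
  assume "immersed_boundary_3 \<Omega> \<Omega>\<^sub>0 \<Omega>\<^sub>1 \<Gamma> \<Theta> X \<and> F \<in> vec_space (Lp_space (lebesgue_on \<Theta>) p)"
  then show "\<exists>f \<in> W_minus1_vec \<Omega> p. \<forall>\<phi> \<in> vec_space (test_functions \<Omega>).
               integrable (lebesgue_on \<Theta>) (\<lambda>\<theta>. F \<theta> \<bullet> \<phi> (X \<theta>)) \<and>
               f \<phi> = (LINT \<theta>|lebesgue_on \<Theta>. F \<theta> \<bullet> \<phi> (X \<theta>))"
    unfolding immersed_boundary_3_def using J3_nonzero_imp_inj assms
    by (intro immersed_boundary_force_in_dual[where \<Omega>\<^sub>0 = \<Omega>\<^sub>0 and \<Omega>\<^sub>1 = \<Omega>\<^sub>1 and \<Gamma> = \<Gamma>]) simp_all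
qed

end
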